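(* Let $\mathbb{K}$ be a field of characteristic zero and let $(L,\psi)$ be a quadratic Lie algebra over $\mathbb{K}$. The following assertions are equivalent: (a) $(L,\psi)$ is a non-semisimple indecomposable quadratic Lie algebra such that $\psi$ has Witt index $1$. (b) $L=\mathfrak{d}(V,\varphi,\delta)$ is a $\mathbb{K}$-oscillator algebra (that is, $(L,\psi)$ is isometrically isomorphic to some $(\mathfrak{d}(V,\varphi,\delta),\varphi_\delta)$ with $\delta$ an automorphism), and $\varphi(v,v)\neq 0$ for all nonzero $v\in V$. Lie algebras that satisfy one of the previous equivalent conditions are double extensions $\mathfrak{d}(V,\varphi,\delta)$ of an abelian quadratic algebra $(V,\varphi)$ by a $\varphi$-skew semisimple automorphism $\delta$. Even more, any irreducible polynomial in the factorization of the minimal polynomial $m_\delta(x)$ is of the form $\pi(x)=x^{2n}-a_{n-1}x^{2(n-1)}-\dots-a_1x^2-a_0\in\mathbb{K}[x]$ with $n\ge 1$.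
   Context: A quadratic Lie algebra $(L,\psi)$ is a finite-dimensional Lie algebra $L$ with a non-degenerate symmetric bilinear form $\psi$ that is invariant: $\psi([x,y],z)+\psi(y,[x,z])=0$. It is decomposable if it contains a proper nonzero ideal $I$ with $I\cap I^\perp=0$, and indecomposable otherwise. The Witt index of $\psi$ is the maximal dimension of a totally isotropic subspace. An isometric isomorphism is a Lie algebra isomorphism preserving the forms. $\mathbb{K}$-oscillator algebra: let $V$ be a finite-dimensional $\mathbb{K}$-vector space with $\dim V\ge 2$, $\varphi$ a non-degenerate symmetric bilinear form on $V$, and $\delta\colon V\to V$ a $\varphi$-skew linear automorphism, i.e. a bijective linear map with $\varphi(\delta(x),y)=-\varphi(x,\delta(y))$. Then $\mathfrak{d}(V,\varphi,\delta)=\mathbb{K}\cdot\delta\oplus V\oplus\mathbb{K}\cdot\delta^*$ (the one-dimensional-by-abelian double extension), where $\delta$ and $\delta^*$ are used as basis symbols of one-dimensional spaces, is the Lie algebra with bracket $$[t\delta+x+s\delta^*,t'\delta+y+s'\delta^*]=t\,\delta(y)-t'\,\delta(x)+\varphi(\delta(x),y)\,\delta^*,$$ and it carries the non-degenerate invariant symmetric bilinear form $$\varphi_\delta(t\delta+x+s\delta^*,t'\delta+y+s'\delta^* )=ts'+st'+\varphi(x,y),$$ for $t,t',s,s'\in\mathbb{K}$, $x,y\in V$. A linear map is semisimple if every invariant subspace has an invariant complement (equivalently, its minimal polynomial is squarefree). *)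

theory Defs
  imports
    "HOL-Library.Product_Plus"
    "HOL-Computational_Algebra.Computational_Algebra"
begin

text \<open>
  All vector spaces, Lie algebras and quadratic spaces live on carrier sets that are linear
  subspaces of an ambient vector space, so that they can be quantified over inside a formula.
  Operations are only constrained on the carrier.
\<close>

section \<open>Linear maps on a carrier\<close>

definition linear_on_carrier ::
  "'b set \<Rightarrow> ('k \<Rightarrow> 'b \<Rightarrow> 'b) \<Rightarrow> ('k \<Rightarrow> 'c \<Rightarrow> 'c) \<Rightarrow> ('b::ab_group_add \<Rightarrow> 'c::ab_group_add) \<Rightarrow> bool"
  where "linear_on_carrier V s s' f \<longleftrightarrow>
    (\<forall>x\<in>V. \<forall>y\<in>V. f (x + y) = f x + f y) \<and> (\<forall>c. \<forall>x\<in>V. f (s c x) = s' c (f x))"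

definition semisimple_map ::
  "('k::field \<Rightarrow> 'b::ab_group_add \<Rightarrow> 'b) \<Rightarrow> 'b set \<Rightarrow> ('b \<Rightarrow> 'b) \<Rightarrow> bool"
  where "semisimple_map scale V f \<longleftrightarrow>
    (\<forall>W. module.subspace scale W \<and> W \<subseteq> V \<and> f ` W \<subseteq> W \<longrightarrow>
      (\<exists>U. module.subspace scale U \<and> U \<subseteq> V \<and> f ` U \<subseteq> U \<and>
           W \<inter> U = {0} \<and> V = {w + u | w u. w \<in> W \<and> u \<in> U}))"

definition poly_apply ::
  "('k::field \<Rightarrow> 'b::ab_group_add \<Rightarrow> 'b) \<Rightarrow> 'k poly \<Rightarrow> ('b \<Rightarrow> 'b) \<Rightarrow> 'b \<Rightarrow> 'b"
  where "poly_apply scale p f x = (\<Sum>i\<le>degree p. scale (coeff p i) ((f ^^ i) x))"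

definition annihilates ::
  "('k::field \<Rightarrow> 'b::ab_group_add \<Rightarrow> 'b) \<Rightarrow> 'b set \<Rightarrow> ('b \<Rightarrow> 'b) \<Rightarrow> 'k poly \<Rightarrow> bool"
  where "annihilates scale V f p \<longleftrightarrow> (\<forall>x\<in>V. poly_apply scale p f x = 0)"

definition minimal_polynomial ::
  "('k::field \<Rightarrow> 'b::ab_group_add \<Rightarrow> 'b) \<Rightarrow> 'b set \<Rightarrow> ('b \<Rightarrow> 'b) \<Rightarrow> 'k poly"
  where "minimal_polynomial scale V f =
    (THE p. lead_coeff p = 1 \<and> annihilates scale V f p \<and>
            (\<forall>q. annihilates scale V f q \<longrightarrow> p dvd q))"

definition totally_isotropic :: "('b \<Rightarrow> 'b \<Rightarrow> 'k::field) \<Rightarrow> 'b set \<Rightarrow> bool"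
  where "totally_isotropic \<psi> W \<longleftrightarrow> (\<forall>x\<in>W. \<forall>y\<in>W. \<psi> x y = 0)"

definition witt_index ::
  "('k::field \<Rightarrow> 'b::ab_group_add \<Rightarrow> 'b) \<Rightarrow> 'b set \<Rightarrow> ('b \<Rightarrow> 'b \<Rightarrow> 'k) \<Rightarrow> nat"
  where "witt_index scale V \<psi> =
    Max {vector_space.dim scale W | W.
           module.subspace scale W \<and> W \<subseteq> V \<and> totally_isotropic \<psi> W}"

section \<open>Quadratic spaces and quadratic Lie algebras\<close>

locale quadratic_space = vector_space scale
  for scale :: "'k::field \<Rightarrow> 'b::ab_group_add \<Rightarrow> 'b" +
  fixes V :: "'b set" and \<phi> :: "'b \<Rightarrow> 'b \<Rightarrow> 'k"
  assumes subspace_V: "subspace V"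
    and finite_dim: "\<exists>B. finite B \<and> span B = V"
    and form_add: "\<lbrakk>x \<in> V; y \<in> V; z \<in> V\<rbrakk> \<Longrightarrow> \<phi> (x + y) z = \<phi> x z + \<phi> y z"
    and form_scale: "\<lbrakk>x \<in> V; y \<in> V\<rbrakk> \<Longrightarrow> \<phi> (scale c x) y = c * \<phi> x y"
    and form_sym: "\<lbrakk>x \<in> V; y \<in> V\<rbrakk> \<Longrightarrow> \<phi> x y = \<phi> y x"
    and nondegenerate: "\<lbrakk>x \<in> V; \<And>y. y \<in> V \<Longrightarrow> \<phi> x y = 0\<rbrakk> \<Longrightarrow> x = 0"

locale lie_algebra = vector_space scale
  for scale :: "'k::field \<Rightarrow> 'b::ab_group_add \<Rightarrow> 'b" +
  fixes L :: "'b set" and br :: "'b \<Rightarrow> 'b \<Rightarrow> 'b"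
  assumes subspace_L: "subspace L"
    and br_closed: "\<lbrakk>x \<in> L; y \<in> L\<rbrakk> \<Longrightarrow> br x y \<in> L"
    and br_add_left: "\<lbrakk>x \<in> L; y \<in> L; z \<in> L\<rbrakk> \<Longrightarrow> br (x + y) z = br x z + br y z"
    and br_add_right: "\<lbrakk>x \<in> L; y \<in> L; z \<in> L\<rbrakk> \<Longrightarrow> br x (y + z) = br x y + br x z"
    and br_scale_left: "\<lbrakk>x \<in> L; y \<in> L\<rbrakk> \<Longrightarrow> br (scale c x) y = scale c (br x y)"
    and br_scale_right: "\<lbrakk>x \<in> L; y \<in> L\<rbrakk> \<Longrightarrow> br x (scale c y) = scale c (br x y)"
    and br_self: "x \<in> L \<Longrightarrow> br x x = 0"
    and jacobi: "\<lbrakk>x \<in> L; y \<in> L; z \<in> L\<rbrakk> \<Longrightarrow>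
      br x (br y z) + br y (br z x) + br z (br x y) = 0"
begin

definition ideal :: "'b set \<Rightarrow> bool"
  where "ideal I \<longleftrightarrow> subspace I \<and> I \<subseteq> L \<and> (\<forall>x\<in>L. \<forall>y\<in>I. br x y \<in> I)"

definition derived :: "'b set \<Rightarrow> 'b set"
  where "derived I = span {br x y | x y. x \<in> I \<and> y \<in> I}"

definition solvable :: "'b set \<Rightarrow> bool"
  where "solvable I \<longleftrightarrow> (\<exists>n. (derived ^^ n) I = {0})"

text \<open>Vanishing of the solvable radical, the largest solvable ideal.\<close>

definition semisimple :: bool
  where "semisimple \<longleftrightarrow> (\<forall>I. ideal I \<and> solvable I \<longrightarrow> I = {0})"

end

locale quadratic_lie_algebra =
  lie_algebra scale L br + quadratic_space scale L \<psi>
  for scale :: "'k::field \<Rightarrow> 'b::ab_group_add \<Rightarrow> 'b" and L br \<psi> +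
  assumes invariant: "\<lbrakk>x \<in> L; y \<in> L; z \<in> L\<rbrakk> \<Longrightarrow> \<psi> (br x y) z + \<psi> y (br x z) = 0"
begin

definition perp :: "'b set \<Rightarrow> 'b set"
  where "perp I = {x \<in> L. \<forall>y\<in>I. \<psi> x y = 0}"

definition decomposable :: bool
  where "decomposable \<longleftrightarrow> (\<exists>I. ideal I \<and> I \<noteq> {0} \<and> I \<noteq> L \<and> I \<inter> perp I = {0})"

definition indecomposable :: bool
  where "indecomposable \<longleftrightarrow> \<not> decomposable"

end

definition isometric_isomorphism ::
  "('k \<Rightarrow> 'b \<Rightarrow> 'b) \<Rightarrow> 'b set \<Rightarrow> ('b \<Rightarrow> 'b \<Rightarrow> 'b) \<Rightarrow> ('b \<Rightarrow> 'b \<Rightarrow> 'k) \<Rightarrow>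
   ('k \<Rightarrow> 'c \<Rightarrow> 'c) \<Rightarrow> 'c set \<Rightarrow> ('c \<Rightarrow> 'c \<Rightarrow> 'c) \<Rightarrow> ('c \<Rightarrow> 'c \<Rightarrow> 'k) \<Rightarrow>
   ('b::ab_group_add \<Rightarrow> 'c::ab_group_add) \<Rightarrow> bool"
  where "isometric_isomorphism s L br \<psi> s' L' br' \<psi>' f \<longleftrightarrow>
    linear_on_carrier L s s' f \<and> bij_betw f L L' \<and>
    (\<forall>x\<in>L. \<forall>y\<in>L. f (br x y) = br' (f x) (f y)) \<and>
    (\<forall>x\<in>L. \<forall>y\<in>L. \<psi>' (f x) (f y) = \<psi> x y)"

section \<open>Oscillator algebras\<close>

text \<open>The triple \<open>(t, x, s)\<close> stands for \<open>t\<delta> + x + s\<delta>*\<close>.\<close>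

definition osc_scale :: "('k::field \<Rightarrow> 'v::ab_group_add \<Rightarrow> 'v) \<Rightarrow> 'k \<Rightarrow> 'k \<times> 'v \<times> 'k \<Rightarrow> 'k \<times> 'v \<times> 'k"
  where "osc_scale scale c = (\<lambda>(t, x, s). (c * t, scale c x, c * s))"

definition osc_carrier :: "'v set \<Rightarrow> ('k \<times> 'v \<times> 'k) set"
  where "osc_carrier V = UNIV \<times> V \<times> UNIV"

definition osc_bracket ::
  "('k::field \<Rightarrow> 'v::ab_group_add \<Rightarrow> 'v) \<Rightarrow> ('v \<Rightarrow> 'v \<Rightarrow> 'k) \<Rightarrow> ('v \<Rightarrow> 'v) \<Rightarrow>
   'k \<times> 'v \<times> 'k \<Rightarrow> 'k \<times> 'v \<times> 'k \<Rightarrow> 'k \<times> 'v \<times> 'k"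
  where "osc_bracket scale \<phi> \<delta> =
    (\<lambda>(t, x, s) (t', y, s'). (0, scale t (\<delta> y) - scale t' (\<delta> x), \<phi> (\<delta> x) y))"

definition osc_form :: "('v \<Rightarrow> 'v \<Rightarrow> 'k::field) \<Rightarrow> 'k \<times> 'v \<times> 'k \<Rightarrow> 'k \<times> 'v \<times> 'k \<Rightarrow> 'k"
  where "osc_form \<phi> = (\<lambda>(t, x, s) (t', y, s'). t * s' + s * t' + \<phi> x y)"

locale oscillator_data = quadratic_space scale V \<phi>
  for scale :: "'k::field_char_0 \<Rightarrow> 'v::ab_group_add \<Rightarrow> 'v" and V \<phi> +
  fixes \<delta> :: "'v \<Rightarrow> 'v"
  assumes dim_ge_2: "dim V \<ge> 2"
    and linear_\<delta>: "linear_on_carrier V scale scale \<delta>"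
    and bij_\<delta>: "bij_betw \<delta> V V"
    and skew: "\<lbrakk>x \<in> V; y \<in> V\<rbrakk> \<Longrightarrow> \<phi> (\<delta> x) y = - \<phi> x (\<delta> y)"
begin

lemma \<delta>_in: "x \<in> V \<Longrightarrow> \<delta> x \<in> V"
  using bij_\<delta> by (auto simp: bij_betw_def)

lemma \<delta>_add: "\<lbrakk>x \<in> V; y \<in> V\<rbrakk> \<Longrightarrow> \<delta> (x + y) = \<delta> x + \<delta> y"
  and \<delta>_scale: "x \<in> V \<Longrightarrow> \<delta> (scale c x) = scale c (\<delta> x)"
  using linear_\<delta> by (auto simp: linear_on_carrier_def)

lemma V_closed: "\<lbrakk>x \<in> V; y \<in> V\<rbrakk> \<Longrightarrow> x + y \<in> V" "x \<in> V \<Longrightarrow> scale c x \<in> V"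
    "\<lbrakk>x \<in> V; y \<in> V\<rbrakk> \<Longrightarrow> x - y \<in> V" "0 \<in> V" "x \<in> V \<Longrightarrow> - x \<in> V"
  by (fact subspace_add[OF subspace_V] subspace_scale[OF subspace_V]
      subspace_diff[OF subspace_V] subspace_0[OF subspace_V] subspace_neg[OF subspace_V])+

lemma form_add_right: "\<lbrakk>x \<in> V; y \<in> V; z \<in> V\<rbrakk> \<Longrightarrow> \<phi> z (x + y) = \<phi> z x + \<phi> z y"
  by (metis V_closed(1) form_add form_sym)

lemma form_scale_right: "\<lbrakk>x \<in> V; y \<in> V\<rbrakk> \<Longrightarrow> \<phi> y (scale c x) = c * \<phi> y x"
  by (metis V_closed(2) form_scale form_sym)

lemma form_zero: "x \<in> V \<Longrightarrow> \<phi> 0 x = 0" "x \<in> V \<Longrightarrow> \<phi> x 0 = 0"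
proof -
  assume x: "x \<in> V"
  show "\<phi> 0 x = 0" using form_scale[OF x x, of 0] by simp
  show "\<phi> x 0 = 0" using form_scale_right[OF x x, of 0] by simp
qed

lemma form_diff: "\<lbrakk>x \<in> V; y \<in> V; z \<in> V\<rbrakk> \<Longrightarrow> \<phi> (x - y) z = \<phi> x z - \<phi> y z"
  using form_add[of "x - y" y z] V_closed by (simp add: algebra_simps)

lemma form_diff_right: "\<lbrakk>x \<in> V; y \<in> V; z \<in> V\<rbrakk> \<Longrightarrow> \<phi> z (x - y) = \<phi> z x - \<phi> z y"
  using form_add_right[of "x - y" y z] V_closed by (simp add: algebra_simps)

lemma \<delta>_diff: "\<lbrakk>x \<in> V; y \<in> V\<rbrakk> \<Longrightarrow> \<delta> (x - y) = \<delta> x - \<delta> y"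
  using \<delta>_add[of "x - y" y] V_closed by (simp add: algebra_simps)

lemma \<delta>_zero: "\<delta> 0 = 0"
  using \<delta>_diff[of 0 0] V_closed by simp

lemma skew_self: "x \<in> V \<Longrightarrow> \<phi> (\<delta> x) x = 0"
proof -
  assume x: "x \<in> V"
  have "\<phi> (\<delta> x) x = - \<phi> (\<delta> x) x"
    using skew[OF x x] form_sym[OF x \<delta>_in[OF x]] by simp
  thus ?thesis by (simp add: eq_neg_iff_add_eq_0 mult_2[symmetric])
qed

sublocale osc: vector_space "osc_scale scale"
  by unfold_locales
     (auto simp: osc_scale_def algebra_simps scale_right_distrib scale_left_distrib)

lemma osc_scale_apply: "osc_scale scale c (t, x, s) = (c * t, scale c x, c * s)"
  by (simp add: osc_scale_def)

lemma osc_finite_dim: "\<exists>B. finite B \<and> osc.span B = osc_carrier V"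
proof -
  obtain B where B: "finite B" "span B = V" using finite_dim by blast
  define C :: "('k \<times> 'v \<times> 'k) set" where "C = (\<lambda>b. (0, b, 0)) ` B \<union> {(1, 0, 0), (0, 0, 1)}"
  have sub: "osc.subspace (osc_carrier V)"
    by (auto simp: osc.subspace_def osc_carrier_def osc_scale_apply zero_prod_def V_closed)
  have "B \<subseteq> V" using B span_superset by blast
  hence "C \<subseteq> osc_carrier V" by (auto simp: C_def osc_carrier_def V_closed)
  hence 1: "osc.span C \<subseteq> osc_carrier V" using sub by (rule osc.span_minimal)
  have mid: "(0, x, 0) \<in> osc.span C" if "x \<in> span B" for x
    using that
  proof (induction rule: span_induct_alt)
    case base
    then show ?case using osc.span_zero[of C] by (simp add: zero_prod_def)
  next
    case (step c x y)
    have "(0, x, 0) \<in> osc.span C" using step by (intro osc.span_base) (auto simp: C_def)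
    from osc.span_add[OF osc.span_scale[OF this, of c] step.IH] show ?case
      by (simp add: osc_scale_apply)
  qed
  have "(t, x, s) \<in> osc.span C" if "x \<in> V" for t x s
  proof -
    have a: "(1, 0, 0) \<in> osc.span C" "(0, 0, 1) \<in> osc.span C"
      by (auto intro!: osc.span_base simp: C_def)
    have "osc_scale scale t (1, 0, 0) + ((0, x, 0) + osc_scale scale s (0, 0, 1)) \<in> osc.span C"
      using a mid that B by (intro osc.span_add osc.span_scale) auto
    thus ?thesis by (simp add: osc_scale_apply)
  qed
  hence "osc.span C = osc_carrier V" using 1 by (auto simp: osc_carrier_def)
  moreover have "finite C" using B by (simp add: C_def)
  ultimately show ?thesis by blast
qed

theorem osc_quadratic_lie_algebra:
  "quadratic_lie_algebra (osc_scale scale) (osc_carrier V) (osc_bracket scale \<phi> \<delta>) (osc_form \<phi>)"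
proof
  show "osc.subspace (osc_carrier V)"
    by (auto simp: osc.subspace_def osc_carrier_def osc_scale_apply zero_prod_def V_closed)
  show "\<exists>B. finite B \<and> osc.span B = osc_carrier V" by (rule osc_finite_dim)
next
  fix x :: "'k \<times> 'v \<times> 'k" assume x: "x \<in> osc_carrier V"
    and 0: "\<And>y. y \<in> osc_carrier V \<Longrightarrow> osc_form \<phi> x y = 0"
  obtain t v s where [simp]: "x = (t, v, s)" by (cases x)
  have v: "v \<in> V" using x by (simp add: osc_carrier_def)
  have "t = 0" using 0[of "(0, 0, 1)"] v
    by (simp add: osc_carrier_def osc_form_def V_closed form_zero)
  moreover have "s = 0" using 0[of "(1, 0, 0)"] v
    by (simp add: osc_carrier_def osc_form_def V_closed form_zero)
  moreover have "v = 0"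
  proof (rule nondegenerate[OF v])
    fix y assume "y \<in> V"
    thus "\<phi> v y = 0" using 0[of "(0, y, 0)"] by (simp add: osc_carrier_def osc_form_def)
  qed
  ultimately show "x = 0" by (simp add: zero_prod_def)
next
  fix x y z :: "'k \<times> 'v \<times> 'k" assume "x \<in> osc_carrier V" "y \<in> osc_carrier V" "z \<in> osc_carrier V"
  then obtain t1 v1 s1 t2 v2 s2 t3 v3 s3 where
    [simp]: "x = (t1, v1, s1)" "y = (t2, v2, s2)" "z = (t3, v3, s3)" "v1 \<in> V" "v2 \<in> V" "v3 \<in> V"
    by (cases x, cases y, cases z) (auto simp: osc_carrier_def)
  note s = V_closed \<delta>_in \<delta>_diff \<delta>_scale \<delta>_add form_diff form_scale form_add
    form_diff_right form_scale_right form_add_right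
  have e: "\<phi> (\<delta> a) b = - \<phi> (\<delta> b) a" if "a \<in> V" "b \<in> V" for a b
    using skew[OF that] form_sym[OF that(1) \<delta>_in[OF that(2)]] by simp
  have f: "\<phi> (\<delta> a) (\<delta> b) = \<phi> (\<delta> b) (\<delta> a)" if "a \<in> V" "b \<in> V" for a b
    using that form_sym \<delta>_in by blast
  show "osc_bracket scale \<phi> \<delta> x (osc_bracket scale \<phi> \<delta> y z)
      + osc_bracket scale \<phi> \<delta> y (osc_bracket scale \<phi> \<delta> z x)
      + osc_bracket scale \<phi> \<delta> z (osc_bracket scale \<phi> \<delta> x y) = 0"
    using f[of v1 v2] f[of v1 v3] f[of v2 v3]
    by (simp add: osc_bracket_def s zero_prod_def scale_right_diff_distrib mult.commute)
  show "osc_form \<phi> (osc_bracket scale \<phi> \<delta> x y) z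
      + osc_form \<phi> y (osc_bracket scale \<phi> \<delta> x z) = 0"
    using e[of v1 v2] e[of v2 v3] form_sym[OF \<open>v2 \<in> V\<close> \<delta>_in[OF \<open>v3 \<in> V\<close>]]
      form_sym[OF \<open>v2 \<in> V\<close> \<delta>_in[OF \<open>v1 \<in> V\<close>]]
    by (simp add: osc_bracket_def osc_form_def s right_diff_distrib)
  show "osc_bracket scale \<phi> \<delta> (x + y) z
      = osc_bracket scale \<phi> \<delta> x z + osc_bracket scale \<phi> \<delta> y z"
    by (simp add: osc_bracket_def s scale_left_distrib scale_right_distrib)
  show "osc_bracket scale \<phi> \<delta> x (y + z)
      = osc_bracket scale \<phi> \<delta> x y + osc_bracket scale \<phi> \<delta> x z"
    by (simp add: osc_bracket_def s scale_left_distrib scale_right_distrib)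
  show "osc_form \<phi> (x + y) z = osc_form \<phi> x z + osc_form \<phi> y z"
    by (simp add: osc_form_def s distrib_right)
next
  fix x y :: "'k \<times> 'v \<times> 'k" and c assume "x \<in> osc_carrier V" "y \<in> osc_carrier V"
  then obtain t1 v1 s1 t2 v2 s2 where
    [simp]: "x = (t1, v1, s1)" "y = (t2, v2, s2)" "v1 \<in> V" "v2 \<in> V"
    by (cases x, cases y) (auto simp: osc_carrier_def)
  show "osc_bracket scale \<phi> \<delta> x y \<in> osc_carrier V"
    by (simp add: osc_carrier_def osc_bracket_def V_closed \<delta>_in)
  show "osc_bracket scale \<phi> \<delta> (osc_scale scale c x) y = osc_scale scale c (osc_bracket scale \<phi> \<delta> x y)"
    by (simp add: osc_bracket_def osc_scale_apply \<delta>_scale \<delta>_in form_scale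
        scale_right_diff_distrib mult.commute)
  show "osc_bracket scale \<phi> \<delta> x (osc_scale scale c y) = osc_scale scale c (osc_bracket scale \<phi> \<delta> x y)"
    by (simp add: osc_bracket_def osc_scale_apply \<delta>_scale \<delta>_in form_scale_right
        scale_right_diff_distrib mult.commute)
  show "osc_bracket scale \<phi> \<delta> x x = 0"
    by (simp add: osc_bracket_def zero_prod_def skew_self)
  show "osc_form \<phi> (osc_scale scale c x) y = c * osc_form \<phi> x y"
    by (simp add: osc_form_def osc_scale_apply form_scale distrib_left mult.assoc)
  show "osc_form \<phi> x y = osc_form \<phi> y x"
    using form_sym[of v1 v2] by (simp add: osc_form_def mult.commute)
qed

end

end

theory Submission
  imports "HOL-Algebra.Algebraic_Closure_Type" Defs
begin

text \<open>
  The heart of the matter is to show that a non-semisimple indecomposable algebra of Witt index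
  one is an oscillator algebra. The last non-zero term of the derived series of a solvable
  ideal is an abelian ideal, and its intersection with its orthogonal space is a totally
  isotropic ideal, hence a line \<open>K z\<close>; invariance of the form makes \<open>z\<close> central
  (\<open>hyperbolic_splitting_exists\<close>). Completing \<open>z\<close> to a hyperbolic pair \<open>d, z\<close> gives
  \<open>L = K d + H + K z\<close> with \<open>H\<close> anisotropic, since otherwise the Witt index would be larger. The
  space \<open>H\<close> carries the bracket \<open>\<beta>\<close> of the subquotient, which makes it an anisotropic quadratic
  Lie algebra, and \<open>ad d\<close> acts on it as a skew derivation. It remains to prove that \<open>\<beta> = 0\<close> and that
  \<open>ad d\<close> is bijective.

  For \<open>\<beta> = 0\<close> one needs that derivations of an anisotropic quadratic Lie algebra are inner up to
  central values (\<open>derivation_inner_mod_center\<close>): then \<open>d\<close> can be corrected by an element of \<open>H\<close>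
  so that the commutators of \<open>H\<close> become a direct factor of \<open>L\<close>, and indecomposability removes
  them (\<open>\<beta>_trivial\<close>). The usual argument with the Killing form applies as soon as the radical of
  the Killing form is known to be the centre, which is the case of Cartan's criterion proved in
  \<open>killing_radical_central\<close>. Let \<open>a\<close> be in the radical and \<open>u = [a, b]\<close>. Then \<open>tr(ad u D) = 0\<close> for
  every derivation \<open>D\<close>. Every \<open>ad u\<close> is semisimple, because orthogonal complements of
  invariant subspaces are invariant; hence it is diagonalisable over the algebraic closure.
  If \<open>f\<close> is an additive map of the closure to the rationals, multiplying each eigenspace by
  \<open>f(\<lambda>)\<close> is a derivation, a polynomial in \<open>ad u\<close>, and so \<open>\<Sum> \<mu>(\<lambda>) \<lambda> f(\<lambda>) = 0\<close> with the
  multiplicities \<open>\<mu>(\<lambda>)\<close>. Applying \<open>f\<close> once more gives \<open>\<Sum> \<mu>(\<lambda>) f(\<lambda>)^2 = 0\<close>. Thus \<open>ad u = 0\<close>, and a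
  central commutator is orthogonal to itself, so that \<open>u = 0\<close>.

  Instead of tensoring with the closure, the argument extends scalars only in the values of
  linear functionals. Powers of an operator then become sequences that satisfy a linear
  recurrence with simple characteristic roots, hence combinations of geometric sequences
  (\<open>recurrence_solution\<close>, \<open>replica_derivation\<close>). That traces of powers are power sums of the
  eigenvalues with non-negative integral multiplicities is proved by splitting off cyclic
  subspaces orthogonally (\<open>cyclic_trace\<close>, \<open>invariant_power_sums\<close>).

  Bijectivity of \<open>ad d\<close> holds because a kernel vector would span a direct factor. The converse
  direction is a computation with ideals and isotropic vectors in \<open>K \<delta> + V + K \<delta>*\<close>. Finally, a
  skew endomorphism of an anisotropic space is semisimple, and on the kernel of \<open>p(\<delta>)\<close>, for
  an irreducible factor \<open>p\<close> of its minimal polynomial, the adjoint \<open>p(-\<delta>)\<close> vanishes too; hence \<open>p\<close>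
  divides \<open>p(-x)\<close>, and \<open>p\<close> is even unless \<open>p = x\<close> (\<open>irreducible_factor_even\<close>).
\<close>

section \<open>Polynomials over a field\<close>

lemma poly_ideal_principal:
  fixes S :: "'k::field poly set"
  assumes nz: "a \<in> S" "a \<noteq> 0"
    and diff: "\<And>a b. a \<in> S \<Longrightarrow> b \<in> S \<Longrightarrow> a - b \<in> S"
    and mult: "\<And>a r. a \<in> S \<Longrightarrow> r * a \<in> S"
  obtains g where "g \<in> S" "lead_coeff g = 1" "\<And>a. a \<in> S \<Longrightarrow> g dvd a"
proof -
  define n where "n = (LEAST n. \<exists>a\<in>S. a \<noteq> 0 \<and> degree a = n)"
  have "\<exists>n. \<exists>a\<in>S. a \<noteq> 0 \<and> degree a = n" using nz by blast
  then have "\<exists>a\<in>S. a \<noteq> 0 \<and> degree a = n" unfolding n_def by (rule LeastI_ex)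
  then obtain h where h: "h \<in> S" "h \<noteq> 0" "degree h = n" by blast
  have least: "n \<le> degree a" if "a \<in> S" "a \<noteq> 0" for a
    unfolding n_def using that by (intro Least_le) blast
  define g where "g = [:inverse (lead_coeff h):] * h"
  have g: "g \<in> S" unfolding g_def by (rule mult[OF h(1)])
  have deg: "degree g = n" using h by (auto simp: g_def)
  have lc: "lead_coeff g = 1" using h(2) by (simp add: g_def)
  have "g dvd a" if a: "a \<in> S" for a
  proof (rule ccontr)
    assume "\<not> g dvd a"
    then have r: "a mod g \<noteq> 0" by (simp add: dvd_eq_mod_eq_0)
    have "a mod g = a - a div g * g" by (simp add: minus_div_mult_eq_mod)
    then have "a mod g \<in> S" using diff[OF a mult[OF g]] by simp
    then have "n \<le> degree (a mod g)" using r by (rule least)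
    moreover have "g \<noteq> 0" using lc by auto
    ultimately show False using degree_mod_less[of g a] r deg by simp
  qed
  then show ?thesis using that g lc by blast
qed

text \<open>Bezout: the ideal generated by two polynomials is principal.\<close>

lemma poly_common_divisor:
  fixes p q :: "'k::field poly"
  assumes p: "p \<noteq> 0"
  obtains g a b where "lead_coeff g = 1" "g dvd p" "g dvd q" "g = a * p + b * q"
proof -
  define S where "S = {a * p + b * q | a b. True}"
  have pS: "p \<in> S" and qS: "q \<in> S"
  proof -
    have "p = 1 * p + 0 * q" "q = 0 * p + 1 * q" by simp_all
    then show "p \<in> S" "q \<in> S" unfolding S_def by blast+
  qed
  have diff: "x - y \<in> S" if "x \<in> S" "y \<in> S" for x y
  proof -
    obtain a b c d where "x = a * p + b * q" "y = c * p + d * q"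
      using \<open>x \<in> S\<close> \<open>y \<in> S\<close> unfolding S_def by blast
    then have "x - y = (a - c) * p + (b - d) * q" by (simp add: algebra_simps)
    then show ?thesis unfolding S_def by blast
  qed
  have mult: "r * x \<in> S" if "x \<in> S" for x r
  proof -
    obtain a b where "x = a * p + b * q" using \<open>x \<in> S\<close> unfolding S_def by blast
    then have "r * x = (r * a) * p + (r * b) * q" by (simp add: algebra_simps)
    then show ?thesis unfolding S_def by blast
  qed
  from poly_ideal_principal[OF pS p diff mult] obtain g where
    g: "g \<in> S" "lead_coeff g = 1" "\<And>a. a \<in> S \<Longrightarrow> g dvd a" by blast
  then show ?thesis using that pS qS unfolding S_def by blast
qed

lemma monic_degree_0: "lead_coeff p = 1 \<Longrightarrow> degree p = 0 \<Longrightarrow> p = (1 :: 'k::field poly)"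
  by (metis degree_eq_zeroE lead_coeff_pCons(2) one_pCons)

lemma irreducible_degree_pos: "irreducible (p :: 'k::field poly) \<Longrightarrow> degree p > 0"
  by (metis gr0I irreducible_def is_unit_iff_degree)

lemma irreducible_dvd_or_bezout:
  fixes r q :: "'k::field poly"
  assumes r: "irreducible r" and nd: "\<not> r dvd q"
  obtains a b where "a * r + b * q = 1"
proof -
  have r0: "r \<noteq> 0" using r by auto
  from poly_common_divisor[OF r0, of q] obtain g a b where
    g: "lead_coeff g = 1" "g dvd r" "g dvd q" "g = a * r + b * q" by blast
  have "is_unit g"
    using g(2,3) nd r by (metis dvd_trans irreducible_altdef)
  then have "g = 1" using g(1) monic_degree_0[of g] by (auto simp: is_unit_poly_iff)
  then show ?thesis using g(4) that by simp
qed

lemma irreducible_dvd_mult_poly: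
  fixes r p q :: "'k::field poly"
  assumes r: "irreducible r" and d: "r dvd p * q"
  shows "r dvd p \<or> r dvd q"
proof (rule ccontr)
  assume n: "\<not> ?thesis"
  then obtain a b where ab: "a * r + b * q = 1" using irreducible_dvd_or_bezout[OF r] by blast
  have "p = (a * r + b * q) * p" using ab by simp
  also have "\<dots> = r * (a * p) + (p * q) * b" by (simp add: algebra_simps)
  finally have "r dvd p" using d by (metis dvd_add dvd_mult2 dvd_triv_left)
  then show False using n by blast
qed

lemma exists_irreducible_factor:
  fixes p :: "'k::field poly"
  assumes "degree p > 0"
  shows "\<exists>r. irreducible r \<and> r dvd p"
  using assms
proof (induction "degree p" arbitrary: p rule: less_induct)
  case less
  show ?case
  proof (cases "irreducible p")
    case False
    have "p \<noteq> 0" "\<not> is_unit p" using less.prems by (auto simp: is_unit_poly_iff)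
    then obtain a b where ab: "p = a * b" "\<not> is_unit a" "\<not> is_unit b"
      using False unfolding irreducible_def by blast
    have nz: "a \<noteq> 0" "b \<noteq> 0" using ab \<open>p \<noteq> 0\<close> by auto
    then have "degree a > 0" "degree b > 0"
      using ab(2,3) by (auto simp: is_unit_iff_degree)
    moreover have "degree p = degree a + degree b" using ab nz by (simp add: degree_mult_eq)
    ultimately obtain r where "irreducible r" "r dvd a" using less.hyps[of a] by auto
    then show ?thesis using ab(1) by auto
  qed auto
qed

text \<open>In characteristic zero the derivative of an irreducible polynomial is non-zero and of lower
  degree, so that a common irreducible factor of \<open>p\<close> and its derivative occurs twice in \<open>p\<close>.\<close>

lemma squarefree_coprime_pderiv:
  fixes p :: "'k::field_char_0 poly"
  assumes p: "p \<noteq> 0" and sqf: "\<And>r. r * r dvd p \<Longrightarrow> degree r = 0"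
  obtains a b where "a * p + b * pderiv p = 1"
proof -
  from poly_common_divisor[OF p, of "pderiv p"] obtain g a b where
    g: "lead_coeff g = 1" "g dvd p" "g dvd pderiv p" "g = a * p + b * pderiv p" by blast
  have "degree g = 0"
  proof (rule ccontr)
    assume "degree g \<noteq> 0"
    then obtain r where r: "irreducible r" "r dvd g" using exists_irreducible_factor[of g] by auto
    have r0: "r \<noteq> 0" using r by auto
    have deg: "degree r > 0" using r(1) by (rule irreducible_degree_pos)
    obtain s where s: "p = r * s" using r g(2) by (meson dvd_trans dvdE)
    have "r dvd pderiv p" using r g(3) dvd_trans by blast
    then have "r dvd r * pderiv s + pderiv r * s" by (simp add: s pderiv_mult ac_simps)
    then have "r dvd pderiv r * s" by (simp add: dvd_add_right_iff)
    moreover have "\<not> r dvd pderiv r"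
    proof
      assume "r dvd pderiv r"
      moreover have "pderiv r \<noteq> 0" using deg by (simp add: pderiv_eq_0_iff)
      ultimately have "degree r \<le> degree (pderiv r)" by (rule dvd_imp_degree_le)
      then show False using deg by (simp add: degree_pderiv)
    qed
    ultimately have "r dvd s" using irreducible_dvd_mult_poly[OF r(1)] by blast
    then have "r * r dvd p" using s by (simp add: mult_dvd_mono)
    then show False using sqf deg by auto
  qed
  then have "g = 1" using g(1) monic_degree_0 by blast
  then show ?thesis using g(4) that by simp
qed

section \<open>Extension of scalars to the algebraic closure\<close>

abbreviation ac_poly :: "'k::field poly \<Rightarrow> 'k alg_closure poly" where
  "ac_poly \<equiv> map_poly to_ac"

lemma coeff_ac_poly: "coeff (ac_poly p) n = to_ac (coeff p n)"
  by (simp add: coeff_map_poly)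

lemma degree_ac_poly: "degree (ac_poly p) = degree p"
  by (rule degree_map_poly) simp

lemma ac_poly_add: "ac_poly (p + q) = ac_poly p + ac_poly q"
  by (rule poly_eqI) (simp add: coeff_ac_poly)

lemma ac_poly_mult: "ac_poly (p * q) = ac_poly p * ac_poly q"
  by (rule poly_eqI) (simp add: coeff_ac_poly coeff_mult to_ac_sum)

lemma ac_poly_pderiv: "ac_poly (pderiv p) = pderiv (ac_poly p)"
  by (rule poly_eqI) (simp add: coeff_ac_poly coeff_pderiv flip: to_ac_of_nat)

lemma ac_poly_1: "ac_poly 1 = 1"
  by (simp add: map_poly_1)

text \<open>A Bezout identity for \<open>p\<close> and its derivative survives the extension of scalars and rules out
  repeated roots there.\<close>

lemma ac_poly_squarefree_roots:
  fixes p :: "'k::field_char_0 poly"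
  assumes p: "p \<noteq> 0" and sqf: "\<And>r. r * r dvd p \<Longrightarrow> degree r = 0"
  shows "rsquarefree (ac_poly p)"
proof -
  obtain a b where "a * p + b * pderiv p = 1" using squarefree_coprime_pderiv[OF p sqf] by blast
  then have "ac_poly a * ac_poly p + ac_poly b * pderiv (ac_poly p) = 1"
    by (metis ac_poly_1 ac_poly_add ac_poly_mult ac_poly_pderiv)
  then have "poly (ac_poly a) x * poly (ac_poly p) x
      + poly (ac_poly b) x * poly (pderiv (ac_poly p)) x = 1" for x
    by (metis poly_1 poly_add poly_mult)
  then show ?thesis unfolding rsquarefree_roots
    by (metis add.right_neutral mult_zero_right zero_neq_one)
qed

lemma rsquarefree_dvd:
  assumes "rsquarefree p" "q dvd p"
  shows "rsquarefree (q :: 'e::field_char_0 poly)"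
proof -
  obtain s where "p = q * s" using assms(2) by (elim dvdE)
  then show ?thesis using assms(1) unfolding rsquarefree_roots
    by (auto simp: pderiv_mult)
qed

lemma rsquarefree_splits:
  fixes p :: "'e::alg_closed_field poly"
  assumes sq: "rsquarefree p" and monic: "lead_coeff p = 1"
  shows "p = (\<Prod>x\<in>{x. poly p x = 0}. [:-x, 1:])"
proof -
  have p0: "p \<noteq> 0" using monic by auto
  obtain A where A: "p = (\<Prod>x\<in>#A. [:-x, 1:])"
    using alg_closed_imp_factorization[OF p0] monic by auto
  have set: "set_mset A = {x. poly p x = 0}"
    unfolding A by (simp add: poly_prod_mset prod_mset_zero_iff image_iff)
  have "count A x \<le> 1" for x
  proof (rule ccontr)
    assume "\<not> ?thesis"
    then have "count {#x, x#} y \<le> count A y" for y by (cases "y = x") auto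
    then have "{#x, x#} \<subseteq># A" by (rule mset_subset_eqI)
    then obtain B where "A = {#x, x#} + B" by (metis subset_mset.le_iff_add)
    then have "[:-x, 1:] ^ 2 dvd p" unfolding A
      by (simp only: image_mset_union prod_mset.union image_mset_add_mset prod_mset.add_mset
          image_mset_empty prod_mset.empty power2_eq_square mult_1_right dvd_triv_left)
    then have "order x p \<ge> 2" using p0 by (simp add: order_divides)
    then show False using sq unfolding rsquarefree_def by (metis One_nat_def not_less_eq_eq numeral_2_eq_2 zero_le)
  qed
  then have "A = mset_set (set_mset A)"
    by (intro multiset_eqI) (metis count_greater_eq_one_iff count_mset_set(1,3) count_inI finite_set_mset le_antisym not_in_iff)
  then have "p = (\<Prod>x\<in>set_mset A. [:-x, 1:])" unfolding A
    by (metis (no_types) prod_unfold_prod_mset)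
  then show ?thesis unfolding set .
qed


section \<open>Lagrange interpolation and linear recurrences\<close>

definition lagrange :: "'e::field set \<Rightarrow> 'e \<Rightarrow> 'e poly" where
  "lagrange R x = smult (inverse (\<Prod>y\<in>R - {x}. x - y)) (\<Prod>y\<in>R - {x}. [:-y, 1:])"

lemma poly_lagrange:
  assumes "finite R" "x \<in> R" "y \<in> R"
  shows "poly (lagrange R x) y = (if y = x then 1 else 0)"
  using assms by (auto simp: lagrange_def poly_prod prod_zero_iff)

lemma degree_lagrange:
  assumes "finite R" "x \<in> R"
  shows "degree (lagrange R x) < card R"
proof -
  have "degree (lagrange R x) \<le> degree (\<Prod>y\<in>R - {x}. [:-y, 1:])"
    unfolding lagrange_def by (rule degree_smult_le)
  also have "\<dots> = (\<Sum>y\<in>R - {x}. degree [:-y, 1:])" by (rule degree_prod_eq_sum_degree) auto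
  also have "\<dots> = card (R - {x})" by simp
  also have "\<dots> < card R" using assms by (intro card_Diff1_less)
  finally show ?thesis .
qed

lemma interpolation_exists:
  fixes g :: "'e::field \<Rightarrow> 'e"
  assumes "finite R"
  shows "\<exists>h. \<forall>x\<in>R. poly h x = g x"
proof (intro exI ballI)
  fix x assume x: "x \<in> R"
  have "poly (\<Sum>y\<in>R. smult (g y) (lagrange R y)) x = (\<Sum>y\<in>R. g y * (if x = y then 1 else 0))"
    using x assms by (simp add: poly_sum poly_lagrange)
  also have "\<dots> = g x" using x assms by (simp add: if_distrib sum.delta cong: if_cong)
  finally show "poly (\<Sum>y\<in>R. smult (g y) (lagrange R y)) x = g x" .
qed

lemma lagrange_expansion:
  assumes R: "finite R" and deg: "degree h < card R \<or> h = 0"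
  shows "h = (\<Sum>x\<in>R. smult (poly h x) (lagrange R x))" (is "_ = ?s")
proof (cases "R = {}")
  case False
  have c: "card R > 0" using R False by (simp add: card_gt_0_iff)
  show ?thesis
  proof (rule poly_eqI_degree[where A = R])
    fix x assume x: "x \<in> R"
    have "poly ?s x = (\<Sum>y\<in>R. poly h y * (if x = y then 1 else 0))"
      using x R by (simp add: poly_sum poly_lagrange)
    then show "poly h x = poly ?s x" using x R by (simp add: if_distrib sum.delta cong: if_cong)
  next
    show "card R > degree h" using deg c by auto
    have "degree ?s \<le> card R - 1"
    proof (rule degree_sum_le[OF R])
      fix x assume "x \<in> R"
      then show "degree (smult (poly h x) (lagrange R x)) \<le> card R - 1"
        using degree_lagrange[OF R, of x] degree_smult_le[of "poly h x" "lagrange R x"] by linarith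
    qed
    then show "card R > degree ?s" using c by linarith
  qed
qed (use deg in auto)

text \<open>Interpolation at the roots computes the remainder: both sides have degree below the number of
  roots and agree there.\<close>

lemma mod_prod_linear:
  fixes R :: "'e::field set"
  assumes R: "finite R"
  defines "P \<equiv> \<Prod>x\<in>R. [:-x, 1:]"
  shows "h mod P = (\<Sum>x\<in>R. smult (poly h x) (lagrange R x))"
proof -
  have P0: "P \<noteq> 0" using R by (simp add: P_def)
  have "degree P = card R" unfolding P_def by (subst degree_prod_eq_sum_degree) auto
  then have "degree (h mod P) < card R \<or> h mod P = 0"
    using degree_mod_less[OF P0, of h] by auto
  then have "h mod P = (\<Sum>x\<in>R. smult (poly (h mod P) x) (lagrange R x))"
    by (rule lagrange_expansion[OF R])
  moreover have "poly (h mod P) x = poly h x" if "x \<in> R" for x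
  proof -
    have "poly P x = 0" using that R by (auto simp: P_def poly_prod prod_zero_iff)
    moreover have "poly h x = poly (h div P) x * poly P x + poly (h mod P) x"
      by (metis div_mult_mod_eq poly_add poly_mult)
    ultimately show ?thesis by simp
  qed
  ultimately show ?thesis by simp
qed

lemma sum_coeff_bound:
  assumes "\<And>i. F 0 i = 0" "degree p \<le> N"
  shows "(\<Sum>i\<le>degree p. F (coeff p i) i) = (\<Sum>i\<le>N. F (coeff p i) i)"
proof (rule sum.mono_neutral_left)
  show "\<forall>i\<in>{..N} - {..degree p}. F (coeff p i) i = 0"
    using assms(1) by (auto simp: coeff_eq_0)
qed (use assms in auto)

text \<open>The value of a polynomial at a sequence: the linear functional with \<open>X^k \<mapsto> s k\<close>.\<close>

definition seq_eval :: "'e::comm_ring_1 poly \<Rightarrow> (nat \<Rightarrow> 'e) \<Rightarrow> 'e" where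
  "seq_eval h s = (\<Sum>k\<le>degree h. coeff h k * s k)"

lemma seq_eval_add: "seq_eval (p + q) s = seq_eval p s + seq_eval q s"
proof -
  define N where "N = max (degree p) (degree q)"
  have "degree (p + q) \<le> N" "degree p \<le> N" "degree q \<le> N"
    by (auto simp: N_def degree_add_le_max)
  then have "seq_eval r s = (\<Sum>k\<le>N. coeff r k * s k)" if "r \<in> {p, q, p + q}" for r
    unfolding seq_eval_def using sum_coeff_bound[of "\<lambda>a k. a * s k" r N] that by auto
  then show ?thesis by (simp add: algebra_simps sum.distrib)
qed

lemma seq_eval_smult: "seq_eval (smult c p) s = c * seq_eval p s"
proof -
  have "seq_eval (smult c p) s = (\<Sum>k\<le>degree p. coeff (smult c p) k * s k)"
    unfolding seq_eval_def
    by (rule sum_coeff_bound[where F = "\<lambda>a k. a * s k"]) (auto simp: degree_smult_le)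
  then show ?thesis by (simp add: seq_eval_def sum_distrib_left mult.assoc)
qed

lemma seq_eval_0 [simp]: "seq_eval 0 s = 0"
  by (simp add: seq_eval_def)

lemma seq_eval_monom [simp]: "seq_eval (monom 1 k) s = s k"
proof -
  have "seq_eval (monom 1 k) s = (\<Sum>i\<le>k. coeff (monom 1 k) i * s i)"
    unfolding seq_eval_def
    by (rule sum_coeff_bound[where F = "\<lambda>a k. a * s k"]) (auto simp: degree_monom_le)
  then show ?thesis by (simp add: if_distrib[of "\<lambda>x. x * _"] sum.delta cong: if_cong)
qed

lemma seq_eval_sum: "seq_eval (sum f A) s = (\<Sum>x\<in>A. seq_eval (f x) s)"
  by (induction A rule: infinite_finite_induct) (auto simp: seq_eval_add)

lemma seq_eval_pCons: "seq_eval (pCons a p) s = a * s 0 + seq_eval p (\<lambda>k. s (Suc k))"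
proof -
  have "seq_eval (pCons a p) s = (\<Sum>k\<le>Suc (degree p). coeff (pCons a p) k * s k)"
    unfolding seq_eval_def
    by (rule sum_coeff_bound[where F = "\<lambda>a k. a * s k"]) (auto simp: degree_pCons_le)
  also have "\<dots> = a * s 0 + (\<Sum>k\<le>degree p. coeff p k * s (Suc k))"
    by (subst sum.atMost_Suc_shift) simp
  finally show ?thesis by (simp add: seq_eval_def)
qed

text \<open>A sequence that satisfies the recurrence with characteristic polynomial \<open>P\<close> kills the ideal
  generated by \<open>P\<close>.\<close>

lemma seq_eval_recurrence:
  assumes "\<And>j. seq_eval P (\<lambda>k. s (k + j)) = 0"
  shows "seq_eval (P * g) s = 0"
  using assms
proof (induction g arbitrary: s)
  case (pCons a g)
  have "seq_eval (P * pCons a g) s = a * seq_eval P s + seq_eval (P * g) (\<lambda>k. s (Suc k))"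
    by (simp add: seq_eval_add seq_eval_smult seq_eval_pCons)
  moreover have "seq_eval P s = 0" using pCons.prems[of 0] by simp
  moreover have "seq_eval (P * g) (\<lambda>k. s (Suc k)) = 0"
    using pCons.prems[of "Suc j" for j] by (intro pCons.IH) simp
  ultimately show ?case by simp
qed simp

text \<open>Distinct characteristic roots: modulo the characteristic polynomial \<open>x^k\<close> is the combination
  of the Lagrange polynomials with the values \<open>\<lambda>^k\<close> as coefficients.\<close>

lemma recurrence_solution:
  fixes R :: "'e::field set"
  assumes R: "finite R" and rec: "\<And>j. seq_eval (\<Prod>x\<in>R. [:-x, 1:]) (\<lambda>k. s (k + j)) = 0"
  shows "s k = (\<Sum>x\<in>R. seq_eval (lagrange R x) s * x ^ k)"
proof -
  let ?P = "\<Prod>x\<in>R. [:-x, 1:]"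
  have "monom 1 k = ?P * (monom 1 k div ?P) + (\<Sum>x\<in>R. smult (x ^ k) (lagrange R x))"
    by (metis (no_types, lifting) mod_prod_linear[OF R, of "monom 1 k"] mult_div_mod_eq poly_monom mult_1 sum.cong)
  then have "s k = seq_eval (?P * (monom 1 k div ?P) + (\<Sum>x\<in>R. smult (x ^ k) (lagrange R x))) s"
    by (metis seq_eval_monom)
  also have "\<dots> = (\<Sum>x\<in>R. x ^ k * seq_eval (lagrange R x) s)"
    by (simp add: seq_eval_add seq_eval_sum seq_eval_smult seq_eval_recurrence[OF rec])
  finally show ?thesis by (simp add: mult.commute)
qed

lemma double_recurrence_solution:
  fixes R :: "'e::field set" and c :: "nat \<Rightarrow> nat \<Rightarrow> 'e"
  assumes R: "finite R"
    and rec1: "\<And>i j. seq_eval (\<Prod>x\<in>R. [:-x, 1:]) (\<lambda>k. c (k + i) j) = 0"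
    and rec2: "\<And>i j. seq_eval (\<Prod>x\<in>R. [:-x, 1:]) (\<lambda>k. c i (k + j)) = 0"
  obtains C where "\<And>i j. c i j = (\<Sum>x\<in>R. \<Sum>y\<in>R. C x y * x ^ i * y ^ j)"
proof -
  let ?P = "\<Prod>x\<in>R. [:-x, 1:]"
  define C where "C x y = seq_eval (lagrange R y) (\<lambda>j. seq_eval (lagrange R x) (\<lambda>i. c i j))" for x y
  have rec: "seq_eval ?P (\<lambda>k. seq_eval (lagrange R x) (\<lambda>i. c i (k + j))) = 0" for x j
  proof -
    let ?n = "degree ?P" and ?m = "degree (lagrange R x)"
    have "seq_eval ?P (\<lambda>k. seq_eval (lagrange R x) (\<lambda>i. c i (k + j)))
        = (\<Sum>k\<le>?n. \<Sum>i\<le>?m. coeff (lagrange R x) i * (coeff ?P k * c i (k + j)))"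
      by (simp add: seq_eval_def sum_distrib_left mult.left_commute)
    also have "\<dots> = (\<Sum>i\<le>?m. coeff (lagrange R x) i * seq_eval ?P (\<lambda>k. c i (k + j)))"
      by (subst sum.swap) (simp add: seq_eval_def sum_distrib_left)
    finally show ?thesis by (simp add: rec2)
  qed
  have "c i j = (\<Sum>x\<in>R. \<Sum>y\<in>R. C x y * x ^ i * y ^ j)" for i j
  proof -
    have "c i j = (\<Sum>x\<in>R. seq_eval (lagrange R x) (\<lambda>i. c i j) * x ^ i)"
      by (rule recurrence_solution[OF R rec1])
    also have "\<dots> = (\<Sum>x\<in>R. (\<Sum>y\<in>R. C x y * y ^ j) * x ^ i)"
    proof (rule sum.cong[OF refl])
      fix x
      have "seq_eval (lagrange R x) (\<lambda>i. c i j) = (\<Sum>y\<in>R. C x y * y ^ j)"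
        unfolding C_def by (rule recurrence_solution[OF R rec])
      then show "seq_eval (lagrange R x) (\<lambda>i. c i j) * x ^ i
          = (\<Sum>y\<in>R. C x y * y ^ j) * x ^ i" by simp
    qed
    finally show ?thesis by (simp add: sum_distrib_right sum_distrib_left mult_ac)
  qed
  then show ?thesis using that by blast
qed

text \<open>In characteristic zero the field is a vector space over the rationals; extend \<open>x\<close> to a basis
  and take the coordinate of \<open>x\<close>.\<close>

lemma rational_functional_exists:
  fixes x :: "'e::field_char_0"
  assumes "x \<noteq> 0"
  obtains F :: "'e \<Rightarrow> rat" where "\<And>a b. F (a + b) = F a + F b"
    "\<And>r a. F (of_rat r * a) = r * F a" "F x = 1"
proof -
  interpret Q: vector_space "\<lambda>r (a::'e). of_rat r * a"
    by unfold_locales (auto simp: algebra_simps of_rat_add of_rat_mult)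
  interpret Q1: vector_space "(*) :: rat \<Rightarrow> rat \<Rightarrow> rat"
    by unfold_locales (auto simp: algebra_simps)
  interpret QQ: vector_space_pair "\<lambda>r (a::'e). of_rat r * a" "(*) :: rat \<Rightarrow> rat \<Rightarrow> rat" ..
  have "Q.independent {x}" using assms by simp
  then obtain F where F: "Vector_Spaces.linear (\<lambda>r (a::'e). of_rat r * a) (*) F" "F x = 1"
    using QQ.linear_independent_extend[of "{x}" "\<lambda>_. 1"] by auto
  interpret Vector_Spaces.linear "\<lambda>r (a::'e). of_rat r * a" "(*)" F by (rule F(1))
  show ?thesis using that[of F] F(2) add scale by blast
qed

section \<open>Finite-dimensional carriers and traces\<close>

context vector_space
begin

lemma linear_on_carrier_0:
  assumes "linear_on_carrier W scale s' f" "subspace W"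
  shows "f 0 = 0"
proof -
  have "f (0 + 0) = f 0 + f 0" using assms subspace_0 unfolding linear_on_carrier_def by blast
  then show ?thesis by simp
qed

lemma linear_on_carrier_sum:
  assumes f: "linear_on_carrier W scale s' f" and W: "subspace W"
    and x: "\<And>i. i \<in> I \<Longrightarrow> x i \<in> W"
  shows "f (\<Sum>i\<in>I. scale (c i) (x i)) = (\<Sum>i\<in>I. s' (c i) (f (x i)))"
  using x
proof (induction I rule: infinite_finite_induct)
  case (insert i I)
  have "(\<Sum>i\<in>I. scale (c i) (x i)) \<in> W" "scale (c i) (x i) \<in> W"
    using insert.prems by (auto intro!: subspace_sum[OF W] subspace_scale[OF W])
  then have "f (scale (c i) (x i) + (\<Sum>i\<in>I. scale (c i) (x i)))
      = s' (c i) (f (x i)) + f (\<Sum>i\<in>I. scale (c i) (x i))"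
    using f insert.prems unfolding linear_on_carrier_def by simp
  then show ?case using insert by simp
qed (auto simp: linear_on_carrier_0[OF f W])

end

locale fd_carrier = vector_space scale
  for scale :: "'k::field \<Rightarrow> 'b::ab_group_add \<Rightarrow> 'b" and V :: "'b set" +
  assumes subspace_carrier: "subspace V"
    and finitely_generated: "\<exists>B. finite B \<and> span B = V"
begin

lemmas carrier_0 = subspace_0[OF subspace_carrier]
  and carrier_add = subspace_add[OF subspace_carrier]
  and carrier_diff = subspace_diff[OF subspace_carrier]
  and carrier_neg = subspace_neg[OF subspace_carrier]
  and carrier_scale = subspace_scale[OF subspace_carrier]
  and carrier_sum = subspace_sum[OF subspace_carrier]

lemmas carrier_closed = carrier_0 carrier_add carrier_diff carrier_neg carrier_scale

lemma subspace_basis: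
  assumes "subspace W" "W \<subseteq> V"
  obtains B where "finite B" "independent B" "B \<subseteq> W" "span B = W"
proof -
  obtain B where B: "B \<subseteq> W" "independent B" "W \<subseteq> span B"
    using maximal_independent_subset by blast
  obtain C where C: "finite C" "span C = V" using finitely_generated by blast
  have "finite B" using independent_span_bound[OF C(1) B(2)] B(1) assms(2) C(2) by blast
  moreover have "span B = W" using B assms(1) by (simp add: span_minimal subset_antisym)
  ultimately show ?thesis using that B by blast
qed

lemma subspace_fd_carrier:
  assumes "subspace W" "W \<subseteq> V"
  shows "fd_carrier scale W"
proof
  show "subspace W" by fact
  show "\<exists>B. finite B \<and> span B = W" using subspace_basis[OF assms] by metis
qed

text \<open>A frame is a finite family of vectors with linear coefficient functionals that reproduce
  every vector. Unlike bases, frames can be written down for cyclic subspaces and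
  for direct sums without a choice, and the trace of an operator is the same in all of them.\<close>

definition frame :: "'b set \<Rightarrow> nat \<Rightarrow> (nat \<Rightarrow> 'b) \<Rightarrow> (nat \<Rightarrow> 'b \<Rightarrow> 'k) \<Rightarrow> bool" where
  "frame W n b \<gamma> \<longleftrightarrow> (\<forall>i<n. b i \<in> W \<and> linear_on_carrier W scale (*) (\<gamma> i)) \<and>
     (\<forall>x\<in>W. x = (\<Sum>i<n. scale (\<gamma> i x) (b i)))"

lemma frame_exists: "\<exists>n b \<gamma>. frame V n b \<gamma>"
proof -
  obtain B where B: "finite B" "independent B" "B \<subseteq> V" "span B = V"
    using subspace_basis[OF subspace_carrier] by blast
  obtain b where b: "bij_betw b {..<card B} B"
    using ex_bij_betw_nat_finite[OF B(1)] by (auto simp: atLeast0LessThan)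
  define \<gamma> where "\<gamma> i x = representation B x (b i)" for i x
  have "frame V (card B) b \<gamma>"
    unfolding frame_def
  proof (intro conjI allI impI ballI)
    fix i assume "i < card B"
    then show "b i \<in> V" using b B(3) by (auto simp: bij_betw_def)
    show "linear_on_carrier V scale (*) (\<gamma> i)"
      using B by (simp add: linear_on_carrier_def \<gamma>_def representation_add representation_scale)
  next
    fix x assume x: "x \<in> V"
    have "(\<Sum>i<card B. scale (\<gamma> i x) (b i)) = (\<Sum>v\<in>B. scale (representation B x v) v)"
      unfolding \<gamma>_def using sum.reindex_bij_betw[OF b, of "\<lambda>v. scale (representation B x v) v"] .
    also have "\<dots> = x" using B x by (intro sum_representation_eq) auto
    finally show "x = (\<Sum>i<card B. scale (\<gamma> i x) (b i))" by simp
  qed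
  then show ?thesis by blast
qed

definition frame_trace :: "nat \<Rightarrow> (nat \<Rightarrow> 'b) \<Rightarrow> (nat \<Rightarrow> 'b \<Rightarrow> 'k) \<Rightarrow> ('b \<Rightarrow> 'b) \<Rightarrow> 'k" where
  "frame_trace n b \<gamma> T = (\<Sum>i<n. \<gamma> i (T (b i)))"

text \<open>The usual double sum for \<open>tr(TS) = tr(ST)\<close>, with the two traces taken in different frames, so
  that \<open>S = id\<close> yields the independence of the frame.\<close>

lemma frame_trace_commute_frames:
  assumes W: "subspace W" and 1: "frame W n b \<gamma>" and 2: "frame W m c \<delta>"
    and T: "linear_on_carrier W scale scale T" "\<And>x. x \<in> W \<Longrightarrow> T x \<in> W"
    and S: "linear_on_carrier W scale scale S" "\<And>x. x \<in> W \<Longrightarrow> S x \<in> W"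
  shows "frame_trace n b \<gamma> (\<lambda>x. T (S x)) = frame_trace m c \<delta> (\<lambda>x. S (T x))"
proof -
  have b: "b i \<in> W" "linear_on_carrier W scale (*) (\<gamma> i)" if "i < n" for i
    using 1 that by (auto simp: frame_def)
  have c: "c i \<in> W" "linear_on_carrier W scale (*) (\<delta> i)" if "i < m" for i
    using 2 that by (auto simp: frame_def)
  have "\<gamma> i (T (S (b i))) = (\<Sum>j<m. \<delta> j (S (b i)) * \<gamma> i (T (c j)))" if i: "i < n" for i
  proof -
    have "S (b i) \<in> W" using b(1)[OF i] by (rule S(2))
    then have "S (b i) = (\<Sum>j<m. scale (\<delta> j (S (b i))) (c j))" using 2 by (simp add: frame_def)
    then have "T (S (b i)) = T (\<Sum>j<m. scale (\<delta> j (S (b i))) (c j))" by (rule arg_cong)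
    also have "\<dots> = (\<Sum>j<m. scale (\<delta> j (S (b i))) (T (c j)))"
      using c by (intro linear_on_carrier_sum[OF T(1) W]) auto
    finally have "\<gamma> i (T (S (b i))) = \<gamma> i (\<Sum>j<m. scale (\<delta> j (S (b i))) (T (c j)))" by simp
    also have "\<dots> = (\<Sum>j<m. \<delta> j (S (b i)) * \<gamma> i (T (c j)))"
      using c T(2) by (intro linear_on_carrier_sum[OF b(2)[OF i] W]) auto
    finally show ?thesis .
  qed
  then have "frame_trace n b \<gamma> (\<lambda>x. T (S x)) = (\<Sum>i<n. \<Sum>j<m. \<delta> j (S (b i)) * \<gamma> i (T (c j)))"
    by (simp add: frame_trace_def)
  also have "\<dots> = (\<Sum>j<m. \<Sum>i<n. \<gamma> i (T (c j)) * \<delta> j (S (b i)))"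
    by (subst sum.swap) (simp add: mult.commute)
  also have "\<dots> = frame_trace m c \<delta> (\<lambda>x. S (T x))"
    unfolding frame_trace_def
  proof (rule sum.cong[OF refl])
    fix j assume "j \<in> {..<m}"
    then have j: "j < m" by simp
    have "T (c j) \<in> W" using c(1)[OF j] by (rule T(2))
    then have "T (c j) = (\<Sum>i<n. scale (\<gamma> i (T (c j))) (b i))" using 1 by (simp add: frame_def)
    then have "S (T (c j)) = S (\<Sum>i<n. scale (\<gamma> i (T (c j))) (b i))" by (rule arg_cong)
    also have "\<dots> = (\<Sum>i<n. scale (\<gamma> i (T (c j))) (S (b i)))"
      using b by (intro linear_on_carrier_sum[OF S(1) W]) auto
    finally have "\<delta> j (S (T (c j))) = \<delta> j (\<Sum>i<n. scale (\<gamma> i (T (c j))) (S (b i)))" by simp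
    also have "\<dots> = (\<Sum>i<n. \<gamma> i (T (c j)) * \<delta> j (S (b i)))"
      using b S(2) by (intro linear_on_carrier_sum[OF c(2)[OF j] W]) auto
    finally show "(\<Sum>i<n. \<gamma> i (T (c j)) * \<delta> j (S (b i))) = \<delta> j (S (T (c j)))" ..
  qed
  finally show ?thesis .
qed

lemma linear_on_carrier_id: "linear_on_carrier W scale scale (\<lambda>x. x)"
  by (simp add: linear_on_carrier_def)

lemma frame_trace_unique:
  assumes "subspace W" "frame W n b \<gamma>" "frame W m c \<delta>"
    "linear_on_carrier W scale scale T" "\<And>x. x \<in> W \<Longrightarrow> T x \<in> W"
  shows "frame_trace n b \<gamma> T = frame_trace m c \<delta> T"
  using frame_trace_commute_frames[OF assms linear_on_carrier_id] by simp

lemma linear_on_carrier_subset: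
  "linear_on_carrier V s s' f \<Longrightarrow> W \<subseteq> V \<Longrightarrow> linear_on_carrier W s s' f"
  unfolding linear_on_carrier_def by blast

text \<open>The coefficients of \<open>x\<close> are those of \<open>pr x\<close> in the frame of \<open>U\<close> and those of \<open>x - pr x\<close> in the
  frame of \<open>W\<close>; an operator that preserves both subspaces has block form.\<close>

lemma frame_direct_sum:
  assumes U: "subspace U" "frame U n b \<gamma>" and W: "subspace W" "frame W m c \<delta>"
    and sub: "U \<subseteq> V" "W \<subseteq> V"
    and pr: "linear_on_carrier V scale scale pr" "\<And>x. x \<in> V \<Longrightarrow> pr x \<in> U \<and> x - pr x \<in> W"
    and prU: "\<And>x. x \<in> U \<Longrightarrow> pr x = x" and prW: "\<And>x. x \<in> W \<Longrightarrow> pr x = 0"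
  obtains l d \<epsilon> where "frame V l d \<epsilon>"
    "\<And>T. (\<And>x. x \<in> U \<Longrightarrow> T x \<in> U) \<Longrightarrow> (\<And>x. x \<in> W \<Longrightarrow> T x \<in> W) \<Longrightarrow>
      frame_trace l d \<epsilon> T = frame_trace n b \<gamma> T + frame_trace m c \<delta> T"
proof -
  define d where "d i = (if i < n then b i else c (i - n))" for i
  define \<epsilon> where "\<epsilon> i x = (if i < n then \<gamma> i (pr x) else \<delta> (i - n) (x - pr x))" for i x
  have b: "b i \<in> U" "linear_on_carrier U scale (*) (\<gamma> i)" if "i < n" for i
    using U(2) that by (auto simp: frame_def)
  have c: "c i \<in> W" "linear_on_carrier W scale (*) (\<delta> i)" if "i < m" for i
    using W(2) that by (auto simp: frame_def)
  have split: "(\<Sum>i<n + m. h i) = (\<Sum>i<n. h i) + (\<Sum>i<m. h (n + i))" for h :: "nat \<Rightarrow> 'z::comm_monoid_add"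
    by (induction m) (simp_all add: add.assoc)
  have "frame V (n + m) d \<epsilon>"
    unfolding frame_def
  proof (intro conjI allI impI ballI)
    fix i assume i: "i < n + m"
    show "d i \<in> V" using i b(1)[of i] c(1)[of "i - n"] sub by (auto simp: d_def)
    have lin: "pr (x + y) = pr x + pr y" "pr (scale k x) = scale k (pr x)" if "x \<in> V" "y \<in> V" for k x y
      using pr(1) that unfolding linear_on_carrier_def by blast+
    have e: "x + y - (pr x + pr y) = (x - pr x) + (y - pr y)" for x y by simp
    have e': "scale k x - scale k (pr x) = scale k (x - pr x)" for k x
      by (simp add: scale_right_diff_distrib)
    show "linear_on_carrier V scale (*) (\<epsilon> i)"
      using b(2)[of i] c(2)[of "i - n"] pr(2) i
      unfolding linear_on_carrier_def \<epsilon>_def by (auto simp: lin e e')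
  next
    fix x assume x: "x \<in> V"
    have "pr x = (\<Sum>i<n. scale (\<gamma> i (pr x)) (b i))" using pr(2)[OF x] U(2) by (simp add: frame_def)
    moreover have "x - pr x = (\<Sum>i<m. scale (\<delta> i (x - pr x)) (c i))"
      using pr(2)[OF x] W(2) by (simp add: frame_def)
    ultimately have "x = (\<Sum>i<n. scale (\<gamma> i (pr x)) (b i)) + (\<Sum>i<m. scale (\<delta> i (x - pr x)) (c i))"
      by (metis add_diff_cancel_left' add_diff_eq)
    then show "x = (\<Sum>i<n + m. scale (\<epsilon> i x) (d i))"
      by (simp add: split \<epsilon>_def d_def)
  qed
  moreover have "frame_trace (n + m) d \<epsilon> T = frame_trace n b \<gamma> T + frame_trace m c \<delta> T"
    if T: "\<And>x. x \<in> U \<Longrightarrow> T x \<in> U" "\<And>x. x \<in> W \<Longrightarrow> T x \<in> W" for T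
    using b(1) c(1) by (simp add: frame_trace_def split \<epsilon>_def d_def prU prW T)
  ultimately show ?thesis using that by blast
qed

text \<open>The relation between the members of the sequence is recorded as a polynomial, because for the
  powers \<open>A^i v\<close> it becomes an annihilator of \<open>v\<close>.\<close>

lemma sequence_dependent:
  assumes "\<And>i::nat. x i \<in> V"
  obtains p where "p \<noteq> 0" "(\<Sum>i\<le>degree p. scale (coeff p i) (x i)) = 0"
proof (cases "inj x")
  case True
  obtain C where C: "finite C" "span C = V" using finitely_generated by blast
  have "infinite (range x)" using True by (simp add: finite_image_iff)
  then have "dependent (range x)"
    using independent_span_bound[OF C(1), of "range x"] C(2) assms by blast
  then obtain S u where S: "finite S" "S \<subseteq> range x" "\<exists>v\<in>S. u v \<noteq> 0" "(\<Sum>v\<in>S. scale (u v) v) = 0"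
    unfolding dependent_explicit by blast
  define I where "I = x -` S"
  have I: "finite I" "x ` I = S" unfolding I_def using S True
    by (auto intro!: finite_vimageI)
  define p where "p = (\<Sum>i\<in>I. monom (u (x i)) i)"
  have cf: "coeff p i = (if i \<in> I then u (x i) else 0)" for i
    using I(1) by (simp add: p_def coeff_sum)
  have "p \<noteq> 0"
  proof -
    obtain i where "i \<in> I" "u (x i) \<noteq> 0" using S(3) I(2) by blast
    then have "coeff p i \<noteq> 0" using cf by simp
    then show ?thesis by auto
  qed
  have big: "u (x i) = 0" if "i \<in> I" "\<not> i \<le> degree p" for i
    using cf[of i] coeff_eq_0[of p i] that by simp
  have "(\<Sum>i\<le>degree p. scale (coeff p i) (x i)) = (\<Sum>i\<in>I. scale (u (x i)) (x i))"
  proof (rule sum.mono_neutral_cong)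
    show "scale (coeff p i) (x i) = 0" if "i \<in> {..degree p} - I" for i using that cf[of i] by simp
    show "scale (u (x i)) (x i) = 0" if "i \<in> I - {..degree p}" for i using that big[of i] by simp
    show "scale (coeff p i) (x i) = scale (u (x i)) (x i)" if "i \<in> {..degree p} \<inter> I" for i
      using that cf[of i] by simp
  qed (use I(1) in auto)
  also have "\<dots> = (\<Sum>v\<in>S. scale (u v) v)"
    using sum.reindex[of x I "\<lambda>v. scale (u v) v"] inj_on_subset[OF True, of I] I(2) by simp
  finally show ?thesis using that[of p] \<open>p \<noteq> 0\<close> S(4) by simp
next
  case False
  then obtain i j where "x i = x j" "i \<noteq> j" unfolding inj_def by blast
  then obtain i j where ij: "x i = x j" "i < j" by (metis linorder_neqE_nat)
  define p :: "'k poly" where "p = monom 1 j - monom 1 i"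
  have cf: "coeff p k = (if k = j then 1 else if k = i then -1 else 0)" for k
    using ij(2) by (simp add: p_def)
  have deg: "degree p = j"
  proof (rule antisym)
    show "degree p \<le> j" using ij(2) cf by (intro degree_le allI impI) simp
    show "j \<le> degree p" by (rule le_degree) (simp add: cf)
  qed
  have "(\<Sum>k\<le>j. scale (coeff p k) (x k)) = (\<Sum>k\<in>{i,j}. scale (coeff p k) (x k))"
    using ij(2) by (intro sum.mono_neutral_right) (simp_all add: cf)
  also have "\<dots> = 0" using ij(2) by (simp add: cf ij(1))
  finally have "(\<Sum>k\<le>degree p. scale (coeff p k) (x k)) = 0" unfolding deg .
  moreover have "p \<noteq> 0" using cf[of j] by auto
  ultimately show ?thesis using that by blast
qed

end

section \<open>Polynomials in an endomorphism\<close>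

locale fd_endo = fd_carrier scale V
  for scale :: "'k::field \<Rightarrow> 'b::ab_group_add \<Rightarrow> 'b" and V +
  fixes A :: "'b \<Rightarrow> 'b"
  assumes endo_linear: "linear_on_carrier V scale scale A"
    and endo_closed: "x \<in> V \<Longrightarrow> A x \<in> V"
begin

abbreviation pa :: "'k poly \<Rightarrow> 'b \<Rightarrow> 'b" where
  "pa p x \<equiv> poly_apply scale p A x"

lemma endo_add: "\<lbrakk>x \<in> V; y \<in> V\<rbrakk> \<Longrightarrow> A (x + y) = A x + A y"
  and endo_scale: "x \<in> V \<Longrightarrow> A (scale c x) = scale c (A x)"
  using endo_linear by (auto simp: linear_on_carrier_def)

lemma endo_0: "A 0 = 0"
  by (rule linear_on_carrier_0[OF endo_linear subspace_carrier])

lemma pow_closed: "x \<in> V \<Longrightarrow> (A ^^ i) x \<in> V"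
  by (induction i) (auto simp: endo_closed)

lemma pow_add: "\<lbrakk>x \<in> V; y \<in> V\<rbrakk> \<Longrightarrow> (A ^^ i) (x + y) = (A ^^ i) x + (A ^^ i) y"
  by (induction i) (auto simp: endo_add pow_closed)

lemma pow_scale: "x \<in> V \<Longrightarrow> (A ^^ i) (scale c x) = scale c ((A ^^ i) x)"
  by (induction i) (auto simp: endo_scale pow_closed)

lemma pow_linear: "linear_on_carrier V scale scale (A ^^ i)"
  by (simp add: linear_on_carrier_def pow_add pow_scale)

lemma pa_bound: "degree p \<le> N \<Longrightarrow> pa p x = (\<Sum>i\<le>N. scale (coeff p i) ((A ^^ i) x))"
  unfolding poly_apply_def by (rule sum_coeff_bound) auto

lemma pa_0 [simp]: "pa 0 x = 0"
  by (simp add: poly_apply_def)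

lemma pa_pCons: "x \<in> V \<Longrightarrow> pa (pCons a p) x = scale a x + pa p (A x)"
proof -
  have "pa (pCons a p) x = (\<Sum>i\<le>Suc (degree p). scale (coeff (pCons a p) i) ((A ^^ i) x))"
    by (rule pa_bound) (simp add: degree_pCons_le)
  also have "\<dots> = scale a x + (\<Sum>i\<le>degree p. scale (coeff p i) ((A ^^ Suc i) x))"
    by (subst sum.atMost_Suc_shift) simp
  finally show ?thesis by (simp add: poly_apply_def funpow_swap1)
qed

lemma pa_closed: "x \<in> V \<Longrightarrow> pa p x \<in> V"
  unfolding poly_apply_def by (intro carrier_sum carrier_scale pow_closed)

lemma pa_add: "pa (p + q) x = pa p x + pa q x"
proof -
  define N where "N = max (degree p) (degree q)"
  have "degree (p + q) \<le> N" "degree p \<le> N" "degree q \<le> N"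
    by (auto simp: N_def degree_add_le_max)
  then show ?thesis
    using pa_bound[of p N x] pa_bound[of q N x] pa_bound[of "p + q" N x]
    by (simp add: scale_left_distrib sum.distrib)
qed

lemma pa_smult: "pa (smult c p) x = scale c (pa p x)"
  using pa_bound[of "smult c p" "degree p" x]
  by (simp add: degree_smult_le poly_apply_def scale_sum_right)

lemma pa_diff: "pa (p - q) x = pa p x - pa q x"
  using pa_add[of "p - q" q x] by simp

lemma pa_vector_add: "\<lbrakk>x \<in> V; y \<in> V\<rbrakk> \<Longrightarrow> pa p (x + y) = pa p x + pa p y"
  by (simp add: poly_apply_def pow_add scale_right_distrib sum.distrib)

lemma pa_vector_scale: "x \<in> V \<Longrightarrow> pa p (scale c x) = scale c (pa p x)"
  by (simp add: poly_apply_def pow_scale scale_sum_right mult.commute)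

lemma pa_linear: "linear_on_carrier V scale scale (pa p)"
  by (simp add: linear_on_carrier_def pa_vector_add pa_vector_scale)

lemma pa_vector_0: "pa p 0 = 0"
  by (rule linear_on_carrier_0[OF pa_linear subspace_carrier])

lemma endo_pa: "x \<in> V \<Longrightarrow> A (pa p x) = pa p (A x)"
proof -
  assume x: "x \<in> V"
  have "A (pa p x) = (\<Sum>i\<le>degree p. scale (coeff p i) (A ((A ^^ i) x)))"
    unfolding poly_apply_def
    using x by (intro linear_on_carrier_sum[OF endo_linear subspace_carrier]) (rule pow_closed)
  then show ?thesis by (simp add: poly_apply_def funpow_swap1)
qed

text \<open>Evaluation at \<open>A\<close> is multiplicative on the carrier only, where \<open>A\<close> is linear; powers of \<open>A\<close>
  stay in the carrier, so that the induction on \<open>p\<close> may replace \<open>x\<close> by \<open>A x\<close>.\<close>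

lemma pa_mult: "x \<in> V \<Longrightarrow> pa (p * q) x = pa p (pa q x)"
proof (induction p arbitrary: x)
  case (pCons a p)
  have "pa (pCons a p * q) x = scale a (pa q x) + pa (p * q) (A x)"
    using pCons.prems by (simp add: pa_add pa_smult pa_pCons)
  also have "\<dots> = scale a (pa q x) + pa p (A (pa q x))"
    using pCons by (simp add: endo_closed endo_pa)
  finally show ?case using pCons.prems by (simp add: pa_pCons pa_closed)
qed simp

lemma pa_commute: "x \<in> V \<Longrightarrow> pa p (pa q x) = pa q (pa p x)"
  by (simp flip: pa_mult add: mult.commute)

lemma pa_monom: "pa (monom 1 k) x = (A ^^ k) x"
proof -
  have "pa (monom 1 k) x = (\<Sum>i\<le>k. scale (coeff (monom 1 k) i) ((A ^^ i) x))"
    by (rule pa_bound) (simp add: degree_monom_le)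
  also have "\<dots> = (\<Sum>i\<in>{k}. scale (coeff (monom 1 k) i) ((A ^^ i) x))"
    by (rule sum.mono_neutral_right) auto
  finally show ?thesis by simp
qed

lemma pa_1 [simp]: "pa 1 x = x"
  by (simp add: poly_apply_def)

lemma pa_dvd: "x \<in> V \<Longrightarrow> p dvd q \<Longrightarrow> pa p x = 0 \<Longrightarrow> pa q x = 0"
  by (elim dvdE) (simp add: pa_mult pa_commute[of x p] pa_vector_0)

lemma annihilator_generator:
  assumes Y: "Y \<subseteq> V" and p: "p \<noteq> 0" "\<And>x. x \<in> Y \<Longrightarrow> pa p x = 0"
  obtains g where "lead_coeff g = 1" "\<And>q. (\<forall>x\<in>Y. pa q x = 0) \<longleftrightarrow> g dvd q"
proof -
  define S where "S = {q. \<forall>x\<in>Y. pa q x = 0}"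
  have "p \<in> S" using p by (simp add: S_def)
  moreover have "a - b \<in> S" if "a \<in> S" "b \<in> S" for a b using that by (simp add: S_def pa_diff)
  moreover have "r * a \<in> S" if "a \<in> S" for a r
    using that Y by (auto simp: S_def pa_mult pa_vector_0 subset_iff)
  ultimately obtain g where g: "g \<in> S" "lead_coeff g = 1" "\<And>a. a \<in> S \<Longrightarrow> g dvd a"
    using poly_ideal_principal[OF _ p(1)] by metis
  have "(\<forall>x\<in>Y. pa q x = 0) \<longleftrightarrow> g dvd q" for q
    using g(1,3) pa_dvd[of _ g q] Y by (auto simp: S_def)
  then show ?thesis using that g(2) by blast
qed

lemma vector_annihilator: "x \<in> V \<Longrightarrow> \<exists>p. p \<noteq> 0 \<and> pa p x = 0"
  using sequence_dependent[of "\<lambda>i. (A ^^ i) x"] unfolding poly_apply_def by (metis pow_closed)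

lemma carrier_annihilator: "\<exists>p. p \<noteq> 0 \<and> (\<forall>x\<in>V. pa p x = 0)"
proof -
  obtain B where B: "finite B" "span B = V" using finitely_generated by blast
  have "B \<subseteq> V" using B(2) span_superset by blast
  with B(1) have "\<exists>p. p \<noteq> 0 \<and> (\<forall>x\<in>B. pa p x = 0)"
  proof (induction B)
    case (insert b B)
    then obtain p where p: "p \<noteq> 0" "\<forall>x\<in>B. pa p x = 0" by auto
    obtain q where q: "q \<noteq> 0" "pa q b = 0" using vector_annihilator insert.prems by blast
    have "pa (p * q) x = 0" if "x \<in> insert b B" for x
      using that insert.prems p(2) q(2) pa_dvd[of x p "p * q"] pa_dvd[of x q "p * q"] by auto
    then show ?case using p(1) q(1) by (metis mult_eq_0_iff)
  qed (auto intro: exI[of _ 1])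
  then obtain p where p: "p \<noteq> 0" "\<forall>x\<in>B. pa p x = 0" by blast
  have "subspace {x\<in>V. pa p x = 0}"
    by (simp add: subspace_def carrier_closed pa_vector_0 pa_vector_add pa_vector_scale)
  moreover have "B \<subseteq> {x\<in>V. pa p x = 0}" using p(2) B(2) span_superset by blast
  ultimately have "V \<subseteq> {x\<in>V. pa p x = 0}" using B(2) span_minimal by blast
  then show ?thesis using p(1) by blast
qed

text \<open>The definite description in the definition of the minimal polynomial is proper: the generator
  of the annihilator ideal is unique once it is monic.\<close>

lemma minimal_polynomial:
  shows minimal_polynomial_monic: "lead_coeff (minimal_polynomial scale V A) = 1"
    and annihilates_iff: "annihilates scale V A q \<longleftrightarrow> minimal_polynomial scale V A dvd q"
proof -
  obtain p where p: "p \<noteq> 0" "\<forall>x\<in>V. pa p x = 0" using carrier_annihilator by blast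
  from annihilator_generator[of V p] p obtain g where
    g: "lead_coeff g = 1" "\<And>q. (\<forall>x\<in>V. pa q x = 0) \<longleftrightarrow> g dvd q" by blast
  have "minimal_polynomial scale V A = g"
    unfolding minimal_polynomial_def
  proof (rule the_equality)
    show "lead_coeff g = 1 \<and> annihilates scale V A g \<and> (\<forall>q. annihilates scale V A q \<longrightarrow> g dvd q)"
      using g by (simp add: annihilates_def)
    fix h assume h: "lead_coeff h = 1 \<and> annihilates scale V A h \<and> (\<forall>q. annihilates scale V A q \<longrightarrow> h dvd q)"
    have "h dvd g" "g dvd h" using g h by (simp_all add: annihilates_def)
    then obtain r where r: "g = h * r" by (elim dvdE)
    have "degree r = 0"
    proof -
      have "degree g \<le> degree h" using \<open>g dvd h\<close> h by (intro dvd_imp_degree_le) auto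
      moreover have "g \<noteq> 0" using g(1) by auto
      then have "degree g = degree h + degree r" unfolding r by (intro degree_mult_eq) auto
      ultimately show ?thesis by simp
    qed
    moreover have "lead_coeff h * lead_coeff r = 1"
      using g(1) unfolding r lead_coeff_mult .
    then have "lead_coeff r = 1" using h by simp
    ultimately show "h = g" using r monic_degree_0[of r] by simp
  qed
  then show "lead_coeff (minimal_polynomial scale V A) = 1"
    "annihilates scale V A q \<longleftrightarrow> minimal_polynomial scale V A dvd q"
    using g by (auto simp: annihilates_def)
qed

text \<open>The base change to the algebraic closure is carried out in the values of functionals: for
  linear \<open>g\<close> the sequence \<open>g(A^k x)\<close> satisfies the recurrences given by the annihilators of \<open>A\<close>.\<close>

lemma seq_eval_functional:
  assumes g: "linear_on_carrier V scale (*) g" and x: "x \<in> V"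
  shows "seq_eval (ac_poly p) (\<lambda>k. to_ac (g ((A ^^ k) x))) = to_ac (g (pa p x))"
proof -
  have "g (pa p x) = (\<Sum>k\<le>degree p. coeff p k * g ((A ^^ k) x))"
    unfolding poly_apply_def
    using x by (intro linear_on_carrier_sum[OF g subspace_carrier] pow_closed)
  then show ?thesis by (simp add: seq_eval_def degree_ac_poly coeff_ac_poly to_ac_sum)
qed

text \<open>On a cyclic subspace \<open>K[A]v\<close> the trace of \<open>A^k\<close> is the \<open>k\<close>-th power sum of the roots
  of the annihilator \<open>g\<close> of \<open>v\<close>, if these are simple.  In the frame \<open>v, Av, ...\<close> the diagonal
  entries are the coefficients of \<open>X^(k+j) mod g\<close>, and interpolation at the roots of \<open>g\<close>
  turns their sum into the power sum.\<close>

lemma cyclic_trace: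
  assumes v: "v \<in> V" and g: "lead_coeff g = 1" "\<And>q. pa q v = 0 \<longleftrightarrow> g dvd q"
    and sq: "rsquarefree (ac_poly g)"
  obtains n b \<gamma> where "frame {pa a v | a. True} n b \<gamma>"
    "\<And>k. to_ac (frame_trace n b \<gamma> (A ^^ k)) = (\<Sum>x | poly (ac_poly g) x = 0. x ^ k)"
proof -
  define W where "W = {pa a v | a. True}"
  define n where "n = degree g"
  define b where "b j = (A ^^ j) v" for j
  define \<gamma> where "\<gamma> j w = coeff ((SOME a. pa a v = w) mod g) j" for j w
  have g0: "g \<noteq> 0" using g(1) by auto
  have mod_add: "(p + q) mod g = p mod g + q mod g" for p q by (rule poly_mod_add_left)
  have \<gamma>: "\<gamma> j (pa a v) = coeff (a mod g) j" for j a
  proof -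
    have "pa (SOME a'. pa a' v = pa a v) v = pa a v" by (rule someI) (rule refl)
    then have "g dvd (SOME a'. pa a' v = pa a v) - a"
      by (simp only: g(2)[symmetric] pa_diff diff_self)
    then have "(SOME a'. pa a' v = pa a v) mod g = a mod g" by (simp add: mod_eq_dvd_iff)
    then show ?thesis by (simp add: \<gamma>_def)
  qed
  have deg: "coeff (a mod g) i = 0" if "i \<ge> n" for a i
    using degree_mod_less[OF g0, of a] that coeff_eq_0[of "a mod g" i] by (auto simp: n_def)
  have "frame W n b \<gamma>"
    unfolding frame_def
  proof (intro conjI allI impI ballI)
    fix j assume "j < n"
    show "b j \<in> W" unfolding W_def b_def
      by (rule CollectI, rule exI[of _ "monom 1 j"]) (simp only: pa_monom simp_thms)
    show "linear_on_carrier W scale (*) (\<gamma> j)"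
      unfolding linear_on_carrier_def W_def
    proof (intro conjI allI ballI)
      fix c x y assume "x \<in> {pa a v | a. True}" "y \<in> {pa a v | a. True}"
      then obtain p q where pq: "x = pa p v" "y = pa q v" by blast
      show "\<gamma> j (x + y) = \<gamma> j x + \<gamma> j y" by (simp add: pq \<gamma> mod_add flip: pa_add)
    next
      fix c x assume "x \<in> {pa a v | a. True}"
      then obtain p where p: "x = pa p v" by blast
      show "\<gamma> j (scale c x) = c * \<gamma> j x" by (simp add: p \<gamma> mod_smult_left flip: pa_smult)
    qed
  next
    fix x assume "x \<in> W"
    then obtain a where a: "x = pa a v" by (auto simp: W_def)
    have "pa (a mod g) v = pa a v"
    proof -
      have "g dvd a mod g - a" by (simp add: mod_eq_dvd_iff[symmetric])
      then show ?thesis using g(2)[of "a mod g - a"] by (simp add: pa_diff)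
    qed
    moreover have "pa (a mod g) v = (\<Sum>i\<le>max n (degree (a mod g)). scale (coeff (a mod g) i) (b i))"
      unfolding b_def by (rule pa_bound) simp
    moreover have "\<dots> = (\<Sum>i<n. scale (coeff (a mod g) i) (b i))"
      by (rule sum.mono_neutral_right) (auto simp: deg)
    ultimately show "x = (\<Sum>i<n. scale (\<gamma> i x) (b i))" by (simp add: a \<gamma>)
  qed
  moreover have "to_ac (frame_trace n b \<gamma> (A ^^ k)) = (\<Sum>x | poly (ac_poly g) x = 0. x ^ k)" for k
  proof -
    define R where "R = {x. poly (ac_poly g) x = 0}"
    have ac0: "ac_poly g \<noteq> 0" "lead_coeff (ac_poly g) = 1"
      using g(1) sq by (auto simp: rsquarefree_def degree_ac_poly coeff_ac_poly)
    have R: "finite R" unfolding R_def using ac0(1) by (rule poly_roots_finite)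
    have "ac_poly g = (\<Prod>x\<in>R. [:-x, 1:])"
      unfolding R_def using rsquarefree_splits[OF sq ac0(2)] .
    then have "degree (ac_poly g) = degree (\<Prod>x\<in>R. [:-x, 1:])" by (rule arg_cong)
    also have "\<dots> = (\<Sum>x\<in>R. degree [:-x, 1:])" by (rule degree_prod_eq_sum_degree) auto
    finally have card: "card R = n" by (simp add: degree_ac_poly n_def)
    have step: "to_ac (\<gamma> j ((A ^^ k) (b j))) = (\<Sum>x\<in>R. x ^ k * (x ^ j * coeff (lagrange R x) j))" for j
    proof -
      define h where "h = ac_poly (monom 1 (k + j) mod g)"
      have "(A ^^ k) (b j) = pa (monom 1 (k + j)) v" by (simp add: b_def pa_monom funpow_add)
      then have trace: "to_ac (\<gamma> j ((A ^^ k) (b j))) = coeff h j"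
        by (simp add: \<gamma> h_def coeff_ac_poly)
      have "degree h < card R \<or> h = 0"
        using degree_mod_less[OF g0, of "monom 1 (k + j)"]
        by (auto simp: h_def degree_ac_poly card n_def)
      then have expand: "h = (\<Sum>x\<in>R. smult (poly h x) (lagrange R x))"
        by (rule lagrange_expansion[OF R])
      have val: "poly h x = x ^ (k + j)" if "x \<in> R" for x
      proof -
        have "ac_poly (monom 1 (k + j)) = ac_poly (monom 1 (k + j) div g) * ac_poly g + h"
          unfolding h_def by (metis ac_poly_add ac_poly_mult div_mult_mod_eq)
        moreover have "poly (ac_poly g) x = 0" using that by (simp add: R_def)
        ultimately have "poly (ac_poly (monom 1 (k + j))) x = poly h x" by simp
        then show ?thesis by (simp add: map_poly_monom poly_monom)
      qed
      have "coeff h j = coeff (\<Sum>x\<in>R. smult (poly h x) (lagrange R x)) j"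
        by (rule arg_cong[OF expand])
      also have "\<dots> = (\<Sum>x\<in>R. poly h x * coeff (lagrange R x) j)" by (simp add: coeff_sum)
      also have "\<dots> = (\<Sum>x\<in>R. x ^ k * (x ^ j * coeff (lagrange R x) j))"
        by (rule sum.cong) (simp_all add: val power_add mult.assoc)
      finally have "coeff h j = (\<Sum>x\<in>R. x ^ k * (x ^ j * coeff (lagrange R x) j))" .
      then show ?thesis using trace by simp
    qed
    have lag: "(\<Sum>j<n. x ^ j * coeff (lagrange R x) j) = 1" if x: "x \<in> R" for x
    proof -
      have "poly (lagrange R x) x = (\<Sum>j<n. coeff (lagrange R x) j * x ^ j)"
        using degree_lagrange[OF R x] card unfolding poly_altdef
        by (intro sum.mono_neutral_left) (auto simp: coeff_eq_0)
      then show ?thesis using poly_lagrange[OF R x x] by (simp add: mult.commute)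
    qed
    have "to_ac (frame_trace n b \<gamma> (A ^^ k)) = (\<Sum>j<n. \<Sum>x\<in>R. x ^ k * (x ^ j * coeff (lagrange R x) j))"
      by (simp add: frame_trace_def to_ac_sum step)
    also have "\<dots> = (\<Sum>x\<in>R. x ^ k * (\<Sum>j<n. x ^ j * coeff (lagrange R x) j))"
      by (subst sum.swap) (simp add: sum_distrib_left)
    also have "\<dots> = (\<Sum>x\<in>R. x ^ k)" by (simp add: lag)
    finally show ?thesis by (simp add: R_def)
  qed
  ultimately show ?thesis using that unfolding W_def by blast
qed

end

section \<open>Anisotropic quadratic spaces\<close>

sublocale quadratic_space \<subseteq> fd_carrier scale V
  by unfold_locales (fact subspace_V finite_dim)+

context quadratic_space
begin

lemma form_left_simps:
  "\<lbrakk>x \<in> V; y \<in> V; z \<in> V\<rbrakk> \<Longrightarrow> \<phi> (x + y) z = \<phi> x z + \<phi> y z"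
  "\<lbrakk>x \<in> V; y \<in> V; z \<in> V\<rbrakk> \<Longrightarrow> \<phi> (x - y) z = \<phi> x z - \<phi> y z"
  "\<lbrakk>x \<in> V; z \<in> V\<rbrakk> \<Longrightarrow> \<phi> (scale c x) z = c * \<phi> x z"
  "\<lbrakk>x \<in> V; z \<in> V\<rbrakk> \<Longrightarrow> \<phi> (- x) z = - \<phi> x z"
  "z \<in> V \<Longrightarrow> \<phi> 0 z = 0"
proof -
  assume z: "z \<in> V"
  show "\<phi> 0 z = 0" using form_scale[OF z z, of 0] by simp
  assume x: "x \<in> V"
  show "\<phi> (scale c x) z = c * \<phi> x z" using form_scale[OF x z] .
  show "\<phi> (- x) z = - \<phi> x z" using form_scale[OF x z, of "-1"] by simp
  assume y: "y \<in> V"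
  show "\<phi> (x + y) z = \<phi> x z + \<phi> y z" using form_add[OF x y z] .
  show "\<phi> (x - y) z = \<phi> x z - \<phi> y z"
    using form_add[of "x - y" y z] x y z by (simp add: carrier_closed algebra_simps)
qed

lemma form_right_simps:
  "\<lbrakk>x \<in> V; y \<in> V; z \<in> V\<rbrakk> \<Longrightarrow> \<phi> z (x + y) = \<phi> z x + \<phi> z y"
  "\<lbrakk>x \<in> V; y \<in> V; z \<in> V\<rbrakk> \<Longrightarrow> \<phi> z (x - y) = \<phi> z x - \<phi> z y"
  "\<lbrakk>x \<in> V; z \<in> V\<rbrakk> \<Longrightarrow> \<phi> z (scale c x) = c * \<phi> z x"
  "\<lbrakk>x \<in> V; z \<in> V\<rbrakk> \<Longrightarrow> \<phi> z (- x) = - \<phi> z x"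
  "z \<in> V \<Longrightarrow> \<phi> z 0 = 0"
  by (simp_all add: form_sym[of z] carrier_closed form_left_simps)

lemmas form_simps = form_left_simps form_right_simps

end

locale anisotropic_space = quadratic_space scale V \<phi>
  for scale :: "'k::field_char_0 \<Rightarrow> 'b::ab_group_add \<Rightarrow> 'b" and V \<phi> +
  assumes anisotropic: "\<lbrakk>x \<in> V; \<phi> x x = 0\<rbrakk> \<Longrightarrow> x = 0"
begin

text \<open>Gram-Schmidt along a finite spanning set of \<open>W\<close>: no vector is isotropic, so that every step
  either extends the set by an orthogonal vector of non-zero norm or adds nothing.\<close>

lemma orthogonal_decomposition:
  assumes W: "subspace W" "W \<subseteq> V" and x: "x \<in> V"
  shows "\<exists>w\<in>W. \<forall>y\<in>W. \<phi> (x - w) y = 0"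
proof -
  obtain B where B: "finite B" "independent B" "B \<subseteq> W" "span B = W"
    by (rule subspace_basis[OF W])
  have *: "\<exists>w\<in>span B. \<forall>y\<in>span B. \<phi> (x - w) y = 0" if "finite B" "B \<subseteq> V" "x \<in> V" for x B
    using that
  proof (induction B arbitrary: x)
    case empty
    show ?case by (rule bexI[of _ 0]) (simp_all add: empty form_right_simps)
  next
    case (insert b B)
    have b: "b \<in> V" and BV: "B \<subseteq> V" and x: "x \<in> V" using insert.prems by auto
    have spV: "span B \<subseteq> V" using BV by (rule span_minimal) (rule subspace_carrier)
    obtain w where w: "w \<in> span B" "\<forall>y\<in>span B. \<phi> (x - w) y = 0" using insert.IH[OF BV x] by blast
    obtain u where u: "u \<in> span B" "\<forall>y\<in>span B. \<phi> (b - u) y = 0" using insert.IH[OF BV b] by blast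
    note V = w(1)[THEN subsetD[OF spV]] u(1)[THEN subsetD[OF spV]]
    \<comment> \<open>If \<open>b - u = 0\<close> the quotient is \<open>0\<close>, and \<open>b\<close> contributes nothing.\<close>
    define c where "c = \<phi> (x - w) (b - u) / \<phi> (b - u) (b - u)"
    define v where "v = w + scale c (b - u)"
    have vV: "v \<in> V" using V b by (simp add: v_def carrier_closed)
    have uI: "u \<in> span (insert b B)" "w \<in> span (insert b B)"
      using u(1) w(1) span_mono[of B "insert b B"] by auto
    have "v \<in> span (insert b B)"
      unfolding v_def
      by (rule span_add[OF uI(2) span_scale[OF span_diff[OF span_base[OF insertI1] uI(1)]]])
    moreover have "\<phi> (x - v) y = 0" if y: "y \<in> span (insert b B)" for y
    proof -
      obtain k where k: "y - scale k b \<in> span B" using span_breakdown_eq[THEN iffD1, OF y] by blast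
      define s where "s = y - scale k b + scale k u"
      have s: "s \<in> span B" unfolding s_def by (rule span_add[OF k span_scale[OF u(1)]])
      have sV: "s \<in> V" using s spV by blast
      have y_eq: "y = s + scale k (b - u)" by (simp add: s_def algebra_simps)
      have xw: "x - w \<in> V" and bu: "b - u \<in> V" using V b x by (simp_all add: carrier_diff)
      have cbu: "scale c (b - u) \<in> V" using bu by (rule carrier_scale)
      have eq: "x - v = (x - w) - scale c (b - u)" by (simp add: v_def)
      have val: "\<phi> (x - v) t = \<phi> (x - w) t - c * \<phi> (b - u) t" if "t \<in> V" for t
        unfolding eq form_left_simps(2)[OF xw cbu that] form_left_simps(3)[OF bu that] ..
      have "\<phi> (x - v) s = 0" using val[OF sV] w(2) u(2) s by simp
      moreover have "\<phi> (x - v) (b - u) = 0"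
      proof (cases "b - u = 0")
        case True
        then show ?thesis using carrier_diff[OF x vV] by (simp add: form_right_simps)
      next
        case False
        then have "\<phi> (b - u) (b - u) \<noteq> 0" using anisotropic[OF bu] by blast
        then show ?thesis unfolding val[OF bu] c_def by simp
      qed
      moreover have "\<phi> (x - v) (s + scale k (b - u)) = \<phi> (x - v) s + k * \<phi> (x - v) (b - u)"
        using carrier_diff[OF x vV] sV bu carrier_scale[OF bu] by (simp only: form_right_simps)
      ultimately show ?thesis unfolding y_eq by simp
    qed
    ultimately show ?case by blast
  qed
  from *[OF B(1) subset_trans[OF B(3) W(2)] x] show ?thesis unfolding B(4) .
qed

lemma orthogonal_projection:
  assumes U: "subspace U" "U \<subseteq> V"
  obtains pr where "linear_on_carrier V scale scale pr"
    "\<And>x. x \<in> V \<Longrightarrow> pr x \<in> U" "\<And>x y. x \<in> V \<Longrightarrow> y \<in> U \<Longrightarrow> \<phi> (x - pr x) y = 0"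
    "\<And>x. x \<in> U \<Longrightarrow> pr x = x" "\<And>x. x \<in> V \<Longrightarrow> (\<And>y. y \<in> U \<Longrightarrow> \<phi> x y = 0) \<Longrightarrow> pr x = 0"
proof -
  have "\<forall>x\<in>V. \<exists>w. w \<in> U \<and> (\<forall>y\<in>U. \<phi> (x - w) y = 0)"
    using orthogonal_decomposition[OF U] by blast
  then obtain pr where pr: "\<And>x. x \<in> V \<Longrightarrow> pr x \<in> U \<and> (\<forall>y\<in>U. \<phi> (x - pr x) y = 0)"
    by (metis bchoice)
  have uniq: "pr x = w" if x: "x \<in> V" and w: "w \<in> U" "\<And>y. y \<in> U \<Longrightarrow> \<phi> (x - w) y = 0" for x w
  proof -
    have d: "pr x - w \<in> U" using pr[OF x] w(1) subspace_diff[OF U(1)] by blast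
    have "\<phi> (x - w) (pr x - w) - \<phi> (x - pr x) (pr x - w) = \<phi> (pr x - w) (pr x - w)"
      using pr[OF x] w(1) x d U(2) by (simp add: form_simps carrier_closed subset_iff)
    then have "\<phi> (pr x - w) (pr x - w) = 0" using pr[OF x] w(2)[OF d] d by simp
    then show ?thesis using anisotropic[of "pr x - w"] d U(2) by auto
  qed
  have "linear_on_carrier V scale scale pr"
    unfolding linear_on_carrier_def
  proof (intro conjI allI ballI)
    fix x y assume x: "x \<in> V" and y: "y \<in> V"
    note UV = subsetD[OF U(2)]
    show "pr (x + y) = pr x + pr y"
    proof (rule uniq)
      fix v assume v: "v \<in> U"
      have "\<phi> (x + y - (pr x + pr y)) v = \<phi> (x - pr x) v + \<phi> (y - pr y) v"
        using x y v pr[OF x] pr[OF y] by (simp add: form_simps carrier_closed UV)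
      then show "\<phi> (x + y - (pr x + pr y)) v = 0" using pr[OF x] pr[OF y] v by simp
    qed (use x y pr[OF x] pr[OF y] U in \<open>auto simp: carrier_closed subspace_add\<close>)
  next
    fix c x assume x: "x \<in> V"
    note UV = subsetD[OF U(2)]
    show "pr (scale c x) = scale c (pr x)"
    proof (rule uniq)
      fix v assume v: "v \<in> U"
      have "\<phi> (scale c x - scale c (pr x)) v = c * \<phi> (x - pr x) v"
        using x v pr[OF x] by (simp add: form_simps carrier_closed UV algebra_simps)
      then show "\<phi> (scale c x - scale c (pr x)) v = 0" using pr[OF x] v by simp
    qed (use x pr[OF x] U in \<open>auto simp: carrier_closed subspace_scale\<close>)
  qed
  moreover have "pr x = x" if "x \<in> U" for x using that U(2) by (intro uniq) (auto simp: form_simps)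
  moreover have "pr x = 0" if "x \<in> V" "\<And>y. y \<in> U \<Longrightarrow> \<phi> x y = 0" for x
    using that U by (intro uniq) (auto simp: subspace_0)
  ultimately show ?thesis using that pr by blast
qed

text \<open>The representing vector is orthogonal to the kernel of \<open>g\<close>.\<close>

lemma riesz_representation:
  assumes g: "linear_on_carrier V scale (*) g"
  obtains w where "w \<in> V" "\<And>x. x \<in> V \<Longrightarrow> g x = \<phi> w x"
proof (cases "\<forall>x\<in>V. g x = 0")
  case True
  show ?thesis by (rule that[of 0]) (simp_all add: True form_left_simps carrier_0)
next
  case False
  then obtain x where x: "x \<in> V" "g x \<noteq> 0" by blast
  define W where "W = {x\<in>V. g x = 0}"
  have lin: "g (a + b) = g a + g b" "g (scale c a) = c * g a" if "a \<in> V" "b \<in> V" for a b c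
    using g that by (auto simp: linear_on_carrier_def)
  have g0: "g 0 = 0" by (rule linear_on_carrier_0[OF g subspace_carrier])
  have gdiff: "g (a - b) = g a - g b" if "a \<in> V" "b \<in> V" for a b
    using lin(1)[of "a - b" b] that by (simp add: carrier_closed)
  have W: "subspace W" "W \<subseteq> V" by (auto simp: W_def subspace_def carrier_closed lin g0)
  obtain w where w: "w \<in> W" "\<forall>y\<in>W. \<phi> (x - w) y = 0"
    using orthogonal_decomposition[OF W x(1)] by blast
  define e where "e = x - w"
  have e: "e \<in> V" "g e = g x" using w(1) x by (simp_all add: e_def W_def gdiff carrier_closed)
  then have "e \<noteq> 0" using x g0 by auto
  then have nz: "\<phi> e e \<noteq> 0" using anisotropic e(1) by blast
  have "g y = \<phi> (scale (g e / \<phi> e e) e) y" if y: "y \<in> V" for y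
  proof -
    have "g (y - scale (g y / g e) e) = g y - g y / g e * g e"
      using y e(1) by (simp only: gdiff lin(2) carrier_scale)
    also have "\<dots> = 0" using e(2) x(2) by simp
    finally have "y - scale (g y / g e) e \<in> W"
      using y e(1) by (simp add: W_def carrier_diff carrier_scale)
    then have "\<phi> e (y - scale (g y / g e) e) = 0" using w(2) unfolding e_def by blast
    then have "\<phi> e y = g y / g e * \<phi> e e"
      using y e(1) by (simp add: form_right_simps carrier_scale)
    then show ?thesis using y e x nz by (simp add: form_left_simps)
  qed
  then show ?thesis by (rule that[OF carrier_scale[OF e(1)]])
qed

text \<open>Although \<open>\<kappa>\<close> may be degenerate, it represents every functional that vanishes on its
  radical: the subspace of the vectors that represent, via \<open>\<phi>\<close>, functionals of the form
  \<open>\<kappa> s\<close> is the orthogonal complement of the radical.\<close>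

lemma degenerate_representation:
  assumes \<kappa>: "\<And>x. x \<in> V \<Longrightarrow> linear_on_carrier V scale (*) (\<kappa> x)"
    and sym: "\<And>x y. x \<in> V \<Longrightarrow> y \<in> V \<Longrightarrow> \<kappa> x y = \<kappa> y x"
    and g: "linear_on_carrier V scale (*) g"
    and rad: "\<And>x. x \<in> V \<Longrightarrow> (\<And>y. y \<in> V \<Longrightarrow> \<kappa> x y = 0) \<Longrightarrow> g x = 0"
  obtains s where "s \<in> V" "\<And>x. x \<in> V \<Longrightarrow> g x = \<kappa> s x"
proof -
  define W where "W = {w\<in>V. \<exists>s\<in>V. \<forall>x\<in>V. \<kappa> s x = \<phi> w x}"
  have lin: "\<kappa> (x + y) z = \<kappa> x z + \<kappa> y z" "\<kappa> (scale c x) z = c * \<kappa> x z"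
    if "x \<in> V" "y \<in> V" "z \<in> V" for x y z c
    using that \<kappa>[of z] by (auto simp: linear_on_carrier_def sym[of _ z] carrier_closed)
  have W: "subspace W" "W \<subseteq> V"
  proof -
    have "0 \<in> W"
    proof -
      have "\<kappa> 0 x = 0" if "x \<in> V" for x using lin(2)[of 0 0 x 0] that by (simp add: carrier_closed)
      then show ?thesis by (auto simp: W_def form_simps carrier_closed intro!: bexI[of _ 0])
    qed
    moreover have "x + y \<in> W" if xy: "x \<in> W" "y \<in> W" for x y
    proof -
      obtain s t where "s \<in> V" "\<forall>v\<in>V. \<kappa> s v = \<phi> x v" "t \<in> V" "\<forall>v\<in>V. \<kappa> t v = \<phi> y v"
        using xy by (auto simp: W_def)
      then show ?thesis using xy
        by (auto simp: W_def form_simps carrier_closed lin intro!: bexI[of _ "s + t"])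
    qed
    moreover have "scale c x \<in> W" if xy: "x \<in> W" for x c
    proof -
      obtain s where "s \<in> V" "\<forall>v\<in>V. \<kappa> s v = \<phi> x v" using xy by (auto simp: W_def)
      then show ?thesis using xy
        by (auto simp: W_def form_simps carrier_closed lin intro!: bexI[of _ "scale c s"])
    qed
    ultimately show "subspace W" by (simp add: subspace_def)
  qed (auto simp: W_def)
  obtain w where w: "w \<in> V" "\<And>x. x \<in> V \<Longrightarrow> g x = \<phi> w x" using riesz_representation[OF g] by blast
  obtain w0 where w0: "w0 \<in> W" "\<forall>y\<in>W. \<phi> (w - w0) y = 0"
    using orthogonal_decomposition[OF W w(1)] by blast
  define r where "r = w - w0"
  have V: "w0 \<in> V" "r \<in> V" using w0(1) W(2) w(1) by (auto simp: r_def carrier_closed)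
  have "\<kappa> r x = 0" if x: "x \<in> V" for x
  proof -
    obtain c where c: "c \<in> V" "\<And>y. y \<in> V \<Longrightarrow> \<kappa> x y = \<phi> c y"
      using riesz_representation[OF \<kappa>[OF x]] by blast
    then have "c \<in> W" using x by (auto simp: W_def)
    then have "\<phi> r c = 0" using w0(2) by (simp add: r_def)
    then show ?thesis using c V x by (simp add: sym[of r] form_sym[of c])
  qed
  then have "g r = 0" using rad V(2) by blast
  then have "\<phi> (r + w0) r = 0" using w V by (simp add: r_def)
  moreover have "\<phi> w0 r = 0" using w0 V by (simp add: form_sym[of w0] r_def)
  ultimately have "r = 0" using anisotropic V by (simp add: form_simps)
  then have "w \<in> W" using w0 by (simp add: r_def)
  then show ?thesis using that w(2) by (auto simp: W_def)
qed

end

section \<open>Skew endomorphisms of anisotropic spaces\<close>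

locale skew_endo = anisotropic_space scale V \<phi> + fd_endo scale V A
  for scale :: "'k::field_char_0 \<Rightarrow> 'b::ab_group_add \<Rightarrow> 'b" and V \<phi> A +
  assumes skew_form: "\<lbrakk>x \<in> V; y \<in> V\<rbrakk> \<Longrightarrow> \<phi> (A x) y = - \<phi> x (A y)"
begin

definition orth :: "'b set \<Rightarrow> 'b set" where
  "orth W = {x\<in>V. \<forall>y\<in>W. \<phi> x y = 0}"

lemma subspace_orth: "W \<subseteq> V \<Longrightarrow> subspace (orth W)"
  by (auto simp: subspace_def orth_def form_left_simps carrier_closed subset_iff)

lemma orth_invariant: "\<lbrakk>W \<subseteq> V; A ` W \<subseteq> W; x \<in> orth W\<rbrakk> \<Longrightarrow> A x \<in> orth W"
  by (auto simp: orth_def skew_form endo_closed subset_iff image_subset_iff)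

lemma orth_inter: "W \<subseteq> V \<Longrightarrow> x \<in> W \<Longrightarrow> x \<in> orth W \<Longrightarrow> x = 0"
  using anisotropic by (auto simp: orth_def)

text \<open>The orthogonal complement of an invariant subspace is invariant, because \<open>A\<close> is skew, and is a
  complement, because the form is anisotropic.\<close>

lemma semisimple_skew: "semisimple_map scale V A"
  unfolding semisimple_map_def
proof (intro allI impI)
  fix W assume "subspace W \<and> W \<subseteq> V \<and> A ` W \<subseteq> W"
  then have W: "subspace W" "W \<subseteq> V" "A ` W \<subseteq> W" by auto
  have "x \<in> {w + u | w u. w \<in> W \<and> u \<in> orth W}" if x: "x \<in> V" for x
  proof -
    obtain w where w: "w \<in> W" "\<forall>y\<in>W. \<phi> (x - w) y = 0"
      using orthogonal_decomposition[OF W(1,2) x] by blast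
    then have "x - w \<in> orth W" using x W(2) by (auto simp: orth_def carrier_diff)
    moreover have "x = w + (x - w)" by simp
    ultimately show ?thesis using w(1) by blast
  qed
  moreover have "w + u \<in> V" if "w \<in> W" "u \<in> orth W" for w u
    using that W(2) by (auto simp: orth_def carrier_add)
  ultimately have "V = {w + u | w u. w \<in> W \<and> u \<in> orth W}" by blast
  moreover have "W \<inter> orth W = {0}"
    using orth_inter[OF W(2)] subspace_0[OF W(1)] subspace_0[OF subspace_orth[OF W(2)]] by blast
  moreover have "A ` orth W \<subseteq> orth W" using orth_invariant[OF W(2,3)] by blast
  moreover have "orth W \<subseteq> V" by (auto simp: orth_def)
  ultimately show "\<exists>U. subspace U \<and> U \<subseteq> V \<and> A ` U \<subseteq> U \<and> W \<inter> U = {0} \<and>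
      V = {w + u | w u. w \<in> W \<and> u \<in> U}"
    using subspace_orth[OF W(2)] by (intro exI[of _ "orth W"] conjI)
qed

abbreviation minpoly where "minpoly \<equiv> minimal_polynomial scale V A"

lemma minpoly_nonzero: "minpoly \<noteq> 0"
  using minimal_polynomial_monic by auto

lemma minpoly_annihilates: "x \<in> V \<Longrightarrow> pa minpoly x = 0"
  using annihilates_iff[of minpoly] by (simp add: annihilates_def)

lemma pa_invariant:
  assumes "subspace W" "W \<subseteq> V" "A ` W \<subseteq> W" "x \<in> W"
  shows "pa p x \<in> W"
proof -
  have "(A ^^ i) x \<in> W" for i using assms(3,4) by (induction i) auto
  then show ?thesis unfolding poly_apply_def
    by (intro subspace_sum[OF assms(1)] subspace_scale[OF assms(1)])
qed

text \<open>If \<open>r^2 s\<close> annihilates, then \<open>r(A) s(A) x\<close> lies in the kernel \<open>W\<close> of \<open>r(A)\<close>; it also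
  lies in the complement of \<open>W\<close>, because \<open>r(A)\<close> maps everything into the latter.\<close>

lemma minimal_polynomial_squarefree:
  assumes "r * r dvd minpoly"
  shows "degree r = 0"
proof -
  obtain s where s: "minpoly = r * r * s" using assms by (elim dvdE)
  have nz: "r \<noteq> 0" "s \<noteq> 0" using s minpoly_nonzero by auto
  define W where "W = {x\<in>V. pa r x = 0}"
  have W: "subspace W" "W \<subseteq> V" "A ` W \<subseteq> W"
  proof -
    show "subspace W"
      by (simp add: W_def subspace_def carrier_closed pa_vector_0 pa_vector_add pa_vector_scale)
    show "W \<subseteq> V" by (auto simp: W_def)
    have "pa r (A x) = 0" if "x \<in> V" "pa r x = 0" for x
      using endo_pa[OF that(1), of r] that(2) endo_0 by simp
    then show "A ` W \<subseteq> W" by (auto simp: W_def endo_closed)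
  qed
  have "pa (r * s) x = 0" if x: "x \<in> V" for x
  proof -
    define y where "y = pa s x"
    have y: "y \<in> V" using x by (simp add: y_def pa_closed)
    obtain w where w: "w \<in> W" "\<forall>z\<in>W. \<phi> (y - w) z = 0"
      using orthogonal_decomposition[OF W(1,2) y] by blast
    have wV: "w \<in> V" using w(1) W(2) by blast
    have "y - w \<in> orth W" using w y wV by (simp add: orth_def carrier_diff)
    then have "pa r (y - w) \<in> orth W"
      using orth_invariant[OF W(2,3)]
      by (intro pa_invariant[OF subspace_orth[OF W(2)]]) (auto simp: orth_def)
    moreover have "pa r (w + (y - w)) = pa r w + pa r (y - w)"
      using wV y by (intro pa_vector_add carrier_diff)
    then have "pa r (y - w) = pa r y" using w(1) by (simp add: W_def)
    ultimately have 1: "pa r y \<in> orth W" by simp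
    have "pa r (pa r y) = pa minpoly x" using x by (simp add: s y_def pa_mult pa_closed)
    then have "pa r y \<in> W" using minpoly_annihilates[OF x] y by (simp add: W_def pa_closed)
    then have "pa r y = 0" using 1 orth_inter[OF W(2)] by blast
    then show ?thesis using x by (simp add: pa_mult y_def)
  qed
  then have "minpoly dvd r * s" using annihilates_iff[of "r * s"] by (simp add: annihilates_def)
  then have "degree minpoly \<le> degree (r * s)" using nz by (intro dvd_imp_degree_le) auto
  then show ?thesis using nz by (simp add: s degree_mult_eq)
qed

lemma minpoly_roots_simple: "rsquarefree (ac_poly minpoly)"
  by (rule ac_poly_squarefree_roots[OF minpoly_nonzero minimal_polynomial_squarefree])

definition eigenvalues :: "'k alg_closure set" where
  "eigenvalues = {x. poly (ac_poly minpoly) x = 0}"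

lemma finite_eigenvalues: "finite eigenvalues"
  unfolding eigenvalues_def using minpoly_roots_simple
  by (intro poly_roots_finite) (simp add: rsquarefree_def)

lemma minpoly_splits: "ac_poly minpoly = (\<Prod>x\<in>eigenvalues. [:-x, 1:])"
  unfolding eigenvalues_def using minimal_polynomial_monic
  by (intro rsquarefree_splits minpoly_roots_simple) (simp add: degree_ac_poly coeff_ac_poly)

lemma vector_annihilator_monic:
  assumes "v \<in> V"
  obtains g where "lead_coeff g = 1" "\<And>q. pa q v = 0 \<longleftrightarrow> g dvd q" "g dvd minpoly" "rsquarefree (ac_poly g)"
proof -
  obtain p where p: "p \<noteq> 0" "pa p v = 0" using vector_annihilator[OF assms] by blast
  have "{v} \<subseteq> V" "\<And>x. x \<in> {v} \<Longrightarrow> pa p x = 0" using assms p(2) by auto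
  then obtain g where g: "lead_coeff g = 1" "\<And>q. (\<forall>x\<in>{v}. pa q x = 0) \<longleftrightarrow> g dvd q"
    using annihilator_generator[OF _ p(1)] by metis
  have g2: "pa q v = 0 \<longleftrightarrow> g dvd q" for q using g(2)[of q] by simp
  then have "g dvd minpoly" using minpoly_annihilates[OF assms] by blast
  moreover from this obtain h where "minpoly = g * h" by (elim dvdE)
  then have "ac_poly g dvd ac_poly minpoly" by (simp add: ac_poly_mult)
  then have "rsquarefree (ac_poly g)" using minpoly_roots_simple rsquarefree_dvd by blast
  ultimately show ?thesis using that[OF g(1) g2] by blast
qed

text \<open>If \<open>0\<close> is the only root of the annihilator of \<open>v\<close>, then the annihilator divides \<open>x\<close>, since its
  roots are simple.\<close>

lemma annihilator_roots_zero:
  assumes v: "v \<in> V" and g: "lead_coeff g = 1" "\<And>q. pa q v = 0 \<longleftrightarrow> g dvd q"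
    and sq: "rsquarefree (ac_poly g)" and zero: "\<And>x. poly (ac_poly g) x = 0 \<Longrightarrow> x = 0"
  shows "A v = 0"
proof -
  have "lead_coeff (ac_poly g) = 1" using g(1) by (simp add: degree_ac_poly coeff_ac_poly)
  then have split: "ac_poly g = (\<Prod>x\<in>{x. poly (ac_poly g) x = 0}. [:-x, 1:])"
    by (rule rsquarefree_splits[OF sq])
  have sub: "{x. poly (ac_poly g) x = 0} \<subseteq> {0}" using zero by auto
  have "g dvd [:0, 1:]"
  proof (cases "{x. poly (ac_poly g) x = 0} = {}")
    case True
    then have "ac_poly g = 1" using split by simp
    then have "degree g = 0" using degree_ac_poly[of g] by simp
    then have "g = 1" using g(1) monic_degree_0 by blast
    then show ?thesis by simp
  next
    case False
    then have "{x. poly (ac_poly g) x = 0} = {0}" using sub by blast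
    then have "ac_poly g = [:0, 1:]" using split by simp
    moreover have "ac_poly ([:0, 1:] :: 'k poly) = [:0, 1:]" by (simp add: map_poly_pCons)
    ultimately have "coeff (ac_poly g) i = coeff (ac_poly [:0, 1:]) i" for i by simp
    then have "g = [:0, 1:]" by (intro poly_eqI) (simp only: coeff_ac_poly to_ac_eq_iff)
    then show ?thesis by simp
  qed
  then have "pa [:0, 1:] v = 0" using g(2) by blast
  then show ?thesis using v by (simp add: pa_pCons endo_closed)
qed

text \<open>Splitting off cyclic subspaces one at a time exhibits the trace of \<open>A^k\<close> as a power sum
  of the eigenvalues with non-negative integral multiplicities, not all of which vanish away
  from \<open>0\<close> unless \<open>A\<close> vanishes on \<open>W\<close>.\<close>

lemma invariant_power_sums:
  assumes "subspace W" "W \<subseteq> V" "A ` W \<subseteq> W"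
    and "\<And>C. C \<subseteq> W \<Longrightarrow> independent C \<Longrightarrow> card C \<le> N"
  shows "\<exists>n b \<gamma> \<mu>. frame W n b \<gamma> \<and>
    (\<forall>k. to_ac (frame_trace n b \<gamma> (A ^^ k)) = (\<Sum>x\<in>eigenvalues. of_nat (\<mu> x) * x ^ k)) \<and>
    ((\<forall>x\<in>eigenvalues. x \<noteq> 0 \<longrightarrow> \<mu> x = 0) \<longrightarrow> (\<forall>w\<in>W. A w = 0))"
  using assms
proof (induction N arbitrary: W)
  case 0
  have "W = {0}"
  proof -
    have "v = 0" if v: "v \<in> W" for v
    proof (rule ccontr)
      assume "v \<noteq> 0"
      then have "independent {v}" by (simp add: dependent_single)
      then show False using 0(4)[of "{v}"] v by simp
    qed
    then show ?thesis using subspace_0[OF 0(1)] by blast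
  qed
  then show ?case
    by (intro exI[of _ 0] exI[of _ "\<lambda>_. 0"] exI[of _ "\<lambda>_ _. 0"])
      (simp add: frame_def frame_trace_def endo_0)
next
  case (Suc N)
  note W = Suc.prems(1-3)
  show ?case
  proof (cases "W = {0}")
    case True
    then show ?thesis
      by (intro exI[of _ 0] exI[of _ "\<lambda>_. 0"] exI[of _ "\<lambda>_ _. 0"])
        (simp add: frame_def frame_trace_def endo_0)
  next
    case False
    then obtain v where v: "v \<in> W" "v \<noteq> 0" using subspace_0[OF W(1)] by blast
    then have vV: "v \<in> V" using W(2) by blast
    obtain g where g: "lead_coeff g = 1" "\<And>q. pa q v = 0 \<longleftrightarrow> g dvd q" "g dvd minpoly"
      "rsquarefree (ac_poly g)" using vector_annihilator_monic[OF vV] by metis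
    define U where "U = {pa a v | a. True}"
    have U: "subspace U" "U \<subseteq> W" "A ` U \<subseteq> U"
    proof -
      show "U \<subseteq> W" using pa_invariant[OF W v(1)] by (auto simp: U_def)
      show "subspace U"
      proof (unfold subspace_def, intro conjI ballI allI)
        show "0 \<in> U" unfolding U_def by (rule CollectI, rule exI[of _ 0]) simp
        fix x y c assume "x \<in> U"
        then obtain a where a: "x = pa a v" by (auto simp: U_def)
        have "scale c x = pa (smult c a) v" by (simp add: a pa_smult)
        then show "scale c x \<in> U" unfolding U_def by blast
        assume "y \<in> U"
        then obtain b where b: "y = pa b v" by (auto simp: U_def)
        have "x + y = pa (a + b) v" by (simp add: a b pa_add)
        then show "x + y \<in> U" unfolding U_def by blast
      qed
      have "A (pa a v) = pa (pCons 0 a) v" for a by (simp add: pa_pCons endo_pa vV)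
      then show "A ` U \<subseteq> U" unfolding U_def by blast
    qed
    have UV: "U \<subseteq> V" using U(2) W(2) by blast
    define W' where "W' = W \<inter> orth U"
    have W': "subspace W'" "W' \<subseteq> V" "A ` W' \<subseteq> W'"
    proof -
      show "subspace W'" unfolding W'_def by (rule subspace_inter[OF W(1) subspace_orth[OF UV]])
      show "W' \<subseteq> V" using W(2) by (auto simp: W'_def)
      show "A ` W' \<subseteq> W'" using W(3) orth_invariant[OF UV U(3)] by (auto simp: W'_def)
    qed
    have "card C \<le> N" if C: "C \<subseteq> W'" "independent C" for C
    proof -
      have vU: "v \<in> U" unfolding U_def by (rule CollectI, rule exI[of _ 1]) simp
      obtain D where D: "finite D" "span D = V" using finitely_generated by blast
      have fin: "finite C" using independent_span_bound[OF D(1) C(2)] D(2) C(1) W'(2) by blast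
      have "span C \<subseteq> W'" using C(1) W'(1) by (rule span_minimal)
      then have nv: "v \<notin> span C" using orth_inter[OF UV vU] v(2) by (auto simp: W'_def)
      then have "independent (insert v C)" using C(2) by (rule independent_insertI)
      moreover have "insert v C \<subseteq> W" using v(1) C(1) by (auto simp: W'_def)
      ultimately have "card (insert v C) \<le> Suc N" using Suc.prems(4) by blast
      moreover have "v \<notin> C" using nv span_base by blast
      ultimately show ?thesis using fin by simp
    qed
    from Suc.IH[OF W' this] obtain n' b' \<gamma>' \<mu>' where
      IH: "frame W' n' b' \<gamma>'"
        "\<And>k. to_ac (frame_trace n' b' \<gamma>' (A ^^ k)) = (\<Sum>x\<in>eigenvalues. of_nat (\<mu>' x) * x ^ k)"
        "(\<forall>x\<in>eigenvalues. x \<noteq> 0 \<longrightarrow> \<mu>' x = 0) \<longrightarrow> (\<forall>w\<in>W'. A w = 0)"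
      by blast
    obtain n b \<gamma> where fr: "frame U n b \<gamma>"
      "\<And>k. to_ac (frame_trace n b \<gamma> (A ^^ k)) = (\<Sum>x | poly (ac_poly g) x = 0. x ^ k)"
      using cyclic_trace[OF vV g(1,2,4)] unfolding U_def by metis
    obtain pr where pr: "linear_on_carrier V scale scale pr"
      "\<And>x. x \<in> V \<Longrightarrow> pr x \<in> U" "\<And>x y. x \<in> V \<Longrightarrow> y \<in> U \<Longrightarrow> \<phi> (x - pr x) y = 0"
      "\<And>x. x \<in> U \<Longrightarrow> pr x = x" "\<And>x. x \<in> V \<Longrightarrow> (\<And>y. y \<in> U \<Longrightarrow> \<phi> x y = 0) \<Longrightarrow> pr x = 0"
      using orthogonal_projection[OF U(1) UV] by metis
    interpret W: fd_carrier scale W by (rule subspace_fd_carrier[OF W(1,2)])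
    have W'W: "W' \<subseteq> W" by (auto simp: W'_def)
    have prW: "pr x \<in> U \<and> x - pr x \<in> W'" if "x \<in> W" for x
    proof -
      have xV: "x \<in> V" using that W(2) by blast
      then have "pr x \<in> U" by (rule pr(2))
      then have "x - pr x \<in> W" "pr x \<in> V" using that U(2) UV W.carrier_diff by blast+
      then show ?thesis using pr(2,3)[OF xV] xV by (simp add: W'_def orth_def carrier_diff)
    qed
    have prW': "pr x = 0" if "x \<in> W'" for x using that pr(5)[of x] by (auto simp: W'_def orth_def)
    obtain l d \<epsilon> where total: "frame W l d \<epsilon>"
      "\<And>T. (\<And>x. x \<in> U \<Longrightarrow> T x \<in> U) \<Longrightarrow> (\<And>x. x \<in> W' \<Longrightarrow> T x \<in> W') \<Longrightarrow>
        frame_trace l d \<epsilon> T = frame_trace n b \<gamma> T + frame_trace n' b' \<gamma>' T"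
      using W.frame_direct_sum[OF U(1) fr(1) W'(1) IH(1) U(2) W'W
        linear_on_carrier_subset[OF pr(1) W(2)] prW pr(4) prW'] by metis
    define \<mu> where "\<mu> x = \<mu>' x + (if poly (ac_poly g) x = 0 then 1 else 0)" for x
    have roots: "{x. poly (ac_poly g) x = 0} \<subseteq> eigenvalues"
    proof -
      obtain h where "minpoly = g * h" using g(3) by (elim dvdE)
      then show ?thesis by (auto simp: eigenvalues_def ac_poly_mult)
    qed
    have "to_ac (frame_trace l d \<epsilon> (A ^^ k)) = (\<Sum>x\<in>eigenvalues. of_nat (\<mu> x) * x ^ k)" for k
    proof -
      have inv: "(A ^^ k) x \<in> Z" if "A ` Z \<subseteq> Z" "x \<in> Z" for x Z
        using that by (induction k) auto
      have "frame_trace l d \<epsilon> (A ^^ k) = frame_trace n b \<gamma> (A ^^ k) + frame_trace n' b' \<gamma>' (A ^^ k)"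
        using inv[OF U(3)] inv[OF W'(3)] by (intro total(2))
      then have "to_ac (frame_trace l d \<epsilon> (A ^^ k))
          = (\<Sum>x | poly (ac_poly g) x = 0. x ^ k) + (\<Sum>x\<in>eigenvalues. of_nat (\<mu>' x) * x ^ k)"
        by (simp add: fr(2) IH(2))
      also have "(\<Sum>x | poly (ac_poly g) x = 0. x ^ k)
          = (\<Sum>x\<in>eigenvalues. if poly (ac_poly g) x = 0 then x ^ k else 0)"
        using roots by (intro sum.mono_neutral_cong_left finite_eigenvalues) auto
      finally show ?thesis
        by (simp add: \<mu>_def algebra_simps flip: sum.distrib) (intro sum.cong, auto simp: algebra_simps)
    qed
    moreover have "\<forall>w\<in>W. A w = 0" if zero: "\<forall>x\<in>eigenvalues. x \<noteq> 0 \<longrightarrow> \<mu> x = 0"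
    proof
      fix w assume w: "w \<in> W"
      have "\<forall>x\<in>eigenvalues. x \<noteq> 0 \<longrightarrow> \<mu>' x = 0" using zero by (simp add: \<mu>_def)
      then have 1: "A x = 0" if "x \<in> W'" for x using IH(3) that by blast
      have "x = 0" if "poly (ac_poly g) x = 0" for x
        using zero roots that by (auto simp: \<mu>_def)
      then have "A v = 0" by (rule annihilator_roots_zero[OF vV g(1,2,4)])
      then have 2: "A (pa a v) = 0" for a by (simp add: endo_pa vV pa_vector_0)
      have "A w = A (pr w + (w - pr w))" by simp
      also have "\<dots> = A (pr w) + A (w - pr w)"
        using prW[OF w] UV W'(2) by (intro endo_add) blast+
      also have "A (pr w) = 0" using prW[OF w] 2 by (auto simp: U_def)
      also have "A (w - pr w) = 0" using prW[OF w] 1 by blast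
      finally show "A w = 0" by simp
    qed
    ultimately show ?thesis using total(1) by blast
  qed
qed

lemma power_sums:
  obtains n b \<gamma> \<mu> where "frame V n b \<gamma>"
    "\<And>k. to_ac (frame_trace n b \<gamma> (A ^^ k)) = (\<Sum>x\<in>eigenvalues. of_nat (\<mu> x) * x ^ k)"
    "(\<forall>x\<in>eigenvalues. x \<noteq> 0 \<longrightarrow> \<mu> x = 0) \<Longrightarrow> (\<forall>w\<in>V. A w = 0)"
proof -
  obtain D where D: "finite D" "span D = V" using finitely_generated by blast
  have inv: "A ` V \<subseteq> V" using endo_closed by blast
  have card: "card C \<le> card D" if "C \<subseteq> V" "independent C" for C
    using independent_span_bound[OF D(1) that(2)] that(1) D(2) by blast
  have "\<exists>n b \<gamma> \<mu>. frame V n b \<gamma> \<and>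
      (\<forall>k. to_ac (frame_trace n b \<gamma> (A ^^ k)) = (\<Sum>x\<in>eigenvalues. of_nat (\<mu> x) * x ^ k)) \<and>
      ((\<forall>x\<in>eigenvalues. x \<noteq> 0 \<longrightarrow> \<mu> x = 0) \<longrightarrow> (\<forall>w\<in>V. A w = 0))"
    by (rule invariant_power_sums[OF subspace_carrier order_refl inv card])
  then show ?thesis
  proof (elim exE conjE)
    fix n b \<gamma> \<mu>
    assume *: "frame V n b \<gamma>"
      "\<forall>k. to_ac (frame_trace n b \<gamma> (A ^^ k)) = (\<Sum>x\<in>eigenvalues. of_nat (\<mu> x) * x ^ k)"
      "(\<forall>x\<in>eigenvalues. x \<noteq> 0 \<longrightarrow> \<mu> x = 0) \<longrightarrow> (\<forall>w\<in>V. A w = 0)"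
    show ?thesis by (rule that[OF *(1) spec[OF *(2)] mp[OF *(3)]])
  qed
qed

lemma pa_adjoint:
  "\<lbrakk>x \<in> V; y \<in> V\<rbrakk> \<Longrightarrow> \<phi> (pa p x) y = \<phi> x (pa (pcompose p [:0, -1:]) y)"
proof (induction p arbitrary: x)
  case 0
  then show ?case by (simp add: form_simps)
next
  case (pCons a p)
  let ?q = "pcompose p [:0, -1:]"
  have "pa (pcompose (pCons a p) [:0, -1:]) y = scale a y - A (pa ?q y)"
    using pCons.prems
    by (simp add: pcompose_pCons pa_add pa_pCons pa_smult endo_pa pa_closed endo_closed carrier_closed
        pa_diff[of 0, simplified])
  moreover have "\<phi> (pa (pCons a p) x) y = a * \<phi> x y + \<phi> (A x) (pa ?q y)"
    using pCons by (simp add: pa_pCons form_left_simps carrier_closed endo_closed pa_closed)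
  ultimately show ?case
    using pCons.prems by (simp add: form_right_simps skew_form pa_closed endo_closed carrier_closed)
qed

text \<open>On the kernel of \<open>p(A)\<close> the adjoint \<open>p(-A)\<close> vanishes as well, because the form is anisotropic.
  An irreducible \<open>p\<close> that did not divide \<open>p(-x)\<close> would be coprime to it, and a Bezout identity
  would make the kernel vanish.\<close>

lemma pa_reflect_invariant:
  assumes "irreducible p" "p dvd minpoly"
  shows "p dvd pcompose p [:0, -1:]"
proof -
  let ?q = "pcompose p [:0, -1:]"
  define W where "W = {x\<in>V. pa p x = 0}"
  have W: "subspace W" "W \<subseteq> V"
    by (auto simp: W_def subspace_def carrier_closed pa_vector_0 pa_vector_add pa_vector_scale)
  have W_pa: "pa r x \<in> W" if "x \<in> W" for r x
    using that pa_commute[of x p r] by (simp add: W_def pa_closed pa_vector_0)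
  \<comment> \<open>The kernel of \<open>p(A)\<close> is non-zero, since otherwise the cofactor of \<open>p\<close> would annihilate.\<close>
  obtain x where x: "x \<in> W" "x \<noteq> 0"
  proof -
    obtain r where r: "minpoly = p * r" using assms(2) by (elim dvdE)
    have nz: "p \<noteq> 0" "r \<noteq> 0" using r minpoly_nonzero by auto
    have "degree r < degree minpoly" using nz irreducible_degree_pos[OF assms(1)]
      by (simp add: r degree_mult_eq)
    then have "\<not> minpoly dvd r" using dvd_imp_degree_le[of minpoly r] nz(2) by linarith
    then have "\<not> annihilates scale V A r" using annihilates_iff[of r] by simp
    then obtain y where y: "y \<in> V" "pa r y \<noteq> 0" unfolding annihilates_def by blast
    have "pa p (pa r y) = 0" using minpoly_annihilates[OF y(1)] y(1) by (simp add: r pa_mult)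
    then have "pa r y \<in> W" using y(1) by (simp add: W_def pa_closed)
    then show ?thesis using that y(2) by blast
  qed
  have xV: "x \<in> V" using x(1) W(2) by blast
  have "\<phi> (pa ?q x) (pa ?q x) = \<phi> (pa p (pa ?q x)) x"
    using pa_adjoint[of "pa ?q x" x p] xV by (simp add: pa_closed)
  also have "\<dots> = 0" using W_pa[OF x(1), of ?q] xV by (simp add: W_def form_simps)
  finally have q: "pa ?q x = 0" using anisotropic xV by (simp add: pa_closed)
  show ?thesis
  proof (rule ccontr)
    assume "\<not> p dvd ?q"
    then obtain a b where ab: "a * p + b * ?q = 1" using irreducible_dvd_or_bezout[OF assms(1)] by blast
    have "x = pa (a * p + b * ?q) x" by (simp add: ab)
    also have "\<dots> = pa a (pa p x) + pa b (pa ?q x)" using xV by (simp add: pa_add pa_mult)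
    also have "\<dots> = 0" using x(1) q by (simp add: W_def pa_vector_0)
    finally show False using x(2) by blast
  qed
qed

text \<open>An irreducible factor \<open>p\<close> divides its reflection \<open>p(-x)\<close>, which has the same degree, so
  that \<open>p\<close> is even or odd. An odd irreducible polynomial is a multiple of \<open>x\<close>, which is
  excluded by injectivity.\<close>

lemma irreducible_factor_even:
  assumes inj: "\<And>x. x \<in> V \<Longrightarrow> A x = 0 \<Longrightarrow> x = 0"
    and p: "irreducible p" "lead_coeff p = 1" "p dvd minpoly"
  shows "\<exists>n a. n \<ge> 1 \<and> p = monom 1 (2 * n) - (\<Sum>i<n. monom (a i) (2 * i))"
proof -
  let ?q = "pcompose p [:0, -1:]"
  define d where "d = degree p"
  have p0: "p \<noteq> 0" using p by auto
  have d: "d > 0" unfolding d_def by (rule irreducible_degree_pos[OF p(1)])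
  have degq: "degree ?q = d" by (simp add: d_def degree_pcompose)
  obtain c where c: "?q = p * c" using pa_reflect_invariant[OF p(1,3)] by (elim dvdE)
  have "?q \<noteq> 0" using degq d by auto
  then have "c \<noteq> 0" using c by auto
  then have "degree c = 0" using degq c p0 by (simp add: degree_mult_eq d_def)
  then obtain k where "c = [:k:]" by (metis degree_eq_zeroE)
  then have q: "?q = smult k p" using c by simp
  have cf: "(-1) ^ i * coeff p i = k * coeff p i" for i
  proof -
    have "coeff ?q i = (-1) ^ i * coeff p i" for i
      by (simp add: coeff_pcompose_linear)
    then show ?thesis using q by (metis coeff_smult)
  qed
  have k: "k = (-1) ^ d" using cf[of d] p(2) by (simp add: d_def)
  have ev: "even d"
  proof (rule ccontr)
    assume odd: "odd d"
    then have "coeff p 0 = 0" using cf[of 0] k by (simp add: eq_neg_iff_add_eq_0 flip: mult_2)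
    then obtain r where r: "p = pCons 0 r" by (metis coeff_pCons_0 pCons_cases)
    then have "p = [:0, 1:] * r" by simp
    moreover have "\<not> is_unit ([:0, 1:] :: 'k poly)" by (simp add: is_unit_poly_iff)
    ultimately have "is_unit r" using p(1) unfolding irreducible_def by blast
    then have "degree r = 0" by (auto simp: is_unit_poly_iff)
    then have "r = 1" using p(2) r monic_degree_0[of r] by (auto split: if_splits)
    then have px: "p = [:0, 1:]" using r by simp
    obtain s where s: "minpoly = p * s" using p(3) by (elim dvdE)
    have "pa s x = 0" if x: "x \<in> V" for x
    proof -
      have "pa p (pa s x) = 0" using minpoly_annihilates[OF x] x by (simp add: s pa_mult)
      then have "A (pa s x) = 0" using x by (simp add: px pa_pCons pa_closed endo_closed)
      then show ?thesis using inj x by (simp add: pa_closed)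
    qed
    then have "minpoly dvd s" using annihilates_iff[of s] by (simp add: annihilates_def)
    then have "degree minpoly \<le> degree s" using minpoly_nonzero s by (intro dvd_imp_degree_le) auto
    then show False using minpoly_nonzero s p0 d by (auto simp: degree_mult_eq d_def)
  qed
  then obtain n where n: "d = 2 * n" by (elim evenE)
  have odd0: "coeff p i = 0" if "odd i" for i
    using cf[of i] k ev that by (simp add: neg_eq_iff_add_eq_0 flip: mult_2)
  have "p = monom 1 (2 * n) - (\<Sum>i<n. monom (- coeff p (2 * i)) (2 * i))"
  proof (rule poly_eqI)
    fix j
    have sum: "coeff (\<Sum>i<n. monom (- coeff p (2 * i)) (2 * i)) j
        = (\<Sum>i<n. if 2 * i = j then - coeff p (2 * i) else 0)"
      by (simp add: coeff_sum)
    show "coeff p j = coeff (monom 1 (2 * n) - (\<Sum>i<n. monom (- coeff p (2 * i)) (2 * i))) j"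
    proof (cases "even j \<and> j < 2 * n")
      case True
      then obtain l where l: "j = 2 * l" "l < n" by auto
      then show ?thesis by (simp add: coeff_sum)
    next
      case False
      then have "(\<Sum>i<n. if 2 * i = j then - coeff p (2 * i) else 0) = 0"
        by (intro sum.neutral) auto
      moreover have "coeff p j = (if j = 2 * n then 1 else 0)"
        using False odd0[of j] p(2) coeff_eq_0[of p j] n by (auto simp: d_def)
      ultimately show ?thesis using sum by simp
    qed
  qed
  moreover have "n \<ge> 1" using d n by simp
  ultimately show ?thesis by (intro exI[of _ n] exI[of _ "\<lambda>i. - coeff p (2 * i)"] conjI)
qed

end

section \<open>The trace of an endomorphism\<close>

context fd_carrier
begin

definition endo :: "('b \<Rightarrow> 'b) \<Rightarrow> bool" where
  "endo T \<longleftrightarrow> linear_on_carrier V scale scale T \<and> (\<forall>x\<in>V. T x \<in> V)"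

lemma endoI:
  assumes "\<And>x. x \<in> V \<Longrightarrow> T x \<in> V" "\<And>x y. \<lbrakk>x \<in> V; y \<in> V\<rbrakk> \<Longrightarrow> T (x + y) = T x + T y"
    "\<And>c x. x \<in> V \<Longrightarrow> T (scale c x) = scale c (T x)"
  shows "endo T"
  using assms by (simp add: endo_def linear_on_carrier_def)

lemma endoD:
  assumes "endo T"
  shows endo_in: "x \<in> V \<Longrightarrow> T x \<in> V" and "\<lbrakk>x \<in> V; y \<in> V\<rbrakk> \<Longrightarrow> T (x + y) = T x + T y"
    "x \<in> V \<Longrightarrow> T (scale c x) = scale c (T x)"
  using assms by (auto simp: endo_def linear_on_carrier_def)

lemma endo_compose: "endo T \<Longrightarrow> endo S \<Longrightarrow> endo (\<lambda>x. T (S x))"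
  by (rule endoI) (simp_all add: endoD)

lemma endo_diff: "endo T \<Longrightarrow> endo S \<Longrightarrow> endo (\<lambda>x. T x - S x)"
  by (rule endoI) (simp_all add: endoD carrier_diff scale_right_diff_distrib)

lemma endo_diff_arg: "endo T \<Longrightarrow> x \<in> V \<Longrightarrow> y \<in> V \<Longrightarrow> T (x - y) = T x - T y"
  using endoD(2)[of T "x - y" y] by (simp add: carrier_diff)

lemma endo_zero_arg: "endo T \<Longrightarrow> T 0 = 0"
  using endo_diff_arg[of T 0 0] by (simp add: carrier_0)

text \<open>By \<open>frame_trace_unique\<close> the choice of the frame does not matter for endomorphisms.\<close>

definition tr :: "('b \<Rightarrow> 'b) \<Rightarrow> 'k" where
  "tr T = (case (SOME (n, b, \<gamma>). frame V n b \<gamma>) of (n, b, \<gamma>) \<Rightarrow> frame_trace n b \<gamma> T)"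

lemma tr_frame:
  obtains n b \<gamma> where "frame V n b \<gamma>" "tr = frame_trace n b \<gamma>"
proof -
  obtain n b \<gamma> where F: "(SOME (n, b, \<gamma>). frame V n b \<gamma>) = (n, b, \<gamma>)" by (metis prod_cases3)
  have "\<exists>p. case p of (n, b, \<gamma>) \<Rightarrow> frame V n b \<gamma>" using frame_exists by auto
  then have "case (SOME (n, b, \<gamma>). frame V n b \<gamma>) of (n, b, \<gamma>) \<Rightarrow> frame V n b \<gamma>" by (rule someI_ex)
  then have "frame V n b \<gamma>" unfolding F by simp
  moreover have "tr = frame_trace n b \<gamma>" unfolding tr_def F by simp
  ultimately show ?thesis by (rule that)
qed

lemma tr_eq_frame_trace: "frame V n b \<gamma> \<Longrightarrow> endo T \<Longrightarrow> tr T = frame_trace n b \<gamma> T"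
  by (rule tr_frame) (auto simp: endo_def intro!: frame_trace_unique[OF subspace_carrier])

lemma tr_commute: "endo T \<Longrightarrow> endo S \<Longrightarrow> tr (\<lambda>x. T (S x)) = tr (\<lambda>x. S (T x))"
  by (rule tr_frame) (auto simp: endo_def intro!: frame_trace_commute_frames[OF subspace_carrier])

lemma tr_cong: "(\<And>x. x \<in> V \<Longrightarrow> T x = S x) \<Longrightarrow> tr T = tr S"
  by (rule tr_frame) (auto simp: frame_trace_def frame_def)

lemma tr_add: "endo T \<Longrightarrow> endo S \<Longrightarrow> tr (\<lambda>x. T x + S x) = tr T + tr S"
  by (rule tr_frame) (auto simp: frame_trace_def frame_def linear_on_carrier_def endo_def sum.distrib)

lemma tr_scale: "endo T \<Longrightarrow> tr (\<lambda>x. scale c (T x)) = c * tr T"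
  by (rule tr_frame)
    (auto simp: frame_trace_def frame_def linear_on_carrier_def endo_def sum_distrib_left)

lemma tr_diff: "endo T \<Longrightarrow> endo S \<Longrightarrow> tr (\<lambda>x. T x - S x) = tr T - tr S"
  using tr_add[of "\<lambda>x. T x - S x" S] by (simp add: endo_diff)

lemma tr_zero: "(\<And>x. x \<in> V \<Longrightarrow> T x = 0) \<Longrightarrow> tr T = 0"
proof -
  assume "\<And>x. x \<in> V \<Longrightarrow> T x = 0"
  then have "tr T = tr (\<lambda>x. scale 0 x)" by (intro tr_cong) simp
  then show ?thesis using tr_scale[of "\<lambda>x. x" 0] by (simp add: endo_def linear_on_carrier_def)
qed

end

section \<open>Derivations of anisotropic quadratic Lie algebras\<close>

context lie_algebra
begin

lemma br_anti: "\<lbrakk>x \<in> L; y \<in> L\<rbrakk> \<Longrightarrow> br x y = - br y x"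
proof -
  assume V: "x \<in> L" "y \<in> L"
  have "x + y \<in> L" using V subspace_add[OF subspace_L] by blast
  then have "br (x + y) (x + y) = br x x + br x y + (br y x + br y y)"
    using V by (simp only: br_add_left br_add_right) (simp only: add_ac)
  then show ?thesis using V \<open>x + y \<in> L\<close> by (simp add: br_self eq_neg_iff_add_eq_0)
qed

lemma br_minus_right: "\<lbrakk>x \<in> L; y \<in> L\<rbrakk> \<Longrightarrow> br x (- y) = - br x y"
  using br_scale_right[of x y "-1"] by simp

lemma br_diff_right: "\<lbrakk>x \<in> L; y \<in> L; z \<in> L\<rbrakk> \<Longrightarrow> br x (y - z) = br x y - br x z"
  using br_add_right[of x "y - z" z] subspace_diff[OF subspace_L] by simp

lemma br_diff_left: "\<lbrakk>x \<in> L; y \<in> L; z \<in> L\<rbrakk> \<Longrightarrow> br (x - y) z = br x z - br y z"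
  using br_add_left[of "x - y" y z] subspace_diff[OF subspace_L] by simp

lemma br_leibniz: "\<lbrakk>u \<in> L; x \<in> L; y \<in> L\<rbrakk> \<Longrightarrow> br u (br x y) = br (br u x) y + br x (br u y)"
proof -
  assume V: "u \<in> L" "x \<in> L" "y \<in> L"
  have "br x (br y u) = - br x (br u y)"
    using V by (simp add: br_anti[of y u] br_minus_right br_closed)
  moreover have "br y (br u x) = - br (br u x) y" using V by (intro br_anti br_closed)
  ultimately show ?thesis using jacobi[OF V] by (simp add: algebra_simps)
qed

end

locale anisotropic_lie_algebra = quadratic_lie_algebra scale V br \<phi> + anisotropic_space scale V \<phi>
  for scale :: "'k::field_char_0 \<Rightarrow> 'b::ab_group_add \<Rightarrow> 'b" and V br \<phi>
begin

lemma ad_endo: "u \<in> V \<Longrightarrow> endo (br u)"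
  by (rule endoI) (simp_all add: br_closed br_add_right br_scale_right)

lemma ad_skew: "u \<in> V \<Longrightarrow> skew_endo scale V \<phi> (br u)"
proof unfold_locales
  assume u: "u \<in> V"
  show "linear_on_carrier V scale scale (br u)" using ad_endo[OF u] by (simp add: endo_def)
  show "br u x \<in> V" if "x \<in> V" for x using u that by (rule br_closed)
  show "\<phi> (br u x) y = - \<phi> x (br u y)" if "x \<in> V" "y \<in> V" for x y
    using invariant[OF u that] by (simp add: eq_neg_iff_add_eq_0)
qed

definition killing :: "'b \<Rightarrow> 'b \<Rightarrow> 'k" where
  "killing x y = tr (\<lambda>v. br x (br y v))"

text \<open>A replica of \<open>ad u\<close>: let \<open>f\<close> be an additive function on the algebraic closure and \<open>q\<close> a
  polynomial that agrees with \<open>f\<close> on the eigenvalues of \<open>ad u\<close> and on their sums. The operator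
  that multiplies the eigenspace of \<open>\<lambda>\<close> by \<open>f \<lambda>\<close> is \<open>q(ad u)\<close>, and additivity makes it a
  derivation, because brackets of eigenvectors for \<open>\<lambda>\<close> and \<open>\<mu>\<close> have eigenvalue \<open>\<lambda> + \<mu>\<close>.
  The base change to the algebraic closure takes place in the values of linear functionals
  \<open>\<theta>\<close> only.\<close>

lemma replica_derivation:
  assumes u: "u \<in> V" and x: "x \<in> V" and y: "y \<in> V" and l: "linear_on_carrier V scale (*) \<theta>"
    and R: "R = skew_endo.eigenvalues scale V (br u)"
    and f: "\<And>s t. f (s + t) = f s + f t"
    and q: "\<And>s. s \<in> R \<Longrightarrow> poly q s = f s" "\<And>s t. \<lbrakk>s \<in> R; t \<in> R\<rbrakk> \<Longrightarrow> poly q (s + t) = f (s + t)"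
  shows "seq_eval q (\<lambda>k. to_ac (\<theta> ((br u ^^ k) (br x y))))
    = seq_eval q (\<lambda>k. to_ac (\<theta> (br ((br u ^^ k) x) y))) + seq_eval q (\<lambda>k. to_ac (\<theta> (br x ((br u ^^ k) y))))"
proof -
  interpret ad: skew_endo scale V \<phi> "br u" using u by (rule ad_skew)
  define c where "c i j = to_ac (\<theta> (br ((br u ^^ i) x) ((br u ^^ j) y)))" for i j
  have finR: "finite R" unfolding R by (rule ad.finite_eigenvalues)
  have P: "(\<Prod>x\<in>R. [:-x, 1:]) = ac_poly ad.minpoly" unfolding R by (rule ad.minpoly_splits[symmetric])
  have rec: "seq_eval (ac_poly ad.minpoly) (\<lambda>k. to_ac (g ((br u ^^ (k + i)) z))) = 0"
    if "linear_on_carrier V scale (*) g" "z \<in> V" for g z i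
  proof -
    have "seq_eval (ac_poly ad.minpoly) (\<lambda>k. to_ac (g ((br u ^^ k) ((br u ^^ i) z))))
        = to_ac (g (ad.pa ad.minpoly ((br u ^^ i) z)))"
      using that by (intro ad.seq_eval_functional ad.pow_closed)
    moreover have "ad.pa ad.minpoly ((br u ^^ i) z) = 0" using that(2) by (intro ad.minpoly_annihilates ad.pow_closed)
    moreover have "g 0 = 0" by (rule linear_on_carrier_0[OF that(1) subspace_carrier])
    ultimately show ?thesis by (simp add: funpow_add)
  qed
  have lin: "\<theta> (a + b) = \<theta> a + \<theta> b" "\<theta> (scale c a) = c * \<theta> a" if "a \<in> V" "b \<in> V" for a b c
    using l that by (auto simp: linear_on_carrier_def)
  have rec1: "seq_eval (\<Prod>x\<in>R. [:-x, 1:]) (\<lambda>k. c (k + i) j) = 0" for i j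
  proof -
    have "linear_on_carrier V scale (*) (\<lambda>z. \<theta> (br z ((br u ^^ j) y)))"
      using ad.pow_closed[OF y, of j]
      by (simp add: linear_on_carrier_def lin br_add_left br_scale_left br_closed)
    from rec[OF this x, of i] show ?thesis unfolding P c_def .
  qed
  have rec2: "seq_eval (\<Prod>x\<in>R. [:-x, 1:]) (\<lambda>k. c i (k + j)) = 0" for i j
  proof -
    have "linear_on_carrier V scale (*) (\<lambda>z. \<theta> (br ((br u ^^ i) x) z))"
      using ad.pow_closed[OF x, of i]
      by (simp add: linear_on_carrier_def lin br_add_right br_scale_right br_closed)
    from rec[OF this y, of j] show ?thesis unfolding P c_def .
  qed
  obtain C where C: "\<And>i j. c i j = (\<Sum>s\<in>R. \<Sum>t\<in>R. C s t * s ^ i * t ^ j)"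
  proof (rule double_recurrence_solution[OF finR rec1 rec2])
    fix C assume *: "\<And>i j. c i j = (\<Sum>s\<in>R. \<Sum>t\<in>R. C s t * s ^ i * t ^ j)"
    show thesis by (rule that[OF *])
  qed
  have D: "to_ac (\<theta> ((br u ^^ k) (br ((br u ^^ i) x) ((br u ^^ j) y))))
      = (\<Sum>s\<in>R. \<Sum>t\<in>R. C s t * s ^ i * t ^ j * (s + t) ^ k)" for k i j
  proof (induction k arbitrary: i j)
    case 0
    then show ?case using C[of i j] by (simp add: c_def)
  next
    case (Suc k)
    let ?x = "(br u ^^ i) x" and ?y = "(br u ^^ j) y"
    have V: "?x \<in> V" "?y \<in> V" "br u ?x \<in> V" "br u ?y \<in> V"
      using x y u by (simp_all add: ad.pow_closed br_closed)
    have "(br u ^^ Suc k) (br ?x ?y) = (br u ^^ k) (br u (br ?x ?y))"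
      by (simp only: funpow_Suc_right o_apply)
    also have "\<dots> = (br u ^^ k) (br (br u ?x) ?y) + (br u ^^ k) (br ?x (br u ?y))"
      unfolding br_leibniz[OF u V(1,2)]
      by (rule ad.pow_add[OF br_closed[OF V(3,2)] br_closed[OF V(1,4)]])
    finally have "to_ac (\<theta> ((br u ^^ Suc k) (br ?x ?y)))
        = to_ac (\<theta> ((br u ^^ k) (br ((br u ^^ Suc i) x) ?y)))
        + to_ac (\<theta> ((br u ^^ k) (br ?x ((br u ^^ Suc j) y))))"
      using V by (simp add: lin ad.pow_closed br_closed)
    also have "\<dots> = (\<Sum>s\<in>R. \<Sum>t\<in>R. C s t * s ^ Suc i * t ^ j * (s + t) ^ k
        + C s t * s ^ i * t ^ Suc j * (s + t) ^ k)"
      unfolding Suc.IH by (simp only: sum.distrib)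
    also have "\<dots> = (\<Sum>s\<in>R. \<Sum>t\<in>R. C s t * s ^ i * t ^ j * (s + t) ^ Suc k)"
      by (simp add: algebra_simps)
    finally show ?case .
  qed
  have ev: "seq_eval q (\<lambda>k. z ^ k) = poly q z" for z by (simp add: seq_eval_def poly_altdef)
  have sums: "seq_eval q (\<lambda>k. \<Sum>s\<in>R. \<Sum>t\<in>R. C s t * h s t ^ k)
      = (\<Sum>s\<in>R. \<Sum>t\<in>R. C s t * poly q (h s t))" for h
  proof -
    have "seq_eval q (\<lambda>k. \<Sum>s\<in>R. \<Sum>t\<in>R. C s t * h s t ^ k)
        = (\<Sum>s\<in>R. \<Sum>t\<in>R. \<Sum>k\<le>degree q. C s t * (coeff q k * h s t ^ k))"
      unfolding seq_eval_def sum_distrib_left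
      by (subst sum.swap, rule sum.cong[OF refl], subst sum.swap) (simp add: mult.left_commute)
    then show ?thesis by (simp add: sum_distrib_left poly_altdef)
  qed
  have "seq_eval q (\<lambda>k. to_ac (\<theta> ((br u ^^ k) (br x y)))) = (\<Sum>s\<in>R. \<Sum>t\<in>R. C s t * poly q (s + t))"
    using D[of _ 0 0] sums[of "\<lambda>s t. s + t"] by simp
  also have "\<dots> = (\<Sum>s\<in>R. \<Sum>t\<in>R. C s t * poly q s) + (\<Sum>s\<in>R. \<Sum>t\<in>R. C s t * poly q t)"
    using q f by (simp add: distrib_left sum.distrib)
  also have "(\<Sum>s\<in>R. \<Sum>t\<in>R. C s t * poly q s) = seq_eval q (\<lambda>k. c k 0)"
    using C[of _ 0] sums[of "\<lambda>s t. s"] by simp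
  also have "(\<Sum>s\<in>R. \<Sum>t\<in>R. C s t * poly q t) = seq_eval q (\<lambda>k. c 0 k)"
    using C[of 0] sums[of "\<lambda>s t. t"] by simp
  finally show ?thesis by (simp add: c_def)
qed

text \<open>For \<open>a\<close> in the radical of the Killing form and \<open>u = [a, b]\<close> the trace of \<open>ad u\<close> against
  every derivation vanishes: \<open>tr([ad a, ad b] D) = tr(ad a [ad b, D]) = - \<kappa>(a, D b)\<close>. This is
  the case of the replicas of \<open>ad u\<close>.\<close>

lemma radical_replica_trace:
  assumes a: "a \<in> V" "\<And>y. y \<in> V \<Longrightarrow> killing a y = 0" and b: "b \<in> V" and u: "u = br a b"
    and R: "R = skew_endo.eigenvalues scale V (br u)"
    and f: "\<And>s t. f (s + t) = f s + f t"
    and q: "\<And>s. s \<in> R \<Longrightarrow> poly q s = f s" "\<And>s t. \<lbrakk>s \<in> R; t \<in> R\<rbrakk> \<Longrightarrow> poly q (s + t) = f (s + t)"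
  shows "seq_eval q (\<lambda>k. to_ac (tr (br u ^^ Suc k))) = 0"
proof -
  have uV: "u \<in> V" unfolding u using a(1) b by (rule br_closed)
  interpret ad: skew_endo scale V \<phi> "br u" using uV by (rule ad_skew)
  obtain n e \<gamma> where fr: "frame V n e \<gamma>" and tr: "tr = frame_trace n e \<gamma>" by (rule tr_frame)
  have e: "e i \<in> V" "linear_on_carrier V scale (*) (\<gamma> i)" if "i < n" for i
    using fr that by (auto simp: frame_def)
  have pow: "endo (br u ^^ k)" for k
    unfolding endo_def by (simp add: ad.pow_linear ad.pow_closed)
  note ada = ad_endo[OF a(1)] and adb = ad_endo[OF b]
  define \<theta> where "\<theta> i z = \<gamma> i (br a z)" for i z
  have \<theta>: "linear_on_carrier V scale (*) (\<theta> i)" if "i < n" for i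
    using e(2)[OF that] a(1)
    by (simp add: linear_on_carrier_def \<theta>_def br_add_right br_scale_right br_closed)
  have step: "tr (br u ^^ Suc k) = (\<Sum>i<n. \<theta> i (br b ((br u ^^ k) (e i))))
      - (\<Sum>i<n. \<theta> i ((br u ^^ k) (br b (e i))))" for k
  proof -
    have "tr (br u ^^ Suc k) = tr (\<lambda>v. br a (br b ((br u ^^ k) v)) - br b (br a ((br u ^^ k) v)))"
    proof (rule tr_cong)
      fix v assume "v \<in> V"
      then have v: "(br u ^^ k) v \<in> V" by (rule ad.pow_closed)
      show "(br u ^^ Suc k) v = br a (br b ((br u ^^ k) v)) - br b (br a ((br u ^^ k) v))"
        using br_leibniz[OF a(1) b v] by (simp add: u)
    qed
    also have "\<dots> = tr (\<lambda>v. br a (br b ((br u ^^ k) v))) - tr (\<lambda>v. br b (br a ((br u ^^ k) v)))"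
      by (rule tr_diff[OF endo_compose[OF ada endo_compose[OF adb pow]]
          endo_compose[OF adb endo_compose[OF ada pow]]])
    also have "tr (\<lambda>v. br b (br a ((br u ^^ k) v))) = tr (\<lambda>v. br a ((br u ^^ k) (br b v)))"
      by (rule tr_commute[OF adb endo_compose[OF ada pow]])
    finally show ?thesis by (simp add: tr frame_trace_def \<theta>_def)
  qed
  have rep: "seq_eval q (\<lambda>k. to_ac (\<theta> i ((br u ^^ k) (br b (e i)))))
      = seq_eval q (\<lambda>k. to_ac (\<theta> i (br ((br u ^^ k) b) (e i))))
      + seq_eval q (\<lambda>k. to_ac (\<theta> i (br b ((br u ^^ k) (e i)))))" if i: "i < n" for i
    by (rule replica_derivation[OF uV b e(1)[OF i] \<theta>[OF i] R f q])
  have sum: "seq_eval q (\<lambda>k. to_ac (\<Sum>i<n. h i k)) = (\<Sum>i<n. seq_eval q (\<lambda>k. to_ac (h i k)))" for h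
    unfolding seq_eval_def to_ac_sum sum_distrib_left by (rule sum.swap)
  have diff: "seq_eval q (\<lambda>k. to_ac (h k - h' k))
      = seq_eval q (\<lambda>k. to_ac (h k)) - seq_eval q (\<lambda>k. to_ac (h' k))" for h h'
    by (simp add: seq_eval_def right_diff_distrib sum_subtractf)
  have "seq_eval q (\<lambda>k. to_ac (tr (br u ^^ Suc k)))
      = - (\<Sum>i<n. seq_eval q (\<lambda>k. to_ac (\<theta> i (br ((br u ^^ k) b) (e i)))))"
    unfolding step diff sum by (simp add: rep sum.distrib)
  also have "\<dots> = - seq_eval q (\<lambda>k. to_ac (\<Sum>i<n. \<theta> i (br ((br u ^^ k) b) (e i))))"
    unfolding sum ..
  also have "\<dots> = - seq_eval q (\<lambda>k. to_ac (killing a ((br u ^^ k) b)))"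
    by (simp add: killing_def tr frame_trace_def \<theta>_def)
  also have "\<dots> = 0" using a(2)[OF ad.pow_closed[OF b]] by (simp add: seq_eval_def)
  finally show ?thesis .
qed

text \<open>Cartan's criterion for anisotropic algebras. The previous lemma gives
  \<open>\<Sum> \<mu>(\<lambda>) \<lambda> f(\<lambda>) = 0\<close> for the eigenvalues \<open>\<lambda>\<close> of \<open>ad u\<close> and additive \<open>f\<close>; for rational-valued
  \<open>f\<close> applying \<open>f\<close> again yields the vanishing sum of squares \<open>\<Sum> \<mu>(\<lambda>) f(\<lambda>)^2\<close>. Hence
  \<open>ad u = 0\<close>, so that \<open>u = [a, b]\<close> is central; but commutators are orthogonal to the centre.\<close>

theorem killing_radical_central:
  assumes a: "a \<in> V" "\<And>y. y \<in> V \<Longrightarrow> killing a y = 0" and b: "b \<in> V"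
  shows "br a b = 0"
proof -
  define u where "u = br a b"
  have uV: "u \<in> V" unfolding u_def using a(1) b by (rule br_closed)
  interpret ad: skew_endo scale V \<phi> "br u" using uV by (rule ad_skew)
  define R where "R = ad.eigenvalues"
  have finR: "finite R" unfolding R_def by (rule ad.finite_eigenvalues)
  obtain n e \<gamma> \<mu> where fr: "frame V n e \<gamma>"
    and pow: "\<And>k. to_ac (frame_trace n e \<gamma> (br u ^^ k)) = (\<Sum>x\<in>R. of_nat (\<mu> x) * x ^ k)"
    and zero: "(\<forall>x\<in>R. x \<noteq> 0 \<longrightarrow> \<mu> x = 0) \<Longrightarrow> (\<forall>w\<in>V. br u w = 0)"
  proof (rule ad.power_sums)
    fix n e \<gamma> \<mu>
    assume *: "frame V n e \<gamma>"
      "\<And>k. to_ac (frame_trace n e \<gamma> (br u ^^ k)) = (\<Sum>x\<in>ad.eigenvalues. of_nat (\<mu> x) * x ^ k)"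
      "(\<forall>x\<in>ad.eigenvalues. x \<noteq> 0 \<longrightarrow> \<mu> x = 0) \<Longrightarrow> (\<forall>w\<in>V. br u w = 0)"
    show thesis by (rule that[OF *[folded R_def]])
  qed
  have "\<mu> z = 0" if z: "z \<in> R" "z \<noteq> 0" for z
  proof -
    obtain F where F: "\<And>s t. F (s + t) = F s + F t" "\<And>r s. F (of_rat r * s) = r * F s" "F z = 1"
    proof (rule rational_functional_exists[OF z(2)])
      fix F :: "'k alg_closure \<Rightarrow> rat"
      assume *: "\<And>s t. F (s + t) = F s + F t" "\<And>r s. F (of_rat r * s) = r * F s" "F z = 1"
      show thesis by (rule that[OF *])
    qed
    define f where "f s = (of_rat (F s) :: 'k alg_closure)" for s
    obtain q where q: "\<And>s. s \<in> R \<union> (\<lambda>(s, t). s + t) ` (R \<times> R) \<Longrightarrow> poly q s = f s"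
      using interpolation_exists[of "R \<union> (\<lambda>(s, t). s + t) ` (R \<times> R)" f] finR by blast
    have "endo (br u ^^ k)" for k
      unfolding endo_def by (simp add: ad.pow_linear ad.pow_closed)
    then have tr: "to_ac (tr (br u ^^ k)) = (\<Sum>x\<in>R. of_nat (\<mu> x) * x ^ k)" for k
      using pow[of k] tr_eq_frame_trace[OF fr] by metis
    have "0 = seq_eval q (\<lambda>k. to_ac (tr (br u ^^ Suc k)))"
    proof (rule radical_replica_trace[OF a b u_def R_def, symmetric])
      show "f (s + t) = f s + f t" for s t by (simp add: f_def F(1) of_rat_add)
      show "poly q s = f s" if "s \<in> R" for s using that by (intro q) blast
      show "poly q (s + t) = f (s + t)" if "s \<in> R" "t \<in> R" for s t using that by (intro q) force
    qed
    also have "\<dots> = (\<Sum>k\<le>degree q. \<Sum>x\<in>R. of_nat (\<mu> x) * x * (coeff q k * x ^ k))"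
      by (simp add: seq_eval_def tr sum_distrib_left mult_ac del: funpow.simps)
    also have "\<dots> = (\<Sum>x\<in>R. of_nat (\<mu> x) * x * poly q x)"
      by (subst sum.swap) (simp add: sum_distrib_left poly_altdef)
    also have "\<dots> = (\<Sum>x\<in>R. of_rat (of_nat (\<mu> x) * F x) * x)"
      by (rule sum.cong) (simp_all add: q f_def of_rat_mult mult_ac)
    finally have "F (\<Sum>x\<in>R. of_rat (of_nat (\<mu> x) * F x) * x) = F 0" by simp
    moreover have "F 0 = 0" using F(1)[of 0 0] by simp
    moreover have "F (\<Sum>x\<in>R. of_rat (of_nat (\<mu> x) * F x) * x) = (\<Sum>x\<in>R. of_nat (\<mu> x) * (F x * F x))"
    proof -
      have "F (sum h R) = (\<Sum>x\<in>R. F (h x))" for h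
        using \<open>F 0 = 0\<close> by (induction R rule: infinite_finite_induct) (simp_all add: F(1))
      then show ?thesis by (simp add: F(2) mult.assoc)
    qed
    ultimately have "(\<Sum>x\<in>R. of_nat (\<mu> x) * (F x * F x)) = 0" by simp
    then have "of_nat (\<mu> z) * (F z * F z) = (0 :: rat)"
      using finR z(1) by (subst (asm) sum_nonneg_eq_0_iff) auto
    then show ?thesis by (simp add: F(3))
  qed
  then have "br u v = 0" if "v \<in> V" for v using zero that by blast
  moreover have "\<phi> u u + \<phi> b (br a u) = 0"
    using invariant[OF a(1) b uV] by (simp add: u_def)
  moreover have "br a u = - br u a" using a(1) uV by (rule br_anti)
  ultimately have "\<phi> u u = 0" using a(1) b by (simp add: form_right_simps)
  then show ?thesis using anisotropic[OF uV] by (simp add: u_def)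
qed

lemma killing_linear: "x \<in> V \<Longrightarrow> linear_on_carrier V scale (*) (killing x)"
proof -
  assume x: "x \<in> V"
  note E = endo_compose[OF ad_endo[OF x] ad_endo]
  have "killing x (y + z) = killing x y + killing x z" if "y \<in> V" "z \<in> V" for y z
    unfolding killing_def tr_add[OF E[OF that(1)] E[OF that(2)], symmetric]
    using x that by (intro tr_cong) (simp add: br_add_left br_add_right br_closed)
  moreover have "killing x (scale c y) = c * killing x y" if "y \<in> V" for c y
    unfolding killing_def tr_scale[OF E[OF that], symmetric]
    using x that by (intro tr_cong) (simp add: br_scale_left br_scale_right br_closed)
  ultimately show ?thesis by (simp add: linear_on_carrier_def)
qed

lemma killing_sym: "\<lbrakk>x \<in> V; y \<in> V\<rbrakk> \<Longrightarrow> killing x y = killing y x"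
  unfolding killing_def by (intro tr_commute ad_endo)

text \<open>Derivations are inner up to the centre: subtract from \<open>D\<close> the inner derivation that
  represents the functional \<open>tr (D ad y)\<close> by the Killing form. The difference \<open>D'\<close> is
  orthogonal to all inner derivations, so that \<open>\<kappa>(D' x, y) = tr(D' ad [x, y]) = 0\<close>.\<close>

theorem derivation_inner_mod_center:
  assumes D: "endo D" and der: "\<And>x y. \<lbrakk>x \<in> V; y \<in> V\<rbrakk> \<Longrightarrow> D (br x y) = br (D x) y + br x (D y)"
  obtains s where "s \<in> V" "\<And>x y. \<lbrakk>x \<in> V; y \<in> V\<rbrakk> \<Longrightarrow> br (D x - br s x) y = 0"
proof -
  define g where "g y = tr (\<lambda>v. D (br y v))" for y
  have E: "endo (\<lambda>v. D (br y v))" if "y \<in> V" for y by (rule endo_compose[OF D ad_endo[OF that]])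
  have g_lin: "linear_on_carrier V scale (*) g"
  proof -
    have "g (y + z) = g y + g z" if "y \<in> V" "z \<in> V" for y z
      unfolding g_def tr_add[OF E[OF that(1)] E[OF that(2)], symmetric]
      using that by (intro tr_cong) (simp add: br_add_left endoD(2)[OF D] br_closed)
    moreover have "g (scale c y) = c * g y" if "y \<in> V" for c y
      unfolding g_def tr_scale[OF E[OF that], symmetric]
      using that by (intro tr_cong) (simp add: br_scale_left endoD(3)[OF D] br_closed)
    ultimately show ?thesis by (simp add: linear_on_carrier_def)
  qed
  have rad: "g x = 0" if "x \<in> V" "\<And>y. y \<in> V \<Longrightarrow> killing x y = 0" for x
    unfolding g_def by (rule tr_zero) (simp add: killing_radical_central[OF that] endo_zero_arg[OF D])
  obtain s where s: "s \<in> V" "\<And>x. x \<in> V \<Longrightarrow> g x = killing s x"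
  proof (rule degenerate_representation[OF killing_linear killing_sym g_lin rad])
    fix s assume *: "s \<in> V" "\<And>x. x \<in> V \<Longrightarrow> g x = killing s x"
    show thesis by (rule that[OF *])
  qed
  define D' where "D' x = D x - br s x" for x
  have D': "endo D'" unfolding D'_def by (rule endo_diff[OF D ad_endo[OF s(1)]])
  have der': "D' (br x y) = br (D' x) y + br x (D' y)" if "x \<in> V" "y \<in> V" for x y
    using that s(1) endo_in[OF D]
    by (simp add: D'_def der br_leibniz[OF s(1)] br_diff_left br_diff_right br_closed)
  have orth: "tr (\<lambda>v. D' (br y v)) = 0" if y: "y \<in> V" for y
  proof -
    have "tr (\<lambda>v. D' (br y v)) = g y - killing s y"
      unfolding D'_def g_def killing_def
      by (rule tr_diff[OF E[OF y] endo_compose[OF ad_endo[OF s(1)] ad_endo[OF y]]])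
    then show ?thesis using s(2)[OF y] by simp
  qed
  have "killing (D' x) y = 0" if x: "x \<in> V" and y: "y \<in> V" for x y
  proof -
    note ax = ad_endo[OF x] and ay = ad_endo[OF y]
    have "killing (D' x) y = tr (\<lambda>v. D' (br x (br y v)) - br x (D' (br y v)))"
      unfolding killing_def using x y by (intro tr_cong) (simp add: der' br_closed)
    also have "\<dots> = tr (\<lambda>v. D' (br x (br y v))) - tr (\<lambda>v. br x (D' (br y v)))"
      by (rule tr_diff[OF endo_compose[OF D' endo_compose[OF ax ay]]
          endo_compose[OF ax endo_compose[OF D' ay]]])
    also have "tr (\<lambda>v. br x (D' (br y v))) = tr (\<lambda>v. D' (br y (br x v)))"
      by (rule tr_commute[OF ax endo_compose[OF D' ay]])
    also have "tr (\<lambda>v. D' (br x (br y v))) - tr (\<lambda>v. D' (br y (br x v)))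
        = tr (\<lambda>v. D' (br x (br y v)) - D' (br y (br x v)))"
      by (rule tr_diff[OF endo_compose[OF D' endo_compose[OF ax ay]]
          endo_compose[OF D' endo_compose[OF ay ax]], symmetric])
    also have "\<dots> = tr (\<lambda>v. D' (br (br x y) v))"
    proof (rule tr_cong)
      fix v assume v: "v \<in> V"
      have "br x (br y v) - br y (br x v) = br (br x y) v" using br_leibniz[OF x y v] by simp
      then show "D' (br x (br y v)) - D' (br y (br x v)) = D' (br (br x y) v)"
        using endo_diff_arg[OF D', of "br x (br y v)" "br y (br x v)"] x y v
        by (simp add: br_closed)
    qed
    also have "\<dots> = 0" by (rule orth[OF br_closed[OF x y]])
    finally show ?thesis .
  qed
  then have "br (D' x) y = 0" if "x \<in> V" "y \<in> V" for x y
    using killing_radical_central[OF endo_in[OF D' that(1)]] that by blast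
  then show ?thesis using that[OF s(1)] by (simp add: D'_def)
qed

end

section \<open>Witt index one\<close>

lemma (in vector_space) mem_span_singleton: "y \<in> span {x} \<longleftrightarrow> (\<exists>c. y = scale c x)"
  by (auto simp: span_singleton)

text \<open>Dimensions of subspaces of \<open>V\<close> are bounded, hence the maximum in the definition of the Witt
  index is attained, and it is \<open>1\<close> if and only if non-zero isotropic vectors exist and
  orthogonal isotropic vectors are collinear.\<close>

lemma (in quadratic_space) witt_index_eq_1_iff:
  "witt_index scale V \<phi> = 1 \<longleftrightarrow> (\<exists>z\<in>V. z \<noteq> 0 \<and> \<phi> z z = 0) \<and>
    (\<forall>x\<in>V. \<forall>y\<in>V. x \<noteq> 0 \<longrightarrow> \<phi> x x = 0 \<longrightarrow> \<phi> y y = 0 \<longrightarrow> \<phi> x y = 0 \<longrightarrow> (\<exists>c. y = scale c x))"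
  (is "_ \<longleftrightarrow> ?ex \<and> ?max")
proof -
  define D where "D = {dim W | W. subspace W \<and> W \<subseteq> V \<and> totally_isotropic \<phi> W}"
  have witt: "witt_index scale V \<phi> = Max D" by (simp add: witt_index_def D_def)
  obtain C where C: "finite C" "span C = V" using finite_dim by blast
  have bound: "dim W \<le> card C" if "subspace W" "W \<subseteq> V" for W
  proof (rule subspace_basis[OF that])
    fix B assume B: "finite B" "independent B" "B \<subseteq> W" "span B = W"
    have "dim W = card B" using dim_eq_card[of B W] B span_eq_iff[THEN iffD2, OF that(1)] by metis
    then show ?thesis using independent_span_bound[OF C(1) B(2)] B(3) that(2) C(2) by auto
  qed
  have dim0: "dim {0} = 0"
    using dim_eq_card[of "{}" "{0}"] independent_empty by simp
  have zero: "0 \<in> D"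
  proof -
    from dim0 show ?thesis unfolding D_def
      by (auto intro!: exI[of _ "{0}"] simp: subspace_single_0 carrier_closed totally_isotropic_def form_simps)
  qed
  have fin: "finite D"
  proof (rule finite_subset)
    show "D \<subseteq> {..card C}" using bound by (auto simp: D_def)
  qed simp
  have dim_line: "dim (span {x}) = 1" if "x \<noteq> 0" for x
    using that by (simp add: dim_eq_card[of "{x}"] dependent_single)
  have dim_trivial: "W = {0}" if "dim W = 0" "subspace W" "W \<subseteq> V" for W
  proof (rule subspace_basis[OF that(2,3)])
    fix B assume B: "finite B" "independent B" "B \<subseteq> W" "span B = W"
    have "card B = 0" using dim_eq_card[of B W] B that(1) span_eq_iff[THEN iffD2, OF that(2)] by metis
    then show ?thesis using B by auto
  qed
  have line_D: "1 \<in> D" if "z \<in> V" "z \<noteq> 0" "\<phi> z z = 0" for z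
  proof -
    have "span {z} \<subseteq> V" using that(1) by (intro span_minimal subspace_carrier) simp
    moreover have "totally_isotropic \<phi> (span {z})"
      using that by (auto simp: totally_isotropic_def mem_span_singleton form_simps carrier_closed)
    ultimately show ?thesis unfolding D_def using dim_line[OF that(2)]
      by (auto intro!: exI[of _ "span {z}"] simp: subspace_span)
  qed
  have "?ex \<and> ?max" if M: "Max D = 1"
  proof
    have "1 \<in> D" using Max_in[OF fin] zero M by force
    then obtain W where W: "dim W = 1" "subspace W" "W \<subseteq> V" "totally_isotropic \<phi> W"
      by (auto simp: D_def)
    have "W \<noteq> {0}" using W(1) dim0 by auto
    then obtain z where "z \<in> W" "z \<noteq> 0" using subspace_0[OF W(2)] by blast
    then show ?ex using W(3,4) by (auto simp: totally_isotropic_def)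
    show ?max
    proof (intro ballI impI)
      fix x y assume x: "x \<in> V" and y: "y \<in> V" and nz: "x \<noteq> 0"
        and iso: "\<phi> x x = 0" "\<phi> y y = 0" "\<phi> x y = 0"
      let ?W = "span {y, x}"
      have sub: "?W \<subseteq> V" using x y by (intro span_minimal subspace_carrier) simp
      have "totally_isotropic \<phi> ?W"
        unfolding totally_isotropic_def
      proof (intro ballI)
        fix a b assume ab: "a \<in> ?W" "b \<in> ?W"
        obtain c1 c2 where "a = scale c1 y + scale c2 x"
          using ab(1) unfolding span_breakdown_eq[of a y] mem_span_singleton
          by (metis add.commute diff_add_cancel)
        moreover obtain c3 c4 where "b = scale c3 y + scale c4 x"
          using ab(2) unfolding span_breakdown_eq[of b y] mem_span_singleton
          by (metis add.commute diff_add_cancel)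
        ultimately show "\<phi> a b = 0"
          using x y iso form_sym[OF x y] by (simp add: form_simps carrier_closed)
      qed
      then have "dim ?W \<in> D" unfolding D_def using sub by (auto intro!: exI[of _ ?W] simp: subspace_span)
      then have le: "dim ?W \<le> 1" using Max_ge[OF fin] M by metis
      have "y \<in> span {x}"
      proof (rule ccontr)
        assume n: "y \<notin> span {x}"
        then have "independent {y, x}" using nz by (intro independent_insertI) (auto simp: independent_empty)
        then have "dim ?W = card {y, x}" using dim_eq_card[of "{y, x}" ?W] by (simp add: span_span)
        moreover have "y \<noteq> x" using n span_base[of x "{x}"] by auto
        ultimately show False using le by simp
      qed
      then show "\<exists>c. y = scale c x" unfolding mem_span_singleton .
    qed
  qed
  moreover have "Max D = 1" if ex: ?ex and max: ?max
  proof (rule Max_eqI[OF fin])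
    show "1 \<in> D" using ex line_D by blast
    fix n assume "n \<in> D"
    then obtain W where W: "n = dim W" "subspace W" "W \<subseteq> V" "totally_isotropic \<phi> W"
      by (auto simp: D_def)
    show "n \<le> 1"
    proof (cases "W = {0}")
      case True
      then show ?thesis using W(1) dim0 by simp
    next
      case False
      then obtain w where w: "w \<in> W" "w \<noteq> 0" using subspace_0[OF W(2)] by blast
      have "W \<subseteq> span {w}"
      proof
        fix y assume y: "y \<in> W"
        have "\<phi> w w = 0" "\<phi> y y = 0" "\<phi> w y = 0" "w \<in> V" "y \<in> V"
          using W(3,4) w y by (auto simp: totally_isotropic_def)
        then show "y \<in> span {w}" using max w(2) unfolding mem_span_singleton by blast
      qed
      moreover have "span {w} \<subseteq> W" using w(1) W(2) by (intro span_minimal) auto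
      ultimately have "W = span {w}" by blast
      then show ?thesis using W(1) dim_line[OF w(2)] by simp
    qed
  qed
  ultimately show ?thesis unfolding witt by blast
qed

section \<open>Splitting along a central isotropic vector\<close>

context quadratic_lie_algebra
begin

lemma invariant_left: "\<lbrakk>x \<in> L; y \<in> L; w \<in> L\<rbrakk> \<Longrightarrow> \<psi> (br x y) w = - \<psi> y (br x w)"
  using invariant[of x y w] by (simp add: eq_neg_iff_add_eq_0)

lemma not_decomposable_ideal:
  assumes ind: "indecomposable" and I: "ideal I" "I \<noteq> L"
    and nondeg: "\<And>x. x \<in> I \<Longrightarrow> (\<forall>y\<in>I. \<psi> x y = 0) \<Longrightarrow> x = 0"
  shows "I = {0}"
proof (rule ccontr)
  assume nz: "I \<noteq> {0}"
  have I': "0 \<in> I" "I \<subseteq> L" using I(1) subspace_0 by (auto simp: ideal_def)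
  then have "0 \<in> perp I" by (auto simp: perp_def carrier_0 form_left_simps)
  then have "I \<inter> perp I = {0}" using nondeg I'(1) by (auto simp: perp_def)
  then show False using ind I nz unfolding indecomposable_def decomposable_def by blast
qed

text \<open>A central vector of non-zero norm splits off as a one-dimensional ideal.\<close>

lemma line_not_ideal:
  assumes ind: "indecomposable" and x: "x \<in> L" "\<psi> x x \<noteq> 0" and ctr: "\<And>y. y \<in> L \<Longrightarrow> br y x = 0"
    and y: "y \<in> L" "y \<notin> span {x}"
  shows False
proof -
  have "span {x} \<subseteq> L" using x(1) by (intro span_minimal subspace_L) simp
  moreover have "br a b = 0" if "a \<in> L" "b \<in> span {x}" for a b
    using that ctr x(1) by (auto simp: mem_span_singleton br_scale_right)
  ultimately have "ideal (span {x})" by (auto simp: ideal_def subspace_span span_zero)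
  moreover have "a = 0" if a: "a \<in> span {x}" "\<forall>b\<in>span {x}. \<psi> a b = 0" for a
  proof -
    obtain c where c: "a = scale c x" using a(1) by (auto simp: mem_span_singleton)
    have "\<psi> a x = 0" using a(2) span_base[of x "{x}"] by blast
    then show ?thesis using x by (simp add: c form_left_simps)
  qed
  moreover have "span {x} \<noteq> L" using y by blast
  ultimately have "span {x} = {0}" using not_decomposable_ideal[OF ind] by blast
  then have "x = 0" using span_base[of x "{x}"] by blast
  then show False using x by (simp add: form_left_simps)
qed

end

text \<open>A hyperbolic pair \<open>d, z\<close> with central \<open>z\<close> and anisotropic orthogonal complement \<open>H\<close>. As a vector
  space \<open>L\<close> is \<open>K d + H + K z\<close>, and \<open>pr\<close> below is the projection to \<open>H\<close>.\<close>

locale hyperbolic_splitting = quadratic_lie_algebra scale L br \<psi>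
  for scale :: "'k::field_char_0 \<Rightarrow> 'b::ab_group_add \<Rightarrow> 'b" and L br \<psi> +
  fixes d z :: 'b
  assumes d_in: "d \<in> L" and z_in: "z \<in> L"
    and zz: "\<psi> z z = 0" and dd: "\<psi> d d = 0" and dz: "\<psi> d z = 1"
    and central: "x \<in> L \<Longrightarrow> br x z = 0"
    and definite: "\<lbrakk>x \<in> L; \<psi> x d = 0; \<psi> x z = 0; \<psi> x x = 0\<rbrakk> \<Longrightarrow> x = 0"
begin

definition H :: "'b set" where
  "H = {x\<in>L. \<psi> x d = 0 \<and> \<psi> x z = 0}"

definition pr :: "'b \<Rightarrow> 'b" where
  "pr x = x - scale (\<psi> x z) d - scale (\<psi> x d) z"

text \<open>The bracket that \<open>H\<close> inherits as a copy of the quotient of the orthogonal space of \<open>z\<close> by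
  the line of \<open>z\<close>.\<close>

definition \<beta> :: "'b \<Rightarrow> 'b \<Rightarrow> 'b" where
  "\<beta> x y = pr (br x y)"

lemmas in_L = d_in z_in carrier_closed

lemma zd: "\<psi> z d = 1"
  using form_sym[OF d_in z_in] dz by simp

lemma H_L: "x \<in> H \<Longrightarrow> x \<in> L"
  by (simp add: H_def)

lemma H_d: "x \<in> H \<Longrightarrow> \<psi> x d = 0" "x \<in> H \<Longrightarrow> \<psi> d x = 0"
  and H_z: "x \<in> H \<Longrightarrow> \<psi> x z = 0" "x \<in> H \<Longrightarrow> \<psi> z x = 0"
  using form_sym d_in z_in by (auto simp: H_def)

lemma pr_L: "x \<in> L \<Longrightarrow> pr x \<in> L"
  by (simp add: pr_def in_L)

lemma pr_H: "x \<in> L \<Longrightarrow> pr x \<in> H"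
  by (simp add: H_def pr_L) (simp add: pr_def form_left_simps in_L zz dd dz zd)

lemma pr_id: "x \<in> H \<Longrightarrow> pr x = x"
  by (simp add: pr_def H_d H_z)

lemma pr_add: "\<lbrakk>x \<in> L; y \<in> L\<rbrakk> \<Longrightarrow> pr (x + y) = pr x + pr y"
  by (simp add: pr_def form_left_simps in_L algebra_simps)

lemma pr_scale: "x \<in> L \<Longrightarrow> pr (scale c x) = scale c (pr x)"
  by (simp add: pr_def form_left_simps in_L algebra_simps)

lemma split: "x = scale (\<psi> x z) d + pr x + scale (\<psi> x d) z"
  by (simp add: pr_def)

lemma pr_z: "pr z = 0"
  by (simp add: pr_def zz zd)

lemma central_left: "x \<in> L \<Longrightarrow> br z x = 0"
  using br_anti[OF z_in] central by simp

lemma subspace_H: "subspace H"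
  by (auto simp: subspace_def H_def form_left_simps in_L)

lemma H_closed: "0 \<in> H" "\<lbrakk>x \<in> H; y \<in> H\<rbrakk> \<Longrightarrow> x + y \<in> H" "\<lbrakk>x \<in> H; y \<in> H\<rbrakk> \<Longrightarrow> x - y \<in> H"
  "x \<in> H \<Longrightarrow> scale c x \<in> H"
  using subspace_H subspace_0 subspace_add subspace_diff subspace_scale by blast+

text \<open>Invariance turns the centrality of \<open>z\<close> into the statement that commutators have no
  \<open>d\<close>-component; their \<open>z\<close>-component is computed by \<open>bracket_d\<close> below.\<close>

lemma bracket_z: "\<lbrakk>x \<in> L; y \<in> L\<rbrakk> \<Longrightarrow> \<psi> (br x y) z = 0"
  using invariant_left[of x y z] by (simp add: in_L central form_right_simps)

lemma bracket_split: "\<lbrakk>x \<in> L; y \<in> L\<rbrakk> \<Longrightarrow> br x y = \<beta> x y + scale (\<psi> (br x y) d) z"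
  using split[of "br x y"] by (simp add: \<beta>_def bracket_z)

lemma \<beta>_H: "\<lbrakk>x \<in> L; y \<in> L\<rbrakk> \<Longrightarrow> \<beta> x y \<in> H"
  by (simp add: \<beta>_def pr_H br_closed)

lemma br_\<beta>: "\<lbrakk>x \<in> L; y \<in> L; w \<in> L\<rbrakk> \<Longrightarrow> br w (\<beta> x y) = br w (br x y)"
proof -
  assume V: "x \<in> L" "y \<in> L" "w \<in> L"
  have "br w (br x y) = br w (\<beta> x y + scale (\<psi> (br x y) d) z)"
    using bracket_split[OF V(1,2)] by (rule arg_cong)
  also have "\<dots> = br w (\<beta> x y)"
    using V H_L[OF \<beta>_H[OF V(1,2)]] by (simp add: br_add_right br_scale_right in_L central)
  finally show ?thesis ..
qed

lemma form_\<beta>: "\<lbrakk>x \<in> L; y \<in> L; w \<in> H\<rbrakk> \<Longrightarrow> \<psi> (\<beta> x y) w = \<psi> (br x y) w"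
proof -
  assume V: "x \<in> L" "y \<in> L" "w \<in> H"
  have "\<psi> (br x y) w = \<psi> (\<beta> x y + scale (\<psi> (br x y) d) z) w"
    using bracket_split[OF V(1,2)] by (rule arg_cong[where f = "\<lambda>v. \<psi> v w"])
  also have "\<dots> = \<psi> (\<beta> x y) w"
    using H_L[OF V(3)] H_L[OF \<beta>_H[OF V(1,2)]] V(3) by (simp add: form_left_simps in_L H_z)
  finally show ?thesis ..
qed

lemma ad_d_H: "x \<in> H \<Longrightarrow> br d x \<in> H"
proof -
  assume x: "x \<in> H"
  have "\<psi> (br d x) d = 0"
    using invariant_left[OF d_in H_L[OF x] d_in] H_L[OF x] by (simp add: br_self d_in form_right_simps)
  then show ?thesis using x by (simp add: H_def br_closed d_in bracket_z)
qed

lemma ad_d_skew: "\<lbrakk>x \<in> H; y \<in> H\<rbrakk> \<Longrightarrow> \<psi> (br d x) y = - \<psi> x (br d y)"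
  by (intro invariant_left d_in H_L)

lemma bracket_d: "\<lbrakk>x \<in> H; y \<in> H\<rbrakk> \<Longrightarrow> \<psi> (br x y) d = \<psi> (br d x) y"
proof -
  assume x: "x \<in> H" and y: "y \<in> H"
  have "\<psi> (br x y) d = - \<psi> y (br x d)" using x y by (intro invariant_left d_in H_L)
  also have "br x d = - br d x" using x by (intro br_anti d_in H_L)
  finally show ?thesis
    using x y by (simp add: form_right_simps H_L br_closed d_in form_sym[of y])
qed

text \<open>Since \<open>z\<close> is central and orthogonal to \<open>H\<close>, the \<open>z\<close>-components of inner brackets affect neither
  the Jacobi identity nor invariance.\<close>

lemma anisotropic_H: "anisotropic_lie_algebra scale H \<beta> \<psi>"
proof unfold_locales
  show "subspace H" by (rule subspace_H)
  show "\<exists>B. finite B \<and> span B = H"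
    using fd_carrier.finitely_generated[OF subspace_fd_carrier[OF subspace_H]] by (auto simp: H_def)
next
  fix x assume x: "x \<in> H" and "\<And>y. y \<in> H \<Longrightarrow> \<psi> x y = 0"
  then have "\<psi> x x = 0" by blast
  then show "x = 0" using x definite by (simp add: H_def)
next
  fix x assume x: "x \<in> H" and "\<psi> x x = 0"
  then show "x = 0" using definite by (simp add: H_def)
next
  fix x assume "x \<in> H"
  then show "\<beta> x x = 0" by (simp add: \<beta>_def br_self H_L pr_id H_closed)
next
  fix x y c assume V: "x \<in> H" "y \<in> H"
  show "\<beta> x y \<in> H" using V by (intro \<beta>_H H_L)
  show "\<beta> (scale c x) y = scale c (\<beta> x y)" "\<beta> x (scale c y) = scale c (\<beta> x y)"
    using V by (simp_all add: \<beta>_def br_scale_left br_scale_right H_L br_closed pr_scale)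
  show "\<psi> x y = \<psi> y x" "\<psi> (scale c x) y = c * \<psi> x y"
    using V by (auto simp: H_L form_left_simps intro: form_sym)
next
  fix x y w assume V: "x \<in> H" "y \<in> H" "w \<in> H"
  note V' = V[THEN H_L]
  show "\<beta> (x + y) w = \<beta> x w + \<beta> y w" "\<beta> x (y + w) = \<beta> x y + \<beta> x w"
    using V' by (simp_all add: \<beta>_def br_add_left br_add_right br_closed pr_add)
  show "\<psi> (x + y) w = \<psi> x w + \<psi> y w" using V' by (simp add: form_left_simps)
  have "\<beta> x (\<beta> y w) + \<beta> y (\<beta> w x) + \<beta> w (\<beta> x y)
      = pr (br x (br y w) + br y (br w x) + br w (br x y))"
    using V' by (simp add: \<beta>_def[of x "\<beta> _ _"] \<beta>_def[of y "\<beta> _ _"] \<beta>_def[of w "\<beta> _ _"] br_\<beta> pr_add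
        br_closed in_L)
  then show "\<beta> x (\<beta> y w) + \<beta> y (\<beta> w x) + \<beta> w (\<beta> x y) = 0"
    using V' by (simp add: jacobi pr_id H_closed)
  have "\<psi> y (\<beta> x w) = \<psi> y (br x w)"
    using V V' form_\<beta>[of x w y] form_sym[of y "\<beta> x w"] form_sym[of y "br x w"]
    by (simp add: H_L[OF \<beta>_H] br_closed)
  then show "\<psi> (\<beta> x y) w + \<psi> y (\<beta> x w) = 0"
    using V V' invariant[of x y w] by (simp add: form_\<beta>)
qed

sublocale H: anisotropic_lie_algebra scale H \<beta> \<psi>
  by (rule anisotropic_H)

lemma ad_d_endo: "H.endo (br d)"
  by (rule H.endoI) (simp_all add: ad_d_H br_add_right br_scale_right d_in H_L)

lemma ad_d_derivation:
  assumes "x \<in> H" "y \<in> H"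
  shows "br d (\<beta> x y) = \<beta> (br d x) y + \<beta> x (br d y)"
proof -
  note V = assms[THEN H_L]
  have eq: "br d (\<beta> x y) = br (br d x) y + br x (br d y)"
    unfolding br_\<beta>[OF V d_in] by (rule br_leibniz[OF d_in V])
  have "br d (\<beta> x y) = pr (br d (\<beta> x y))" by (rule pr_id[OF ad_d_H[OF \<beta>_H[OF V]], symmetric])
  then show ?thesis unfolding eq using V d_in by (simp add: \<beta>_def pr_add br_closed)
qed

text \<open>The derivation \<open>ad d\<close> of \<open>H\<close> agrees with some \<open>\<beta> s\<close> up to the centre of \<open>H\<close>, hence on the
  commutators of \<open>H\<close>. The copy \<open>{w + \<psi>(w, s) z}\<close> of the commutator space in \<open>L\<close> is therefore an
  ideal: replacing \<open>d\<close> by \<open>d - s\<close> makes it a direct factor. It is anisotropic, so that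
  indecomposability forces it to vanish.\<close>

lemma \<beta>_trivial:
  assumes ind: "indecomposable" and xy: "x \<in> H" "y \<in> H"
  shows "\<beta> x y = 0"
proof -
  obtain s where s: "s \<in> H" "\<And>x y. \<lbrakk>x \<in> H; y \<in> H\<rbrakk> \<Longrightarrow> \<beta> (br d x - \<beta> s x) y = 0"
  proof (rule H.derivation_inner_mod_center[OF ad_d_endo ad_d_derivation])
    fix s assume *: "s \<in> H" "\<And>x y. \<lbrakk>x \<in> H; y \<in> H\<rbrakk> \<Longrightarrow> \<beta> (br d x - \<beta> s x) y = 0"
    show thesis by (rule that[OF *])
  qed
  note sL = H_L[OF s(1)]
  define C where "C = span {\<beta> a b | a b. a \<in> H \<and> b \<in> H}"
  have C_sub: "subspace C" unfolding C_def by (rule subspace_span)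
  have C_H: "C \<subseteq> H" unfolding C_def by (intro span_minimal subspace_H) (auto intro: H.br_closed)
  have \<beta>_C: "\<beta> a b \<in> C" if "a \<in> H" "b \<in> H" for a b
    unfolding C_def using that by (intro span_base) blast
  have inner: "br d w = \<beta> s w" if w: "w \<in> C" for w
  proof -
    have "br d (\<beta> a b) = \<beta> s (\<beta> a b)" if ab: "a \<in> H" "b \<in> H" for a b
    proof -
      have step: "\<beta> (br d a) b = \<beta> (\<beta> s a) b" if "a \<in> H" "b \<in> H" for a b
        using s(2)[OF that] that s(1) by (simp add: H.br_diff_left ad_d_H H.br_closed)
      have "\<beta> a (br d b) = - \<beta> (\<beta> s b) a"
        using H.br_anti[OF ab(1) ad_d_H[OF ab(2)]] step[OF ab(2,1)] by simp
      also have "\<dots> = \<beta> a (\<beta> s b)"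
        using H.br_anti[OF ab(1) H.br_closed[OF s(1) ab(2)]] by simp
      finally show ?thesis
        using ab step[OF ab] by (simp add: ad_d_derivation H.br_leibniz[OF s(1) ab])
    qed
    then have "C \<subseteq> {w\<in>H. br d w = \<beta> s w}"
      unfolding C_def using s(1)
      by (intro span_minimal) (auto simp: subspace_def H_closed H.endoD[OF ad_d_endo]
        H.endo_zero_arg[OF ad_d_endo] H.br_add_right H.br_scale_right H.br_closed
        H.endo_zero_arg[OF H.ad_endo])
    then show ?thesis using w by blast
  qed
  define lift where "lift w = w + scale (\<psi> w s) z" for w
  define I where "I = lift ` C"
  have CL: "w \<in> L" if "w \<in> C" for w using that C_H H_L by blast
  have lift_L: "lift w \<in> L" if "w \<in> C" for w using CL[OF that] by (simp add: lift_def in_L)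
  have lift_form: "\<psi> (lift w) (lift v) = \<psi> w v" if wv: "w \<in> C" "v \<in> C" for w v
  proof -
    have "w \<in> H" "v \<in> H" using wv C_H by blast+
    then show ?thesis
      using H_L by (simp add: lift_def form_left_simps form_right_simps in_L H_z zz)
  qed
  have "subspace I"
  proof -
    have "lift (a + b) = lift a + lift b" "lift (scale c a) = scale c (lift a)"
      if "a \<in> C" "b \<in> C" for a b c
      using CL that sL by (simp_all add: lift_def form_left_simps algebra_simps)
    moreover have "lift 0 = 0" using sL by (simp add: lift_def form_left_simps)
    ultimately show ?thesis
      using subspace_0[OF C_sub] subspace_add[OF C_sub] subspace_scale[OF C_sub]
      unfolding subspace_def I_def
      by (auto simp: image_iff) metis+
  qed
  moreover have "br y (lift w) \<in> I" if y: "y \<in> L" and w: "w \<in> C" for y w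
  proof -
    define h where "h = pr y"
    have h: "h \<in> H" using y by (simp add: h_def pr_H)
    have wH: "w \<in> H" using w C_H by blast
    note hL = H_L[OF h] and wL = H_L[OF wH]
    define t where "t = \<psi> y z"
    have "br y (lift w) = br y w"
      using y wL by (simp add: lift_def br_add_right br_scale_right in_L central)
    also have "\<dots> = br (scale t d + h + scale (\<psi> y d) z) w"
      using split[of y] by (simp add: t_def h_def)
    also have "\<dots> = scale t (br d w) + br h w"
      using hL wL by (simp add: br_add_left br_scale_left in_L central_left)
    also have "br h w = \<beta> h w + scale (\<psi> (br h w) d) z" by (rule bracket_split[OF hL wL])
    also have "br d w = \<beta> s w" by (rule inner[OF w])
    finally have eq: "br y (lift w) = scale t (\<beta> s w) + \<beta> h w + scale (\<psi> (br h w) d) z"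
      by (simp add: add.assoc)
    define v where "v = scale t (\<beta> s w) + \<beta> h w"
    have v: "v \<in> C" unfolding v_def
      by (intro subspace_add[OF C_sub] subspace_scale[OF C_sub] \<beta>_C s(1) h wH)
    have "\<psi> (\<beta> s w) s = - \<psi> w (\<beta> s s)" using H.invariant_left[OF s(1) wH s(1)] .
    also have "\<dots> = 0" using s(1) wL by (simp add: H.br_self form_right_simps)
    finally have "\<psi> v s = \<psi> (\<beta> h w) s"
      using H_L[OF H.br_closed[OF s(1) wH]] H_L[OF H.br_closed[OF h wH]] sL
      by (simp add: v_def form_left_simps in_L)
    also have "\<dots> = - \<psi> w (\<beta> h s)" by (rule H.invariant_left[OF h wH s(1)])
    also have "\<beta> h s = - \<beta> s h" by (rule H.br_anti[OF h s(1)])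
    also have "- \<psi> w (- \<beta> s h) = \<psi> w (\<beta> s h)"
      using wL H_L[OF H.br_closed[OF s(1) h]] by (simp add: form_right_simps)
    also have "\<dots> = - \<psi> (\<beta> s w) h" using H.invariant_left[OF s(1) wH h] by simp
    also have "\<psi> (\<beta> s w) h = \<psi> (br d w) h" by (simp add: inner[OF w])
    also have "- \<psi> (br d w) h = \<psi> w (br d h)" using ad_d_skew[OF wH h] by simp
    also have "\<dots> = \<psi> (br d h) w"
      using form_sym[OF wL H_L[OF ad_d_H[OF h]]] .
    also have "\<dots> = \<psi> (br h w) d" by (rule bracket_d[OF h wH, symmetric])
    finally have "br y (lift w) = lift v" using eq by (simp add: lift_def v_def)
    then show ?thesis using v by (simp add: I_def)
  qed
  ultimately have ideal: "ideal I" using lift_L by (auto simp: ideal_def I_def)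
  have "I \<noteq> L"
  proof
    assume "I = L"
    then obtain w where w: "w \<in> C" "d = lift w" using d_in by (auto simp: I_def)
    then have "\<psi> (lift w) z = 1" using dz by simp
    moreover have "w \<in> H" using w(1) C_H by blast
    ultimately show False using H_L by (simp add: lift_def form_left_simps in_L H_z zz)
  qed
  moreover have "a = 0" if a: "a \<in> I" "\<forall>b\<in>I. \<psi> a b = 0" for a
  proof -
    obtain w where w: "w \<in> C" "a = lift w" using a(1) by (auto simp: I_def)
    have "\<psi> w w = 0" using a w lift_form[OF w(1) w(1)] by simp
    then have "w = 0" using H.anisotropic w(1) C_H by blast
    then show ?thesis using w(2) sL by (simp add: lift_def form_left_simps)
  qed
  ultimately have "I = {0}" using not_decomposable_ideal[OF ind ideal] by blast
  then have "lift (\<beta> x y) = 0" using \<beta>_C[OF xy] by (auto simp: I_def)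
  then have "\<psi> (\<beta> x y) (\<beta> x y) = 0"
    using lift_form[OF \<beta>_C[OF xy] \<beta>_C[OF xy]] by (simp add: form_left_simps carrier_0)
  then show ?thesis using H.anisotropic H.br_closed[OF xy] by blast
qed

lemma bracket_H: "\<lbrakk>indecomposable; x \<in> H; y \<in> H\<rbrakk> \<Longrightarrow> br x y = scale (\<psi> (br d x) y) z"
  using bracket_split[of x y] by (simp add: \<beta>_trivial bracket_d H_L)

lemma bracket_formula:
  assumes ind: "indecomposable" and x: "x \<in> L" and y: "y \<in> L"
  shows "br x y = scale (\<psi> x z) (br d (pr y)) - scale (\<psi> y z) (br d (pr x))
    + scale (\<psi> (br d (pr x)) (pr y)) z"
proof -
  let ?h = "pr x" and ?k = "pr y"
  have h: "?h \<in> H" and k: "?k \<in> H" using x y by (simp_all add: pr_H)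
  note hL = H_L[OF h] and kL = H_L[OF k]
  have "br x y = br (scale (\<psi> x z) d + ?h + scale (\<psi> x d) z) (scale (\<psi> y z) d + ?k + scale (\<psi> y d) z)"
    using split[of x] split[of y] by (rule arg_cong2)
  also have "\<dots> = scale (\<psi> x z) (br d ?k) + scale (\<psi> y z) (br ?h d) + br ?h ?k"
    using hL kL by (simp add: br_add_left br_add_right br_scale_left br_scale_right in_L central
        central_left br_self br_closed algebra_simps)
  also have "br ?h d = - br d ?h" using hL by (intro br_anti d_in)
  also have "br ?h ?k = scale (\<psi> (br d ?h) ?k) z" by (rule bracket_H[OF ind h k])
  finally show ?thesis by simp
qed

text \<open>By invariance a kernel vector of \<open>ad d\<close> has vanishing brackets with \<open>H\<close> too, so that it is
  central, and it has non-zero norm.\<close>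

lemma ad_d_injective:
  assumes ind: "indecomposable" and x: "x \<in> H" "br d x = 0"
  shows "x = 0"
proof (rule ccontr)
  assume nz: "x \<noteq> 0"
  note xL = H_L[OF x(1)]
  have "br y x = 0" if y: "y \<in> L" for y
  proof -
    have "\<psi> (br d (pr y)) x = 0"
      using ad_d_skew[OF pr_H[OF y] x(1)] x(2) H_L[OF pr_H[OF y]] by (simp add: form_right_simps)
    then show ?thesis
      using bracket_formula[OF ind y xL] x by (simp add: pr_id H_z)
  qed
  moreover have "\<psi> x x \<noteq> 0" using nz x(1) H.anisotropic by blast
  moreover have "d \<notin> span {x}"
  proof
    assume "d \<in> span {x}"
    then obtain c where "d = scale c x" by (auto simp: mem_span_singleton)
    then have "\<psi> (scale c x) z = 1" using dz by simp
    then show False using xL x(1) by (simp add: form_left_simps in_L H_z)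
  qed
  ultimately show False using line_not_ideal[OF ind xL] d_in by blast
qed

text \<open>A vector orthogonal to the image of the skew map \<open>ad d\<close> lies in its kernel.\<close>

lemma ad_d_bij:
  assumes ind: "indecomposable"
  shows "bij_betw (br d) H H"
proof (rule bij_betwI')
  fix x y assume V: "x \<in> H" "y \<in> H"
  have "br d (x - y) = br d x - br d y" by (rule H.endo_diff_arg[OF ad_d_endo V])
  then show "br d x = br d y \<longleftrightarrow> x = y"
    using ad_d_injective[OF ind H_closed(3)[OF V]] by auto
next
  show "br d x \<in> H" if "x \<in> H" for x using that by (rule ad_d_H)
next
  fix y assume y: "y \<in> H"
  have W: "subspace (br d ` H)" "br d ` H \<subseteq> H"
  proof -
    show "br d ` H \<subseteq> H" using ad_d_H by blast
    have "0 \<in> br d ` H" using H.endo_zero_arg[OF ad_d_endo] H_closed(1) by force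
    moreover have "a + b \<in> br d ` H" if "a \<in> br d ` H" "b \<in> br d ` H" for a b
      using that H_closed(2) H.endoD(2)[OF ad_d_endo, symmetric] by (auto simp: image_iff)
    moreover have "scale c a \<in> br d ` H" if "a \<in> br d ` H" for a c
      using that H_closed(4) H.endoD(3)[OF ad_d_endo, symmetric] by auto
    ultimately show "subspace (br d ` H)" by (simp add: subspace_def)
  qed
  obtain w where w: "w \<in> br d ` H" "\<forall>v\<in>br d ` H. \<psi> (y - w) v = 0"
    using H.orthogonal_decomposition[OF W y] by blast
  have r: "y - w \<in> H" using y w(1) W(2) by (intro H_closed(3)) auto
  have "\<psi> (br d (y - w)) v = 0" if v: "v \<in> H" for v
    using ad_d_skew[OF r v] w(2) v by simp
  then have "br d (y - w) = 0" using H.nondegenerate[OF ad_d_H[OF r]] by blast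
  then have "y - w = 0" by (rule ad_d_injective[OF ind r])
  then have "y = w" by simp
  then show "\<exists>x\<in>H. y = br d x" using w(1) by blast
qed

text \<open>If \<open>H = 0\<close>, then \<open>L\<close> is an abelian hyperbolic plane, which splits. If \<open>x\<close> is a non-zero vector
  of \<open>H\<close>, then \<open>ad d x\<close> is non-zero and orthogonal to \<open>x\<close>.\<close>

lemma dim_H_ge_2:
  assumes ind: "indecomposable"
  shows "dim H \<ge> 2"
proof -
  have "\<exists>x\<in>H. x \<noteq> 0"
  proof (rule ccontr)
    assume "\<not> ?thesis"
    then have H0: "pr x = 0" if "x \<in> L" for x using pr_H[OF that] by blast
    \<comment> \<open>Any vector of the plane outside the two isotropic lines will do.\<close>
    define e where "e = d + z"
    have e: "e \<in> L" by (simp add: e_def in_L)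
    have d0: "br d 0 = 0" using br_scale_right[OF d_in d_in, of 0] by simp
    have "\<psi> e e = 2" by (simp add: e_def form_left_simps form_right_simps in_L dd zz dz zd)
    moreover have "br y e = 0" if "y \<in> L" for y
      using bracket_formula[OF ind that e] by (simp add: H0 that e d0 form_left_simps carrier_0)
    moreover have "d \<notin> span {e}"
    proof
      assume "d \<in> span {e}"
      then obtain c where c: "d = scale c e" by (auto simp: mem_span_singleton)
      have "\<psi> d (scale c e) = 0" using dd c by simp
      then have "c = 0"
        by (simp add: e_def form_right_simps in_L dd dz)
      then have "d = 0" using c by simp
      then show False using dz z_in by (simp add: form_left_simps)
    qed
    ultimately show False using line_not_ideal[OF ind e _ _ d_in] by simp
  qed
  then obtain x where x: "x \<in> H" "x \<noteq> 0" by blast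
  have xx: "\<psi> x x \<noteq> 0" using x H.anisotropic by blast
  have y: "br d x \<in> H" by (rule ad_d_H[OF x(1)])
  have nin: "br d x \<notin> span {x}"
  proof
    assume "br d x \<in> span {x}"
    then obtain c where c: "br d x = scale c x" by (auto simp: mem_span_singleton)
    have "\<psi> (br d x) x = - \<psi> x (br d x)" by (rule ad_d_skew[OF x(1) x(1)])
    then have "c * \<psi> x x = - (c * \<psi> x x)"
      using H_L[OF x(1)] by (simp add: c form_left_simps form_right_simps)
    then have "c = 0" using xx by (simp add: eq_neg_iff_add_eq_0 flip: mult_2)
    then show False using ad_d_injective[OF ind x(1)] x(2) c by simp
  qed
  then have ind2: "independent {br d x, x}" using x(2) by (intro independent_insertI) (auto simp: independent_empty)
  have card2: "card {br d x, x} = 2" using nin span_base[of x "{x}"] by (metis card_2_iff singletonI)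
  have HL: "H \<subseteq> L" using H_L by blast
  obtain B where B: "finite B" "independent B" "B \<subseteq> H" "span B = H"
    by (rule subspace_basis[OF subspace_H HL])
  have "{br d x, x} \<subseteq> span B" using B(4) x y by simp
  then have "card {br d x, x} \<le> card B" using independent_span_bound[OF B(1) ind2] by blast
  moreover have "dim H = card B"
    using dim_eq_card[of B H] B span_eq_iff[THEN iffD2, OF subspace_H] by metis
  ultimately show ?thesis using card2 by simp
qed

lemma oscillator_H: "indecomposable \<Longrightarrow> oscillator_data scale H \<psi> (br d)"
proof unfold_locales
  assume ind: "indecomposable"
  show "dim H \<ge> 2" by (rule dim_H_ge_2[OF ind])
  show "linear_on_carrier H scale scale (br d)" using ad_d_endo by (simp add: H.endo_def)
  show "bij_betw (br d) H H" by (rule ad_d_bij[OF ind])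
  show "\<psi> (br d x) y = - \<psi> x (br d y)" if "x \<in> H" "y \<in> H" for x y using that by (rule ad_d_skew)
qed

lemma oscillator_isomorphism:
  assumes ind: "indecomposable"
  shows "isometric_isomorphism scale L br \<psi> (osc_scale scale) (osc_carrier H)
    (osc_bracket scale \<psi> (br d)) (osc_form \<psi>) (\<lambda>x. (\<psi> x z, pr x, \<psi> x d))"
proof -
  let ?f = "\<lambda>x. (\<psi> x z, pr x, \<psi> x d)"
  have "linear_on_carrier L scale (osc_scale scale) ?f"
    by (simp add: linear_on_carrier_def osc_scale_def form_left_simps in_L pr_add pr_scale)
  moreover have "bij_betw ?f L (osc_carrier H)"
  proof (rule bij_betwI')
    fix x y
    show "?f x = ?f y \<longleftrightarrow> x = y" using split[of x] split[of y] by auto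
  next
    show "?f x \<in> osc_carrier H" if "x \<in> L" for x using that by (simp add: osc_carrier_def pr_H)
  next
    fix p :: "'k \<times> 'b \<times> 'k" assume "p \<in> osc_carrier H"
    then obtain t h s where p: "p = (t, h, s)" "h \<in> H" by (cases p) (auto simp: osc_carrier_def)
    note hL = H_L[OF p(2)]
    let ?x = "scale t d + h + scale s z"
    have f1: "\<psi> ?x z = t" and f2: "\<psi> ?x d = s"
      using hL p(2) by (simp_all add: form_left_simps in_L dd zz dz zd H_d H_z)
    have "pr ?x = h" unfolding pr_def f1 f2 by simp
    then show "\<exists>x\<in>L. p = ?f x" using hL p(1) f1 f2 by (intro bexI[of _ ?x]) (simp_all add: in_L)
  qed
  moreover have "?f (br x y) = osc_bracket scale \<psi> (br d) (?f x) (?f y)"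
    if x: "x \<in> L" and y: "y \<in> L" for x y
  proof -
    let ?v = "scale (\<psi> x z) (br d (pr y)) - scale (\<psi> y z) (br d (pr x))"
      and ?c = "\<psi> (br d (pr x)) (pr y)"
    have v: "?v \<in> H" using x y by (intro H_closed ad_d_H pr_H)
    have "br x y = ?v + scale ?c z" by (rule bracket_formula[OF ind x y])
    moreover have "\<psi> (?v + scale ?c z) z = 0" "\<psi> (?v + scale ?c z) d = ?c"
      using H_L[OF v] H_z(1)[OF v] H_d(1)[OF v] z_in d_in zz zd carrier_scale[OF z_in]
      by (simp_all add: form_left_simps(1) form_left_simps(3))
    moreover have "pr (?v + scale ?c z) = ?v"
      using H_L[OF v] v carrier_scale[OF z_in] by (simp add: pr_add pr_scale z_in pr_z pr_id)
    ultimately show ?thesis by (simp add: osc_bracket_def)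
  qed
  moreover have "osc_form \<psi> (?f x) (?f y) = \<psi> x y" if x: "x \<in> L" and y: "y \<in> L" for x y
  proof -
    note h = pr_H[OF x] and k = pr_H[OF y]
    note hL = H_L[OF h] and kL = H_L[OF k]
    have "\<psi> x y = \<psi> (scale (\<psi> x z) d + pr x + scale (\<psi> x d) z) (scale (\<psi> y z) d + pr y + scale (\<psi> y d) z)"
      using split[of x] split[of y] by (rule arg_cong2)
    also have "\<dots> = \<psi> x z * \<psi> y d + \<psi> x d * \<psi> y z + \<psi> (pr x) (pr y)"
      using hL kL h k
      by (simp add: form_left_simps form_right_simps in_L H_d H_z dd zz dz zd algebra_simps)
    finally show ?thesis by (simp add: osc_form_def)
  qed
  ultimately show ?thesis unfolding isometric_isomorphism_def by blast
qed

end

section \<open>Existence of the splitting\<close>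

context lie_algebra
begin

lemma ideal_derived:
  assumes "ideal I"
  shows "ideal (derived I)"
proof -
  have I: "subspace I" "I \<subseteq> L" "\<And>x y. x \<in> L \<Longrightarrow> y \<in> I \<Longrightarrow> br x y \<in> I" using assms by (auto simp: ideal_def)
  let ?G = "{br x y | x y. x \<in> I \<and> y \<in> I}"
  have sub: "derived I \<subseteq> L" unfolding derived_def
    using I(2) by (intro span_minimal subspace_L) (auto intro!: br_closed)
  have "br u w \<in> derived I" if u: "u \<in> L" and w: "w \<in> derived I" for u w
  proof -
    have gen: "br u (br x y) \<in> derived I" if "x \<in> I" "y \<in> I" for x y
    proof -
      have "br u (br x y) = br (br u x) y + br x (br u y)" using that I(2) u by (intro br_leibniz) auto
      moreover have "br (br u x) y \<in> derived I" "br x (br u y) \<in> derived I"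
        unfolding derived_def using that I(3)[OF u] by (auto intro!: span_base)
      ultimately show ?thesis using span_add unfolding derived_def by simp
    qed
    have "span ?G \<subseteq> {w\<in>L. br u w \<in> derived I}"
    proof (rule span_minimal)
      show "?G \<subseteq> {w \<in> L. br u w \<in> derived I}" using gen I(2) by (auto intro!: br_closed)
      have "subspace (derived I)" unfolding derived_def by (rule subspace_span)
      moreover have "br u 0 = 0" using br_scale_right[OF u u, of 0] by simp
      ultimately show "subspace {w \<in> L. br u w \<in> derived I}"
        using subspace_L u by (auto simp: subspace_def br_add_right br_scale_right)
    qed
    moreover have "w \<in> span ?G" using w by (simp only: derived_def)
    ultimately show ?thesis by blast
  qed
  then show ?thesis using sub by (auto simp: ideal_def derived_def subspace_span)
qed

lemma not_semisimple_abelian_ideal: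
  assumes "\<not> semisimple"
  obtains A where "ideal A" "A \<noteq> {0}" "\<And>x y. x \<in> A \<Longrightarrow> y \<in> A \<Longrightarrow> br x y = 0"
proof -
  obtain I n where I: "ideal I" "I \<noteq> {0}" "(derived ^^ n) I = {0}"
    using assms by (auto simp: semisimple_def solvable_def)
  define k where "k = (LEAST n. (derived ^^ n) I = {0})"
  have k: "(derived ^^ k) I = {0}" unfolding k_def using I(3) by (rule LeastI)
  have "k \<noteq> 0" using k I(2) by (intro notI) simp
  then obtain j where j: "k = Suc j" by (cases k) auto
  have "(derived ^^ j) I \<noteq> {0}" using not_less_Least[of j "\<lambda>n. (derived ^^ n) I = {0}"] j
    unfolding k_def by (metis lessI)
  moreover have "ideal ((derived ^^ j) I)" for j by (induction j) (simp_all add: I(1) ideal_derived)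
  moreover have "br x y = 0" if "x \<in> (derived ^^ j) I" "y \<in> (derived ^^ j) I" for x y
  proof -
    have "br x y \<in> derived ((derived ^^ j) I)"
      unfolding derived_def[of "(derived ^^ j) I"] using that by (intro span_base) blast
    then show ?thesis using k j by simp
  qed
  ultimately show ?thesis by (intro that[of "(derived ^^ j) I"])
qed

end

context quadratic_lie_algebra
begin

lemma ideal_inter_perp:
  assumes "ideal A"
  shows "ideal (A \<inter> perp A)"
proof -
  have A: "subspace A" "A \<subseteq> L" "\<And>x y. x \<in> L \<Longrightarrow> y \<in> A \<Longrightarrow> br x y \<in> A" using assms by (auto simp: ideal_def)
  have "subspace (perp A)"
    using A(2) by (auto simp: subspace_def perp_def carrier_closed form_left_simps subset_iff)
  then have "subspace (A \<inter> perp A)" by (rule subspace_inter[OF A(1)])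
  moreover have "br x y \<in> perp A" if "x \<in> L" "y \<in> perp A" for x y
    using that A by (auto simp: perp_def br_closed invariant_left subset_iff)
  ultimately show ?thesis using A by (auto simp: ideal_def)
qed

end

lemma exists_non_isotropic:
  fixes scale :: "'k::field_char_0 \<Rightarrow> 'b::ab_group_add \<Rightarrow> 'b"
  assumes "quadratic_space scale V \<phi>" and x: "x \<in> V" "x \<noteq> 0"
  shows "\<exists>e\<in>V. \<phi> e e \<noteq> 0"
proof (rule ccontr)
  interpret quadratic_space scale V \<phi> by fact
  assume n: "\<not> ?thesis"
  have "\<phi> x y = 0" if y: "y \<in> V" for y
  proof -
    have "\<phi> (x + y) (x + y) = \<phi> x x + \<phi> y y + 2 * \<phi> x y"
      using x(1) y form_sym[OF x(1) y] by (simp add: form_simps carrier_closed algebra_simps)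
    then show ?thesis using n x(1) y by (simp add: carrier_closed)
  qed
  then show False using nondegenerate x by blast
qed

text \<open>The last non-zero term \<open>A\<close> of the derived series of a solvable ideal is an abelian ideal.
  By indecomposability \<open>A\<close> meets its orthogonal space, and the intersection is a totally
  isotropic ideal, hence a line by the assumption on the Witt index. Invariance of the form
  makes the line central.\<close>

theorem hyperbolic_splitting_exists:
  fixes scale :: "'k::field_char_0 \<Rightarrow> 'b::ab_group_add \<Rightarrow> 'b"
  assumes "quadratic_lie_algebra scale L br \<psi>"
    and nss: "\<not> lie_algebra.semisimple scale L br"
    and ind: "quadratic_lie_algebra.indecomposable scale L br \<psi>"
    and witt: "witt_index scale L \<psi> = 1"
  obtains d z where "hyperbolic_splitting scale L br \<psi> d z"
proof -
  interpret quadratic_lie_algebra scale L br \<psi> by fact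
  have iso: "\<exists>z\<in>L. z \<noteq> 0 \<and> \<psi> z z = 0"
    and max: "\<And>x y. \<lbrakk>x \<in> L; y \<in> L; x \<noteq> 0; \<psi> x x = 0; \<psi> y y = 0; \<psi> x y = 0\<rbrakk> \<Longrightarrow> \<exists>c. y = scale c x"
    using witt unfolding witt_index_eq_1_iff by blast+
  obtain A where A: "ideal A" "A \<noteq> {0}" "\<And>x y. x \<in> A \<Longrightarrow> y \<in> A \<Longrightarrow> br x y = 0"
  proof (rule not_semisimple_abelian_ideal[OF nss])
    fix A assume *: "ideal A" "A \<noteq> {0}" "\<And>x y. x \<in> A \<Longrightarrow> y \<in> A \<Longrightarrow> br x y = 0"
    show thesis by (rule that[OF *])
  qed
  have AL: "A \<subseteq> L" using A(1) by (simp add: ideal_def)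
  have "A \<noteq> L"
  proof
    assume "A = L"
    obtain w where w: "w \<in> L" "w \<noteq> 0" "\<psi> w w = 0" using iso by blast
    then obtain e where e: "e \<in> L" "\<psi> e e \<noteq> 0" using exists_non_isotropic[OF quadratic_space_axioms w(1,2)] by blast
    have "w \<notin> span {e}"
    proof
      assume "w \<in> span {e}"
      then obtain c where c: "w = scale c e" by (auto simp: mem_span_singleton)
      then have "c \<noteq> 0" using w(2) by auto
      moreover have "c * (c * \<psi> e e) = 0"
        using w(3) e(1) by (simp add: c form_left_simps form_right_simps carrier_closed)
      ultimately show False using e(2) by simp
    qed
    then show False using line_not_ideal[OF ind e _ w(1)] A(3) e(1) \<open>A = L\<close> by blast
  qed
  then have "A \<inter> perp A \<noteq> {0}" using ind A(1,2) unfolding indecomposable_def decomposable_def by blast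
  moreover have K: "ideal (A \<inter> perp A)" by (rule ideal_inter_perp[OF A(1)])
  moreover have "0 \<in> A \<inter> perp A" using K subspace_0 by (auto simp: ideal_def)
  ultimately obtain z where z: "z \<in> A \<inter> perp A" "z \<noteq> 0" by blast
  have zL: "z \<in> L" using z AL by blast
  have isoK: "\<psi> x y = 0" if "x \<in> A \<inter> perp A" "y \<in> A \<inter> perp A" for x y
    using that by (auto simp: perp_def)
  have eigen: "\<exists>c. br x z = scale c z" if "x \<in> L" for x
  proof (rule max[OF zL _ z(2)])
    have b: "br x z \<in> A \<inter> perp A" using K z(1) that by (auto simp: ideal_def)
    then show "br x z \<in> L" using AL by blast
    show "\<psi> z z = 0" "\<psi> (br x z) (br x z) = 0" "\<psi> z (br x z) = 0" using isoK b z(1) by blast+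
  qed
  have zz: "\<psi> z z = 0" using isoK z(1) by blast
  obtain y where y: "y \<in> L" "\<psi> z y \<noteq> 0" using nondegenerate[OF zL] z(2) by blast
  define d0 where "d0 = scale (inverse (\<psi> z y)) y"
  have d0: "d0 \<in> L" "\<psi> d0 z = 1"
    using y zL form_sym[OF zL y(1)] by (simp_all add: d0_def carrier_closed form_left_simps)
  \<comment> \<open>Moving \<open>d0\<close> along \<open>z\<close> makes it isotropic and keeps its product with \<open>z\<close>.\<close>
  define d where "d = d0 - scale (\<psi> d0 d0 / 2) z"
  have d: "d \<in> L" using d0(1) zL by (simp add: d_def carrier_closed)
  have dz: "\<psi> d z = 1" using d0 zL zz by (simp add: d_def form_left_simps carrier_closed)
  have dd: "\<psi> d d = 0"
    using d0 zL zz form_sym[OF zL d0(1)]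
    by (simp add: d_def form_left_simps form_right_simps carrier_closed)
  have bdz: "br d z = 0"
  proof -
    obtain c where c: "br d z = scale c z" using eigen[OF d] by blast
    have "\<psi> (br d z) d = - \<psi> z (br d d)" by (rule invariant_left[OF d zL d])
    then have "c = 0" using d zL dz form_sym[OF zL d] by (simp add: c br_self form_left_simps form_right_simps)
    then show ?thesis using c by simp
  qed
  have "hyperbolic_splitting scale L br \<psi> d z"
  proof unfold_locales
    fix x assume x: "x \<in> L"
    obtain c where c: "br x z = scale c z" using eigen[OF x] by blast
    have "br x z = - br z x" by (rule br_anti[OF x zL])
    then have "\<psi> (br x z) d = - \<psi> (br z x) d" using x zL d by (simp add: form_left_simps br_closed)
    also have "\<dots> = \<psi> x (br z d)" using invariant_left[OF zL x d] by simp
    also have "br z d = 0" using br_anti[OF zL d] bdz by simp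
    finally have "c = 0" using c x zL d dz form_sym[OF zL d] by (simp add: form_left_simps form_right_simps)
    then show "br x z = 0" using c by simp
  next
    fix x assume x: "x \<in> L" "\<psi> x d = 0" "\<psi> x z = 0" "\<psi> x x = 0"
    have "\<psi> z x = 0" using form_sym[OF zL x(1)] x(3) by simp
    then obtain c where c: "x = scale c z" using max[OF zL x(1) z(2) zz x(4)] by blast
    then have "c = 0" using x(2) zL d dz form_sym[OF zL d] by (simp add: form_left_simps)
    then show "x = 0" using c by simp
  qed (fact d zL zz dd dz)+
  then show ?thesis by (rule that)
qed

section \<open>Oscillator algebras over anisotropic spaces\<close>

locale anisotropic_oscillator = oscillator_data scale V \<phi> \<delta>
  for scale :: "'k::field_char_0 \<Rightarrow> 'v::ab_group_add \<Rightarrow> 'v" and V \<phi> \<delta> +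
  assumes anisotropic_V: "\<lbrakk>v \<in> V; v \<noteq> 0\<rbrakk> \<Longrightarrow> \<phi> v v \<noteq> 0"
begin

sublocale skew_endo scale V \<phi> \<delta>
proof unfold_locales
  show "v = 0" if "v \<in> V" "\<phi> v v = 0" for v using that anisotropic_V by blast
qed (fact linear_\<delta> \<delta>_in skew)+

lemma \<delta>_injective: "\<lbrakk>v \<in> V; \<delta> v = 0\<rbrakk> \<Longrightarrow> v = 0"
  using bij_\<delta> \<delta>_zero V_closed(4) by (metis bij_betw_inv_into_left)

lemma exists_nonzero: "\<exists>v\<in>V. v \<noteq> 0"
proof (rule ccontr)
  assume "\<not> ?thesis"
  then have "V = {0}" using V_closed(4) by blast
  then have "dim V = 0" using dim_eq_card[of "{}" V] independent_empty by simp
  then show False using dim_ge_2 by simp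
qed

text \<open>An ideal \<open>J\<close> on which the form is non-degenerate either contains an element with a
  non-zero \<open>\<delta>\<close>-component, and then brackets with \<open>V\<close> produce the whole algebra, or is orthogonal
  to \<open>\<delta>*\<close>; in the latter case any non-zero element yields a non-zero multiple of \<open>\<delta>*\<close> in
  \<open>J\<close>, contrary to non-degeneracy.\<close>

lemma osc_ideal_trivial:
  assumes sub: "J \<subseteq> osc_carrier V"
    and add: "\<And>p q. p \<in> J \<Longrightarrow> q \<in> J \<Longrightarrow> p + q \<in> J"
    and sc: "\<And>c p. p \<in> J \<Longrightarrow> osc_scale scale c p \<in> J"
    and br: "\<And>p q. p \<in> osc_carrier V \<Longrightarrow> q \<in> J \<Longrightarrow> osc_bracket scale \<phi> \<delta> p q \<in> J"
    and nd: "\<And>p. p \<in> J \<Longrightarrow> (\<forall>q\<in>J. osc_form \<phi> p q = 0) \<Longrightarrow> p = 0"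
    and nz: "\<exists>p\<in>J. p \<noteq> 0"
  shows "osc_carrier V \<subseteq> J"
proof (cases "\<exists>p\<in>J. fst p \<noteq> 0")
  case True
  then obtain t x s where p: "(t, x, s) \<in> J" "t \<noteq> 0" by auto
  have x: "x \<in> V" using p(1) sub by (auto simp: osc_carrier_def)
  have b1: "(0, - scale t (\<delta> y), \<phi> (\<delta> y) x) \<in> J" if "y \<in> V" for y
    using br[OF _ p(1), of "(0, y, 0)"] that by (simp add: osc_carrier_def osc_bracket_def)
  obtain v where v: "v \<in> V" "v \<noteq> 0" using exists_nonzero by blast
  define k where "k = \<phi> (\<delta> v) (- scale t (\<delta> v))"
  have k: "k \<noteq> 0"
    using v p(2) \<delta>_injective[of v] anisotropic_V[of "\<delta> v"]
    by (auto simp: k_def form_right_simps \<delta>_in V_closed)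
  have "(0, 0, k) \<in> J"
    using br[OF _ b1[OF v(1)], of "(0, v, 0)"] v(1) by (simp add: osc_carrier_def osc_bracket_def k_def)
  from sc[OF this, of "c / k" for c] have ctr: "(0, 0, c) \<in> J" for c
    using k by (simp add: osc_scale_apply)
  have mid: "(0, y, 0) \<in> J" if y: "y \<in> V" for y
  proof -
    obtain w where w: "w \<in> V" "y = \<delta> w" using y bij_\<delta> by (auto simp: bij_betw_def)
    have "osc_scale scale (- 1 / t) (0, - scale t (\<delta> w), \<phi> (\<delta> w) x) + (0, 0, \<phi> (\<delta> w) x / t) \<in> J"
      by (intro add sc b1 ctr w(1))
    then show ?thesis using p(2) w by (simp add: osc_scale_apply)
  qed
  have top: "(c, 0, 0) \<in> J" for c
  proof -
    have "osc_scale scale (c / t) ((t, x, s) + (0, - x, 0) + (0, 0, - s)) \<in> J"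
      using x by (intro sc add p(1) mid ctr V_closed)
    then show ?thesis using p(2) by (simp add: osc_scale_apply)
  qed
  have "(a, y, c) \<in> J" if "y \<in> V" for a y c
    using add[OF add[OF top[of a] mid[OF that]] ctr[of c]] by simp
  then show ?thesis by (auto simp: osc_carrier_def)
next
  case False
  have no_ctr: "k = 0" if "(0, 0, k) \<in> J" for k
  proof -
    have "osc_form \<phi> (0, 0, k) q = 0" if q: "q \<in> J" for q
    proof -
      obtain a b c where abc: "q = (a, b, c)" by (cases q)
      have "a = 0" "b \<in> V" using q abc False sub by (auto simp: osc_carrier_def)
      then show ?thesis by (simp add: abc osc_form_def form_left_simps)
    qed
    then show ?thesis using nd[OF that] by (simp add: zero_prod_def)
  qed
  obtain t x s where p: "(t, x, s) \<in> J" "(t, x, s) \<noteq> 0" using nz by auto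
  have t: "t = 0" using p False by auto
  have x: "x \<in> V" using p(1) sub by (auto simp: osc_carrier_def)
  have "(0, 0, \<phi> (\<delta> (\<delta> x)) x) \<in> J"
    using br[OF _ p(1), of "(0, \<delta> x, 0)"] x by (simp add: osc_carrier_def osc_bracket_def t \<delta>_in)
  then have "\<phi> (\<delta> (\<delta> x)) x = 0" by (rule no_ctr)
  then have "\<phi> (\<delta> x) (\<delta> x) = 0" using skew[OF \<delta>_in[OF x] x] by simp
  then have "x = 0" using anisotropic_V[of "\<delta> x"] \<delta>_in \<delta>_injective x by blast
  then have "(0, 0, s) \<in> J" "s \<noteq> 0" using p t by (auto simp: zero_prod_def)
  then show ?thesis using no_ctr by blast
qed

text \<open>Two orthogonal isotropic vectors span a totally isotropic subspace. It meets the hyperplane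
  without \<open>\<delta>\<close>-components in the line of \<open>\<delta>*\<close> at most, because \<open>V\<close> is anisotropic, and no vector with
  a \<open>\<delta>\<close>-component is orthogonal to \<open>\<delta>*\<close>.\<close>

lemma osc_isotropic_collinear:
  assumes p: "p \<in> osc_carrier V" "p \<noteq> 0" "osc_form \<phi> p p = 0"
    and q: "q \<in> osc_carrier V" "osc_form \<phi> q q = 0" and pq: "osc_form \<phi> p q = 0"
  shows "\<exists>c. q = osc_scale scale c p"
proof -
  obtain t v s where p': "p = (t, v, s)" "v \<in> V" using p(1) by (cases p) (auto simp: osc_carrier_def)
  obtain t' w s' where q': "q = (t', w, s')" "w \<in> V" using q(1) by (cases q) (auto simp: osc_carrier_def)
  note V = p'(2) q'(2)
  have pp: "2 * (t * s) + \<phi> v v = 0" using p(3) by (simp add: p' osc_form_def mult.commute)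
  have qq: "2 * (t' * s') + \<phi> w w = 0" using q(2) by (simp add: q' osc_form_def mult.commute)
  have pq: "t * s' + s * t' + \<phi> v w = 0" using pq by (simp add: p' q' osc_form_def)
  show ?thesis
  proof (cases "t = 0")
    case True
    then have v: "v = 0" using pp anisotropic_V V by auto
    then have s: "s \<noteq> 0" using p(2) True by (simp add: p' zero_prod_def)
    then have t': "t' = 0" using pq True v V by (simp add: form_left_simps)
    then have "w = 0" using qq anisotropic_V V by auto
    then show ?thesis using s True v t' by (intro exI[of _ "s' / s"]) (simp add: p' q' osc_scale_apply)
  next
    case False
    \<comment> \<open>The combination of \<open>p\<close> and \<open>q\<close> without \<open>\<delta>\<close>-component is isotropic.\<close>
    define u where "u = scale t' v - scale t w"
    have "\<phi> u u = t' * t' * \<phi> v v - 2 * t * t' * \<phi> v w + t * t * \<phi> w w"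
      using V form_sym[of w v]
      by (simp add: u_def form_left_simps form_right_simps V_closed algebra_simps)
    also have "\<dots> = t' * t' * (2 * (t * s) + \<phi> v v) - 2 * t * t' * (t * s' + s * t' + \<phi> v w)
        + t * t * (2 * (t' * s') + \<phi> w w)" by (simp add: algebra_simps)
    also have "\<dots> = 0" by (simp only: pp qq pq mult_zero_right) simp
    finally have "u = 0" using anisotropic_V[of u] V by (auto simp: u_def V_closed)
    then have tw: "scale t w = scale t' v" by (simp add: u_def)
    then have "scale (1 / t) (scale t w) = scale (1 / t) (scale t' v)" by simp
    then have w: "w = scale (t' / t) v" using False by simp
    have "t * (t * s' - t' * s) = t * (t * s' + s * t' + \<phi> v w) - t' * (2 * (t * s) + \<phi> v v)"
      using V False by (simp add: w form_right_simps algebra_simps)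
    then have "t * s' = t' * s" using False by (simp only: pp pq) simp
    then have "s' = t' / t * s" using False by (simp add: field_simps)
    then show ?thesis using w False by (intro exI[of _ "t' / t"]) (simp add: p' q' osc_scale_apply)
  qed
qed

text \<open>The line of \<open>\<delta>*\<close> is a central, hence solvable ideal; indecomposability and the Witt index are
  read off from the two preceding lemmas in the coordinates that \<open>f\<close> provides.\<close>

lemma isometric_conditions:
  fixes scaleL :: "'k \<Rightarrow> 'b::ab_group_add \<Rightarrow> 'b"
  assumes L: "quadratic_lie_algebra scaleL L brL \<psi>"
    and f: "isometric_isomorphism scaleL L brL \<psi> (osc_scale scale) (osc_carrier V)
      (osc_bracket scale \<phi> \<delta>) (osc_form \<phi>) f"
  shows "\<not> lie_algebra.semisimple scaleL L brL"
    and "quadratic_lie_algebra.indecomposable scaleL L brL \<psi>"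
    and "witt_index scaleL L \<psi> = 1"
proof -
  interpret L: quadratic_lie_algebra scaleL L brL \<psi> by (rule L)
  have f_add: "\<And>x y. \<lbrakk>x \<in> L; y \<in> L\<rbrakk> \<Longrightarrow> f (x + y) = f x + f y"
    and f_scale: "\<And>c x. x \<in> L \<Longrightarrow> f (scaleL c x) = osc_scale scale c (f x)"
    and f_bij: "bij_betw f L (osc_carrier V)"
    and f_br: "\<And>x y. \<lbrakk>x \<in> L; y \<in> L\<rbrakk> \<Longrightarrow> f (brL x y) = osc_bracket scale \<phi> \<delta> (f x) (f y)"
    and f_form: "\<And>x y. \<lbrakk>x \<in> L; y \<in> L\<rbrakk> \<Longrightarrow> osc_form \<phi> (f x) (f y) = \<psi> x y"
    using f by (auto simp: isometric_isomorphism_def linear_on_carrier_def)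
  have f_inj: "x = y" if "x \<in> L" "y \<in> L" "f x = f y" for x y
    using that f_bij by (auto simp: bij_betw_def inj_on_def)
  have f_in: "f x \<in> osc_carrier V" if "x \<in> L" for x using that f_bij by (auto simp: bij_betw_def)
  have f_surj: "\<exists>x\<in>L. f x = p" if "p \<in> osc_carrier V" for p
  proof -
    have "p \<in> f ` L" using that f_bij by (simp add: bij_betw_def)
    then show ?thesis by blast
  qed
  have f_0: "f 0 = 0" using f_add[of 0 0] by (simp add: L.carrier_closed)
  obtain z where z: "z \<in> L" "f z = (0, 0, 1)"
    using f_surj[of "(0, 0, 1)"] V_closed(4) by (auto simp: osc_carrier_def)
  have z0: "z \<noteq> 0" using z(2) f_0 by (auto simp: zero_prod_def)
  have ctr: "brL x z = 0" if xL: "x \<in> L" for x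
  proof (rule f_inj)
    obtain t v s where x: "f x = (t, v, s)" "v \<in> V"
      using f_in[OF xL] unfolding osc_carrier_def by blast
    show "f (brL x z) = f 0"
      using xL z(1) x by (simp add: f_br z(2) f_0 osc_bracket_def zero_prod_def \<delta>_zero form_right_simps \<delta>_in)
    show "brL x z \<in> L" using xL z(1) by (rule L.br_closed)
    show "0 \<in> L" by (rule L.carrier_0)
  qed
  show "\<not> L.semisimple"
  proof
    assume "L.semisimple"
    moreover have "L.ideal (L.span {z})"
      using z(1) ctr
      by (auto simp: L.ideal_def L.subspace_span L.mem_span_singleton L.br_scale_right L.carrier_closed
          intro: exI[of _ 0])
    moreover have "L.derived (L.span {z}) = {0}"
    proof -
      have "brL x y = 0" if "x \<in> L.span {z}" "y \<in> L.span {z}" for x y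
        using that z(1) ctr by (auto simp: L.mem_span_singleton L.br_scale_right L.carrier_closed)
      then have "L.derived (L.span {z}) \<subseteq> L.span {0}"
        unfolding L.derived_def by (intro L.span_mono) auto
      then show ?thesis using L.span_zero unfolding L.derived_def by auto
    qed
    then have "L.solvable (L.span {z})" unfolding L.solvable_def by (intro exI[of _ 1]) simp
    ultimately have "L.span {z} = {0}" unfolding L.semisimple_def by blast
    then show False using z0 L.span_base[of z "{z}"] by blast
  qed
  show "L.indecomposable"
    unfolding L.indecomposable_def L.decomposable_def
  proof
    assume "\<exists>I. L.ideal I \<and> I \<noteq> {0} \<and> I \<noteq> L \<and> I \<inter> L.perp I = {0}"
    then obtain I where I: "L.ideal I" "I \<noteq> {0}" "I \<noteq> L" "I \<inter> L.perp I = {0}" by blast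
    have I': "L.subspace I" "I \<subseteq> L" "\<And>x y. x \<in> L \<Longrightarrow> y \<in> I \<Longrightarrow> brL x y \<in> I"
      using I(1) by (auto simp: L.ideal_def)
    have "osc_carrier V \<subseteq> f ` I"
    proof (rule osc_ideal_trivial)
      show "f ` I \<subseteq> osc_carrier V" using I'(2) f_in by blast
    next
      fix p q assume "p \<in> f ` I" "q \<in> f ` I"
      then obtain x y where "x \<in> I" "y \<in> I" "p = f x" "q = f y" by blast
      then show "p + q \<in> f ` I" using I'(2) L.subspace_add[OF I'(1)] by (metis f_add image_eqI subsetD)
    next
      fix c p assume "p \<in> f ` I"
      then obtain x where "x \<in> I" "p = f x" by blast
      then show "osc_scale scale c p \<in> f ` I"
        using I'(2) L.subspace_scale[OF I'(1)] by (metis f_scale image_eqI subsetD)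
    next
      fix p q :: "'k \<times> 'v \<times> 'k" assume "p \<in> osc_carrier V" "q \<in> f ` I"
      then obtain x y where "x \<in> L" "y \<in> I" "p = f x" "q = f y" using f_surj by blast
      then show "osc_bracket scale \<phi> \<delta> p q \<in> f ` I"
        using I'(2,3) by (metis f_br image_eqI subsetD)
    next
      fix p assume "p \<in> f ` I" and 0: "\<forall>q\<in>f ` I. osc_form \<phi> p q = 0"
      then obtain x where x: "x \<in> I" "p = f x" by blast
      have "\<psi> x y = 0" if "y \<in> I" for y
        using 0 x that I'(2) f_form[of x y] by auto
      then have "x \<in> I \<inter> L.perp I" using x(1) I'(2) by (auto simp: L.perp_def)
      then show "p = 0" using I(4) x(2) f_0 by auto
    next
      obtain x where x: "x \<in> I" "x \<noteq> 0" using I(2) L.subspace_0[OF I'(1)] by blast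
      then have "f x \<noteq> 0" using f_inj[of x 0] I'(2) f_0 by (auto simp: L.carrier_closed)
      then show "\<exists>p\<in>f ` I. p \<noteq> 0" using x(1) by blast
    qed
    then have img: "osc_carrier V \<subseteq> f ` I" .
    have "x \<in> I" if x: "x \<in> L" for x
    proof -
      obtain y where y: "y \<in> I" "f x = f y" using f_in[OF x] img by blast
      then show ?thesis using f_inj[OF x, of y] I'(2) by blast
    qed
    then have "L \<subseteq> I" by blast
    then show False using I(3) I'(2) by blast
  qed
  show "witt_index scaleL L \<psi> = 1"
    unfolding L.witt_index_eq_1_iff
  proof (intro conjI ballI impI)
    have "\<psi> z z = 0"
      using f_form[OF z(1) z(1)] V_closed(4) by (simp add: z(2) osc_form_def form_left_simps)
    then show "\<exists>z\<in>L. z \<noteq> 0 \<and> \<psi> z z = 0" using z(1) z0 by blast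
  next
    fix x y assume x: "x \<in> L" and y: "y \<in> L" and "x \<noteq> 0"
      and iso: "\<psi> x x = 0" "\<psi> y y = 0" "\<psi> x y = 0"
    have "f x \<noteq> 0" using f_inj[of x 0] x \<open>x \<noteq> 0\<close> f_0 by (auto simp: L.carrier_closed)
    then obtain c where "f y = osc_scale scale c (f x)"
      using osc_isotropic_collinear[OF f_in[OF x] _ _ f_in[OF y]] f_form x y iso by auto
    then have "f y = f (scaleL c x)" using x by (simp add: f_scale)
    then show "\<exists>c. y = scaleL c x" using f_inj[OF y L.carrier_scale[OF x]] by blast
  qed
qed

end

section \<open>The classification\<close>

theorem theorem4p2:
  fixes scale :: "'k::field_char_0 \<Rightarrow> 'b::ab_group_add \<Rightarrow> 'b"
    and L :: "'b set" and br :: "'b \<Rightarrow> 'b \<Rightarrow> 'b" and \<psi> :: "'b \<Rightarrow> 'b \<Rightarrow> 'k"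
    and vscale :: "'k \<Rightarrow> 'v::ab_group_add \<Rightarrow> 'v"
  assumes "quadratic_lie_algebra scale L br \<psi>"
  shows
   "((\<not> lie_algebra.semisimple scale L br
        \<and> quadratic_lie_algebra.indecomposable scale L br \<psi>
        \<and> witt_index scale L \<psi> = 1)
      \<longleftrightarrow>
      (\<exists>(V :: 'b set) \<phi> \<delta>. oscillator_data scale V \<phi> \<delta>
        \<and> (\<exists>f. isometric_isomorphism scale L br \<psi>
              (osc_scale scale) (osc_carrier V) (osc_bracket scale \<phi> \<delta>) (osc_form \<phi>) f)
        \<and> (\<forall>v\<in>V. v \<noteq> 0 \<longrightarrow> \<phi> v v \<noteq> 0)))
    \<and>
    (\<forall>(V :: 'v set) \<phi> \<delta>. oscillator_data vscale V \<phi> \<delta>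
        \<and> (\<exists>f. isometric_isomorphism scale L br \<psi>
              (osc_scale vscale) (osc_carrier V) (osc_bracket vscale \<phi> \<delta>) (osc_form \<phi>) f)
        \<and> (\<forall>v\<in>V. v \<noteq> 0 \<longrightarrow> \<phi> v v \<noteq> 0)
      \<longrightarrow>
      (\<not> lie_algebra.semisimple scale L br
        \<and> quadratic_lie_algebra.indecomposable scale L br \<psi>
        \<and> witt_index scale L \<psi> = 1)
      \<and> semisimple_map vscale V \<delta>
      \<and> (\<forall>\<pi>. irreducible \<pi> \<and> lead_coeff \<pi> = 1
              \<and> \<pi> dvd minimal_polynomial vscale V \<delta> \<longrightarrow>
            (\<exists>n a. n \<ge> 1 \<and> \<pi> = monom 1 (2 * n) - (\<Sum>i<n. monom (a i) (2 * i)))))"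
    (is "(?a \<longleftrightarrow> ?b) \<and> ?rest")
proof (intro conjI iffI)
  assume ?a
  then have a: "\<not> lie_algebra.semisimple scale L br"
    "quadratic_lie_algebra.indecomposable scale L br \<psi>" "witt_index scale L \<psi> = 1" by blast+
  obtain d z where "hyperbolic_splitting scale L br \<psi> d z"
    using hyperbolic_splitting_exists[OF assms a] by blast
  then interpret hyperbolic_splitting scale L br \<psi> d z .
  show ?b
  proof (intro exI conjI)
    show "oscillator_data scale H \<psi> (br d)" by (rule oscillator_H[OF a(2)])
    show "isometric_isomorphism scale L br \<psi> (osc_scale scale) (osc_carrier H)
      (osc_bracket scale \<psi> (br d)) (osc_form \<psi>) (\<lambda>x. (\<psi> x z, pr x, \<psi> x d))"
      by (rule oscillator_isomorphism[OF a(2)])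
    show "\<forall>v\<in>H. v \<noteq> 0 \<longrightarrow> \<psi> v v \<noteq> 0" using H.anisotropic by blast
  qed
next
  assume ?b
  then obtain V \<phi> \<delta> f where osc: "oscillator_data scale V \<phi> \<delta>" "\<forall>v\<in>V. v \<noteq> 0 \<longrightarrow> \<phi> v v \<noteq> 0"
    and f: "isometric_isomorphism scale L br \<psi>
      (osc_scale scale) (osc_carrier V) (osc_bracket scale \<phi> \<delta>) (osc_form \<phi>) f" by blast
  have "anisotropic_oscillator scale V \<phi> \<delta>"
    using osc by (simp add: anisotropic_oscillator_def anisotropic_oscillator_axioms_def)
  from anisotropic_oscillator.isometric_conditions[OF this assms f]
  show "\<not> lie_algebra.semisimple scale L br" "quadratic_lie_algebra.indecomposable scale L br \<psi>"
    "witt_index scale L \<psi> = 1" .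
next
  show ?rest
  proof (intro allI impI)
    fix V :: "'v set" and \<phi> \<delta>
    assume "oscillator_data vscale V \<phi> \<delta>
        \<and> (\<exists>f. isometric_isomorphism scale L br \<psi>
              (osc_scale vscale) (osc_carrier V) (osc_bracket vscale \<phi> \<delta>) (osc_form \<phi>) f)
        \<and> (\<forall>v\<in>V. v \<noteq> 0 \<longrightarrow> \<phi> v v \<noteq> 0)"
    then obtain f where osc: "oscillator_data vscale V \<phi> \<delta>" "\<forall>v\<in>V. v \<noteq> 0 \<longrightarrow> \<phi> v v \<noteq> 0"
      and f: "isometric_isomorphism scale L br \<psi>
        (osc_scale vscale) (osc_carrier V) (osc_bracket vscale \<phi> \<delta>) (osc_form \<phi>) f" by blast
    have *: "anisotropic_oscillator vscale V \<phi> \<delta>"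
      using osc by (simp add: anisotropic_oscillator_def anisotropic_oscillator_axioms_def)
    interpret anisotropic_oscillator vscale V \<phi> \<delta> by (rule *)
    show "?a \<and> semisimple_map vscale V \<delta>
      \<and> (\<forall>\<pi>. irreducible \<pi> \<and> lead_coeff \<pi> = 1
              \<and> \<pi> dvd minimal_polynomial vscale V \<delta> \<longrightarrow>
            (\<exists>n a. n \<ge> 1 \<and> \<pi> = monom 1 (2 * n) - (\<Sum>i<n. monom (a i) (2 * i))))"
      using isometric_conditions[OF assms f] semisimple_skew
        irreducible_factor_even[OF \<delta>_injective] by blast
  qed
qed

end
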